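(* Let $\sigma\ge 1$, let $0\le a<b$, and let $\hat{\mathcal B}^{(\sigma)}_{[a,b)}$ be the normalized quantum Lévy area of variance parameter $\sigma$ over $[a,b)$. Put $\sigma_{\pm}=\tfrac12(1\pm\sigma^{-2})$. Then all odd moments vanish, $\mathbb E\big[(\hat{\mathcal B}^{(\sigma)}_{[a,b)})^{n}\big]=0$ for every odd $n\ge 1$, and for every integer $m\ge 1$ $$\mathbb E\Big[\big(\hat{\mathcal B}^{(\sigma)}_{[a,b)}\big)^{2m}\Big]=(2m)!\,(b-a)^{2m}\sum\frac{\sigma_-^{2m-k}\,\sigma_+^{k}}{k_1!\,k_2!\cdots k_r!}\prod_{j=1}^{k}\frac{A_{2m_j-1}}{2m_j\,\big((2m_j-1)!\big)^2}\,S_{2m_j-1}\!\left(\frac{\sigma_+}{\sigma_-}\right),$$ where the sum runs over all partitions $m_1+m_2+\dots+m_k=m$ of $m$ (of every length $k\ge 1$) into positive integers $1\le m_1\le m_2\le\dots\le m_k$, and $k_1,\dots,k_r$ are the multiplicities of the distinct elements of the multiset $\{m_1,\dots,m_k\}$. For $\sigma=1$ (where $\sigma_-=0$) the right-hand side is read as the polynomial in $\sigma_+,\sigma_-$ obtained after cancelling denominators.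
   Context: Quantum planar Brownian motion. For $\sigma\ge1$, $(P^{(\sigma)}(t),Q^{(\sigma)}(t))_{t\ge0}$ is a pair of self-adjoint operator-valued processes, each individually a Brownian motion of variance $\sigma^2$ (so $P^{(\sigma)}(t)$ is Gaussian with mean $0$ and variance $\sigma^2t$), with $[P^{(\sigma)}(s),Q^{(\sigma)}(t)]=-2i\min\{s,t\}$ (in the Weyl sense) and Itô multiplication $(dP^{(\sigma)})^2=(dQ^{(\sigma)})^2=\sigma^2dT$, $dP^{(\sigma)}dQ^{(\sigma)}=-i\,dT$, $dQ^{(\sigma)}dP^{(\sigma)}=i\,dT$, all products involving $dT$ being $0$ ($T(x)=x$ is time). Concretely, let $\mathcal F$ be the symmetric Fock space over $L^2(\mathbb R_+)$ with annihilation and creation processes $A(t),A^\dagger(t)$ (those of the indicator function $1_{[0,t)}$), let $c_\pm=\sqrt{\tfrac12(\sigma^2\pm1)}$, and on $\mathcal F\otimes\mathcal F$ set $$Q^{(\sigma)}=c_+\,(A+A^\dagger)\otimes I+c_-\,I\otimes(A+A^\dagger),\qquad P^{(\sigma)}=c_+\,(-i)(A-A^\dagger)\otimes I+c_-\,I\otimes i(A-A^\dagger).$$ The expectation $\mathbb E$ is $\mathbb E[X]=\langle\Omega,X\Omega\rangle$ with $\Omega$ the tensor product of the two Fock vacuum vectors. (For $\sigma=1$ the second factor plays no role.) All operators are considered on finite-particle vectors. Quantum Lévy area. The quantum Lévy area over $[a,b)$ is the Itô-type quantum stochastic integral $$\mathcal B^{(\sigma)}_{[a,b)}=\tfrac12\int_a^b\Big((P^{(\sigma)}-P^{(\sigma)}(a))\,dQ^{(\sigma)}-(Q^{(\sigma)}-Q^{(\sigma)}(a))\,dP^{(\sigma)}\Big),$$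 that is, the limit over partitions $a=t_0<\dots<t_N=b$ with mesh tending to $0$ of $\tfrac12\sum_j\big((P^{(\sigma)}(t_j)-P^{(\sigma)}(a))(Q^{(\sigma)}(t_{j+1})-Q^{(\sigma)}(t_j))-(Q^{(\sigma)}(t_j)-Q^{(\sigma)}(a))(P^{(\sigma)}(t_{j+1})-P^{(\sigma)}(t_j))\big)$, taken on finite-particle vectors. The normalized quantum Lévy area is $\hat{\mathcal B}^{(\sigma)}_{[a,b)}=\sigma^{-2}\mathcal B^{(\sigma)}_{[a,b)}$. Combinatorial notation. $A_n$ is the Euler zigzag number: the number of permutations $\mathfrak s$ of $\{1,\dots,n\}$ with $\mathfrak s(1)>\mathfrak s(2)<\mathfrak s(3)>\mathfrak s(4)<\cdots$ (so $A_1=1$). For a sequence of integers, $\mathrm{des}(j_1,\dots,j_n)=|\{\ell\in\{1,\dots,n-1\}: j_\ell>j_{\ell+1}\}|$. The Euler polynomial is $S_n(\tau)=\sum_{\mathfrak s}\tau^{\mathrm{des}(\mathfrak s(1),\dots,\mathfrak s(n))}$, the sum being over all permutations $\mathfrak s$ of $\{1,\dots,n\}$ ($n\ge1$). *)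

theory Defs
  imports "HOL-Analysis.Analysis" "HOL-Combinatorics.Permutations"
    "HOL-Library.Multiset" "HOL-Library.Function_Algebras"
begin

section \<open>Two copies of the symmetric Fock space over the half-line\<close>

text \<open>
  A vector of the symmetric Fock space over the complex Hilbert space of square integrable
  functions on the half-line is a sequence of components, the \<open>n\<close>-th one being a symmetric
  square integrable function of \<open>n\<close> points. Points are given as extensional functions on
  \<open>{..<n}\<close>, so that the \<open>n\<close>-particle measure is the library's finite product measure.
  Under the usual identification of a tensor product of function spaces with the functions on the
  product, a vector of the tensor square of Fock space is a doubly indexed family of functions of
  two groups of points, symmetric in each of the groups separately.

  Functions stand for their classes modulo null sets. All operators below respect these classes,
  and only inner products and norms are ever observed. Addition and subtraction of vectors and of
  operators are pointwise.
\<close>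

type_synonym fock = "nat \<Rightarrow> (nat \<Rightarrow> real) \<Rightarrow> complex"
type_synonym fock2 = "nat \<Rightarrow> nat \<Rightarrow> (nat \<Rightarrow> real) \<Rightarrow> (nat \<Rightarrow> real) \<Rightarrow> complex"

definition half_line :: "real measure" where
  "half_line = restrict_space lborel {0..}"

definition sector :: "nat \<Rightarrow> nat \<Rightarrow> ((nat \<Rightarrow> real) \<times> (nat \<Rightarrow> real)) measure" where
  "sector m n = (\<Pi>\<^sub>M i\<in>{..<m}. half_line) \<Otimes>\<^sub>M (\<Pi>\<^sub>M i\<in>{..<n}. half_line)"

definition fock_inner :: "fock2 \<Rightarrow> fock2 \<Rightarrow> complex" where
  "fock_inner \<Phi> \<Psi> =
     (\<Sum>\<^sub>\<infinity>(m, n)\<in>UNIV. \<integral>z. cnj (\<Phi> m n (fst z) (snd z)) * \<Psi> m n (fst z) (snd z) \<partial>sector m n)"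

definition fock_norm :: "fock2 \<Rightarrow> real" where
  "fock_norm \<Psi> = sqrt (Re (fock_inner \<Psi> \<Psi>))"

text \<open>
  Symmetry is demanded at every point; each class of almost everywhere symmetric functions has
  such a representative.
\<close>

definition finite_particle :: "fock2 \<Rightarrow> bool" where
  "finite_particle \<Psi> \<longleftrightarrow>
     finite {(m, n). \<Psi> m n \<noteq> 0} \<and>
     (\<forall>m n. (\<lambda>z. \<Psi> m n (fst z) (snd z)) \<in> borel_measurable (sector m n) \<and>
        integrable (sector m n) (\<lambda>z. (cmod (\<Psi> m n (fst z) (snd z)))\<^sup>2) \<and>
        (\<forall>(x, y)\<in>space (sector m n). \<forall>p q. p permutes {..<m} \<longrightarrow> q permutes {..<n} \<longrightarrow>
           \<Psi> m n (x \<circ> p) (y \<circ> q) = \<Psi> m n x y))"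

definition vacuum :: fock2 where
  "vacuum = (\<lambda>m n x y. if m = 0 \<and> n = 0 then 1 else 0)"

definition scale :: "complex \<Rightarrow> fock2 \<Rightarrow> fock2" where
  "scale c \<Psi> = (\<lambda>m n x y. c * \<Psi> m n x y)"


section \<open>Annihilation and creation\<close>

text \<open>By symmetry it does not matter which coordinate is integrated out; it is the last one here.\<close>

definition annihilation :: "(real \<Rightarrow> complex) \<Rightarrow> fock \<Rightarrow> fock" where
  "annihilation f \<psi> =
     (\<lambda>n x. of_real (sqrt (real (Suc n))) * (\<integral>s. cnj (f s) * \<psi> (Suc n) (x(n := s)) \<partial>half_line))"

definition delete_point :: "nat \<Rightarrow> nat \<Rightarrow> (nat \<Rightarrow> real) \<Rightarrow> (nat \<Rightarrow> real)" where
  "delete_point n i x = (\<lambda>j\<in>{..<n - 1}. if j < i then x j else x (Suc j))"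

definition creation :: "(real \<Rightarrow> complex) \<Rightarrow> fock \<Rightarrow> fock" where
  "creation f \<psi> =
     (\<lambda>n x. (\<Sum>i<n. f (x i) * \<psi> (n - 1) (delete_point n i x)) / of_real (sqrt (real n)))"

definition annih :: "real \<Rightarrow> fock \<Rightarrow> fock" where
  "annih t = annihilation (indicator {0..<t})"

definition creat :: "real \<Rightarrow> fock \<Rightarrow> fock" where
  "creat t = creation (indicator {0..<t})"

text \<open>The operators \<open>X \<otimes> I\<close> and \<open>I \<otimes> X\<close>.\<close>

definition on_left :: "(fock \<Rightarrow> fock) \<Rightarrow> fock2 \<Rightarrow> fock2" where
  "on_left X \<Psi> = (\<lambda>m n x y. X (\<lambda>m' x'. \<Psi> m' n x' y) m x)"

definition on_right :: "(fock \<Rightarrow> fock) \<Rightarrow> fock2 \<Rightarrow> fock2" where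
  "on_right X \<Psi> = (\<lambda>m n x y. X (\<lambda>n' y'. \<Psi> m n' x y') n y)"


section \<open>Quantum planar Brownian motion and its area\<close>

definition c_plus :: "real \<Rightarrow> real" where
  "c_plus \<sigma> = sqrt ((\<sigma>\<^sup>2 + 1) / 2)"

definition c_minus :: "real \<Rightarrow> real" where
  "c_minus \<sigma> = sqrt ((\<sigma>\<^sup>2 - 1) / 2)"

definition Q_bm :: "real \<Rightarrow> real \<Rightarrow> fock2 \<Rightarrow> fock2" where
  "Q_bm \<sigma> t = (scale (of_real (c_plus \<sigma>)) \<circ> on_left (annih t + creat t))
         + (scale (of_real (c_minus \<sigma>)) \<circ> on_right (annih t + creat t))"

definition P_bm :: "real \<Rightarrow> real \<Rightarrow> fock2 \<Rightarrow> fock2" where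
  "P_bm \<sigma> t = (scale (of_real (c_plus \<sigma>) * (- \<i>)) \<circ> on_left (annih t - creat t))
         + (scale (of_real (c_minus \<sigma>) * \<i>) \<circ> on_right (annih t - creat t))"

definition is_partition :: "real \<Rightarrow> real \<Rightarrow> nat \<Rightarrow> (nat \<Rightarrow> real) \<Rightarrow> bool" where
  "is_partition a b N t \<longleftrightarrow> t 0 = a \<and> t N = b \<and> (\<forall>j<N. t j < t (Suc j))"

definition area_sum :: "real \<Rightarrow> real \<Rightarrow> nat \<Rightarrow> (nat \<Rightarrow> real) \<Rightarrow> fock2 \<Rightarrow> fock2" where
  "area_sum \<sigma> a N t = scale (1/2) \<circ>
     (\<Sum>j<N. ((P_bm \<sigma> (t j) - P_bm \<sigma> a) \<circ> (Q_bm \<sigma> (t (Suc j)) - Q_bm \<sigma> (t j)))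
           - ((Q_bm \<sigma> (t j) - Q_bm \<sigma> a) \<circ> (P_bm \<sigma> (t (Suc j)) - P_bm \<sigma> (t j))))"

definition area_limit :: "real \<Rightarrow> real \<Rightarrow> real \<Rightarrow> fock2 \<Rightarrow> fock2 \<Rightarrow> bool" where
  "area_limit \<sigma> a b \<Psi> \<Phi> \<longleftrightarrow>
     (\<forall>\<epsilon>>0. \<exists>\<delta>>0. \<forall>N t. is_partition a b N t \<and> (\<forall>j<N. t (Suc j) - t j < \<delta>) \<longrightarrow>
        fock_norm (area_sum \<sigma> a N t \<Psi> - \<Phi>) < \<epsilon>)"

text \<open>
  The limit vector is unique only up to null sets, hence the choice operator; on finite-particle
  vectors different choices agree almost everywhere.
\<close>

definition levy_area :: "real \<Rightarrow> real \<Rightarrow> real \<Rightarrow> fock2 \<Rightarrow> fock2" where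
  "levy_area \<sigma> a b \<Psi> = (SOME \<Phi>. finite_particle \<Phi> \<and> area_limit \<sigma> a b \<Psi> \<Phi>)"

definition normalized_levy_area :: "real \<Rightarrow> real \<Rightarrow> real \<Rightarrow> fock2 \<Rightarrow> fock2" where
  "normalized_levy_area \<sigma> a b = scale (of_real (1 / \<sigma>\<^sup>2)) \<circ> levy_area \<sigma> a b"

definition expect :: "(fock2 \<Rightarrow> fock2) \<Rightarrow> complex" where
  "expect X = fock_inner vacuum (X vacuum)"


section \<open>Combinatorics\<close>

definition zigzag :: "nat \<Rightarrow> nat" where
  "zigzag n = card {s. s permutes {1..n} \<and>
     (\<forall>i\<in>{1..<n}. if odd i then s i > s (Suc i) else s i < s (Suc i))}"

definition des :: "nat \<Rightarrow> (nat \<Rightarrow> nat) \<Rightarrow> nat" where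
  "des n s = card {i\<in>{1..<n}. s i > s (Suc i)}"

definition euler_poly :: "nat \<Rightarrow> real \<Rightarrow> real" where
  "euler_poly n \<tau> = (\<Sum>s | s permutes {1..n}. \<tau> ^ des n s)"

definition partitions :: "nat \<Rightarrow> nat multiset set" where
  "partitions m = {M. 0 \<notin># M \<and> sum_mset M = m}"

definition sigma_plus :: "real \<Rightarrow> real" where
  "sigma_plus \<sigma> = (1 + 1 / \<sigma>\<^sup>2) / 2"

definition sigma_minus :: "real \<Rightarrow> real" where
  "sigma_minus \<sigma> = (1 - 1 / \<sigma>\<^sup>2) / 2"

definition area_moment :: "nat \<Rightarrow> real \<Rightarrow> real \<Rightarrow> real" where
  "area_moment m u v =
     (\<Sum>M\<in>partitions m.
        v ^ (2 * m - size M) * u ^ size M / (\<Prod>j\<in>set_mset M. fact (count M j)) *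
        (\<Prod>j\<in>#M. real (zigzag (2 * j - 1)) / (real (2 * j) * (fact (2 * j - 1))\<^sup>2) *
                 euler_poly (2 * j - 1) (u / v)))"

text \<open>
  The same expression as a polynomial in \<open>u\<close> and \<open>v\<close>. The factor with index \<open>j\<close> absorbs
  \<open>2 * j - 2\<close> powers of \<open>v\<close>, the degree of its Euler polynomial. Over a partition of \<open>m\<close> into \<open>k\<close>
  parts this uses up \<open>2 * m - 2 * k\<close> of the \<open>2 * m - k\<close> powers.
\<close>

definition euler_hom :: "nat \<Rightarrow> real \<Rightarrow> real \<Rightarrow> real" where
  "euler_hom n u v = (\<Sum>s | s permutes {1..n}. u ^ des n s * v ^ (n - 1 - des n s))"

definition area_moment_cancelled :: "nat \<Rightarrow> real \<Rightarrow> real \<Rightarrow> real" where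
  "area_moment_cancelled m u v =
     (\<Sum>M\<in>partitions m.
        v ^ size M * u ^ size M / (\<Prod>j\<in>set_mset M. fact (count M j)) *
        (\<Prod>j\<in>#M. real (zigzag (2 * j - 1)) / (real (2 * j) * (fact (2 * j - 1))\<^sup>2) *
                 euler_hom (2 * j - 1) u v))"

lemma des_le: "des n s \<le> n - 1"
proof -
  have "des n s \<le> card {1..<n}"
    unfolding des_def by (rule card_mono) auto
  thus ?thesis by simp
qed

lemma euler_hom_eq:
  assumes "v \<noteq> 0"
  shows "euler_hom n u v = v ^ (n - 1) * euler_poly n (u / v)"
proof -
  have "u ^ des n s * v ^ (n - 1 - des n s) = v ^ (n - 1) * (u / v) ^ des n s" for s
  proof -
    have "v ^ (n - 1) = v ^ (n - 1 - des n s) * v ^ des n s"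
      using des_le[of n s] by (metis le_add_diff_inverse2 power_add)
    thus ?thesis using assms by (simp add: power_divide)
  qed
  thus ?thesis by (simp add: euler_hom_def euler_poly_def sum_distrib_left)
qed

lemma power_absorb:
  fixes v :: real
  assumes "0 \<notin># M"
  shows "size M \<le> sum_mset M"
    and "(\<Prod>j\<in>#M. g j * (v ^ (2 * j - 2) * h j)) =
         v ^ (2 * sum_mset M - 2 * size M) * (\<Prod>j\<in>#M. g j * h j)"
  using assms
proof (induction M)
  case (add x M)
  {
    case 1
    then show ?case using add by simp
  next
    case 2
    then have le: "size M \<le> sum_mset M" and "x \<ge> 1" using add by auto
    then have "2 * sum_mset (add_mset x M) - 2 * size (add_mset x M)
                 = (2 * x - 2) + (2 * sum_mset M - 2 * size M)" by simp
    then have "v ^ (2 * sum_mset (add_mset x M) - 2 * size (add_mset x M))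
                 = v ^ (2 * x - 2) * v ^ (2 * sum_mset M - 2 * size M)"
      by (simp only: power_add)
    moreover have "0 \<notin># M" using 2 by simp
    note IH = add.IH(2)[OF this]
    ultimately show ?case
      by (simp only: image_mset_add_mset prod_mset.add_mset IH) (simp only: mult_ac)
  }
qed auto

lemma area_moment_cancelled_eq:
  assumes "v \<noteq> 0"
  shows "area_moment_cancelled m u v = area_moment m u v"
  unfolding area_moment_cancelled_def area_moment_def
proof (rule sum.cong[OF refl])
  fix M assume "M \<in> partitions m"
  then have M: "0 \<notin># M" "sum_mset M = m" by (auto simp: partitions_def)
  let ?c = "\<lambda>j. real (zigzag (2 * j - 1)) / (real (2 * j) * (fact (2 * j - 1))\<^sup>2)"
  let ?S = "\<lambda>j. euler_poly (2 * j - 1) (u / v)"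
  have "2 * j - Suc 0 - Suc 0 = 2 * j - 2" for j :: nat by simp
  then have "(\<Prod>j\<in>#M. ?c j * euler_hom (2 * j - 1) u v) = (\<Prod>j\<in>#M. ?c j * (v ^ (2 * j - 2) * ?S j))"
    by (simp add: euler_hom_eq[OF assms])
  also have "\<dots> = v ^ (2 * m - 2 * size M) * (\<Prod>j\<in>#M. ?c j * ?S j)"
    using power_absorb(2)[OF M(1), of ?c v ?S] M(2) by simp
  finally have eq: "(\<Prod>j\<in>#M. ?c j * euler_hom (2 * j - 1) u v) =
      v ^ (2 * m - 2 * size M) * (\<Prod>j\<in>#M. ?c j * ?S j)" .
  have "2 * m - size M = size M + (2 * m - 2 * size M)"
    using power_absorb(1)[OF M(1)] M(2) by simp
  then have "v ^ (2 * m - size M) = v ^ size M * v ^ (2 * m - 2 * size M)"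
    by (simp only: power_add)
  then show "v ^ size M * u ^ size M / (\<Prod>j\<in>set_mset M. fact (count M j)) *
      (\<Prod>j\<in>#M. ?c j * euler_hom (2 * j - 1) u v) =
      v ^ (2 * m - size M) * u ^ size M / (\<Prod>j\<in>set_mset M. fact (count M j)) *
      (\<Prod>j\<in>#M. ?c j * ?S j)"
    unfolding eq by (simp add: mult_ac)
qed

end

theory Submission
  imports Defs
begin

unbundle no vec_syntax
unbundle fps_syntax

(*PART1*)
definition coeff_bounded :: "('z \<Rightarrow> complex fps) \<Rightarrow> bool" where
  "coeff_bounded g \<longleftrightarrow> (\<forall>n. \<exists>B. \<forall>z. cmod (g z $ n) \<le> B)"

definition coeff_measurable :: "('z::topological_space \<Rightarrow> complex fps) \<Rightarrow> bool" where
  "coeff_measurable g \<longleftrightarrow> (\<forall>n. (\<lambda>z. g z $ n) \<in> borel_measurable borel)"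

definition coeff_tendsto :: "(nat \<Rightarrow> complex fps) \<Rightarrow> complex fps \<Rightarrow> bool" where
  "coeff_tendsto g l \<longleftrightarrow> (\<forall>n. (\<lambda>k. g k $ n) \<longlonglongrightarrow> l $ n)"

lemma coeff_bounded_const [simp]: "coeff_bounded (\<lambda>z. c)"
  by (auto simp: coeff_bounded_def)

lemma coeff_bounded_add:
  assumes "coeff_bounded f" "coeff_bounded g" shows "coeff_bounded (\<lambda>z. f z + g z)"
  unfolding coeff_bounded_def
proof
  fix n
  obtain A where "\<And>z. cmod (f z $ n) \<le> A" using assms(1) unfolding coeff_bounded_def by blast
  moreover obtain B where "\<And>z. cmod (g z $ n) \<le> B" using assms(2) unfolding coeff_bounded_def by blast
  ultimately have "cmod ((f z + g z) $ n) \<le> A + B" for z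
    by (simp add: norm_triangle_mono)
  then show "\<exists>B. \<forall>z. cmod ((f z + g z) $ n) \<le> B" by blast
qed

lemma coeff_bounded_mult:
  assumes "coeff_bounded f" "coeff_bounded g" shows "coeff_bounded (\<lambda>z. f z * g z)"
  unfolding coeff_bounded_def
proof
  fix n
  obtain A where A: "\<And>n z. cmod (f z $ n) \<le> A n"
    using choice[OF assms(1)[unfolded coeff_bounded_def]] by blast
  obtain B where B: "\<And>n z. cmod (g z $ n) \<le> B n"
    using choice[OF assms(2)[unfolded coeff_bounded_def]] by blast
  note AB = A B
  have A0: "A n \<ge> 0" for n by (rule order_trans[OF norm_ge_zero AB(1)])
  have "cmod ((f z * g z) $ n) \<le> (\<Sum>i=0..n. A i * B (n - i))" for z
    unfolding fps_mult_nth
    by (rule sum_norm_le) (simp add: norm_mult mult_mono AB A0)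
  then show "\<exists>B. \<forall>z. cmod ((f z * g z) $ n) \<le> B" by blast
qed

lemma coeff_bounded_sum:
  assumes "\<And>i. i \<in> A \<Longrightarrow> coeff_bounded (f i)" shows "coeff_bounded (\<lambda>z. \<Sum>i\<in>A. f i z)"
  using assms by (induction A rule: infinite_finite_induct) (auto intro!: coeff_bounded_add)

lemma coeff_bounded_prod:
  assumes "\<And>i. i \<in> A \<Longrightarrow> coeff_bounded (f i)" shows "coeff_bounded (\<lambda>z. \<Prod>i\<in>A. f i z)"
  using assms by (induction A rule: infinite_finite_induct) (auto intro!: coeff_bounded_mult)

lemma coeff_bounded_diff:
  assumes "coeff_bounded f" "coeff_bounded g" shows "coeff_bounded (\<lambda>z. f z - g z)"
  using coeff_bounded_add[OF assms(1) coeff_bounded_mult[OF coeff_bounded_const[of "-1"] assms(2)]]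
  by simp

lemma coeff_bounded_compose: "coeff_bounded f \<Longrightarrow> coeff_bounded (\<lambda>z. f (h z))"
  unfolding coeff_bounded_def by blast

lemma coeff_measurable_const [simp]: "coeff_measurable (\<lambda>z. c)"
  by (auto simp: coeff_measurable_def)

lemma coeff_measurable_add:
  assumes "coeff_measurable f" "coeff_measurable g" shows "coeff_measurable (\<lambda>z. f z + g z)"
  using assms unfolding coeff_measurable_def by (simp add: borel_measurable_add)

lemma coeff_measurable_mult:
  assumes "coeff_measurable f" "coeff_measurable g" shows "coeff_measurable (\<lambda>z. f z * g z)"
  using assms unfolding coeff_measurable_def fps_mult_nth
  by (intro allI borel_measurable_sum borel_measurable_times) auto

lemma coeff_measurable_diff:
  assumes "coeff_measurable f" "coeff_measurable g" shows "coeff_measurable (\<lambda>z. f z - g z)"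
  using assms unfolding coeff_measurable_def by (simp add: borel_measurable_diff)

lemma coeff_measurable_sum:
  assumes "\<And>i. i \<in> A \<Longrightarrow> coeff_measurable (f i)" shows "coeff_measurable (\<lambda>z. \<Sum>i\<in>A. f i z)"
  using assms by (induction A rule: infinite_finite_induct) (auto intro!: coeff_measurable_add)

lemma coeff_measurable_prod:
  assumes "\<And>i. i \<in> A \<Longrightarrow> coeff_measurable (f i)" shows "coeff_measurable (\<lambda>z. \<Prod>i\<in>A. f i z)"
  using assms by (induction A rule: infinite_finite_induct) (auto intro!: coeff_measurable_mult)

lemma coeff_measurable_compose:
  assumes "coeff_measurable f" "continuous_on UNIV h" shows "coeff_measurable (\<lambda>z. f (h z))"
  unfolding coeff_measurable_def
proof
  fix n
  have "(\<lambda>w. f w $ n) \<in> borel_measurable borel" "h \<in> borel_measurable borel"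
    using assms borel_measurable_continuous_onI unfolding coeff_measurable_def by blast+
  then show "(\<lambda>z. f (h z) $ n) \<in> borel_measurable borel"
    by (rule measurable_compose[rotated])
qed

lemma coeff_tendsto_const [simp]: "coeff_tendsto (\<lambda>k. c) c"
  by (simp add: coeff_tendsto_def)

lemma coeff_tendsto_add:
  assumes "coeff_tendsto f l" "coeff_tendsto g m" shows "coeff_tendsto (\<lambda>k. f k + g k) (l + m)"
  using assms unfolding coeff_tendsto_def by (auto intro!: tendsto_intros)

lemma coeff_tendsto_mult:
  assumes "coeff_tendsto f l" "coeff_tendsto g m" shows "coeff_tendsto (\<lambda>k. f k * g k) (l * m)"
  using assms unfolding coeff_tendsto_def fps_mult_nth by (auto intro!: tendsto_intros)

lemma coeff_tendsto_sum:
  assumes "\<And>i. i \<in> A \<Longrightarrow> coeff_tendsto (f i) (l i)"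
  shows "coeff_tendsto (\<lambda>k. \<Sum>i\<in>A. f i k) (\<Sum>i\<in>A. l i)"
  using assms by (induction A rule: infinite_finite_induct) (auto intro!: coeff_tendsto_add)

lemma sigma_finite_half_line: "sigma_finite_measure half_line"
  unfolding half_line_def
  by (rule sigma_finite_measure_restrict_space) (auto intro: sigma_finite_lborel)

interpretation half_line: sigma_finite_measure half_line
  by (rule sigma_finite_half_line)

lemma borel_imp_half_line:
  "f \<in> borel_measurable borel \<Longrightarrow> f \<in> borel_measurable half_line"
  unfolding half_line_def by (rule measurable_restrict_space1) simp

lemma id_pair_borel_half_line: "(\<lambda>p. p) \<in> borel \<Otimes>\<^sub>M half_line \<rightarrow>\<^sub>M borel \<Otimes>\<^sub>M (borel :: real measure)"
proof -
  have "(\<lambda>p. (fst p, snd p)) \<in> borel \<Otimes>\<^sub>M half_line \<rightarrow>\<^sub>M borel \<Otimes>\<^sub>M (borel :: real measure)"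
    by (intro measurable_Pair measurable_fst measurable_compose[OF measurable_snd] borel_imp_half_line) simp
  then show ?thesis by simp
qed

lemma id_pair_half_line: "(\<lambda>p. p) \<in> half_line \<Otimes>\<^sub>M half_line \<rightarrow>\<^sub>M borel \<Otimes>\<^sub>M (borel :: real measure)"
proof -
  have "(\<lambda>p. (fst p, snd p)) \<in> half_line \<Otimes>\<^sub>M half_line \<rightarrow>\<^sub>M borel \<Otimes>\<^sub>M (borel :: real measure)"
    by (intro measurable_Pair measurable_compose[OF measurable_fst] measurable_compose[OF measurable_snd]
          borel_imp_half_line) simp_all
  then show ?thesis by simp
qed

lemma space_half_line [simp]: "space half_line = {0..}"
  by (simp add: half_line_def space_restrict_space)

lemma emeasure_half_line_interval:
  "emeasure half_line ({a..<b} \<inter> {0..}) \<le> ennreal (b - a)"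
proof (cases "a \<le> b")
  case True
  have "emeasure half_line ({a..<b} \<inter> {0..}) = emeasure lborel ({a..<b} \<inter> {0..})"
    unfolding half_line_def by (rule emeasure_restrict_space) auto
  also have "\<dots> \<le> emeasure lborel {a..<b}" by (rule emeasure_mono) auto
  finally show ?thesis using True by simp
next
  case False
  then have "{a..<b} \<inter> {0..} = {}" by auto
  then show ?thesis by simp
qed

lemma finite_half_line_interval: "emeasure half_line ({a..<b} \<inter> {0..}) < \<infinity>"
  unfolding infinity_ennreal_def
  by (rule le_less_trans[OF emeasure_half_line_interval ennreal_less_top])

lemma sets_half_line_interval: "{a..<b} \<inter> {0..} \<in> sets half_line"
  unfolding half_line_def sets_restrict_space by (rule image_eqI[of _ _ "{a..<b}"]) (simp_all add: Int_commute)

definition coeff_integrable :: "(real \<Rightarrow> complex fps) \<Rightarrow> bool" where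
  "coeff_integrable f \<longleftrightarrow> (\<forall>n. integrable half_line (\<lambda>s. f s $ n))"

definition coeff_integral :: "(real \<Rightarrow> complex fps) \<Rightarrow> complex fps" where
  "coeff_integral f = Abs_fps (\<lambda>n. \<integral>s. f s $ n \<partial>half_line)"

lemma coeff_integral_nth [simp]: "coeff_integral f $ n = (\<integral>s. f s $ n \<partial>half_line)"
  by (simp add: coeff_integral_def)

lemma coeff_integrableI:
  assumes "coeff_measurable f" "coeff_bounded f" "\<And>s. s \<notin> {a..<b} \<Longrightarrow> f s = 0"
  shows "coeff_integrable f"
  unfolding coeff_integrable_def
proof
  fix n
  obtain B where B: "\<And>s. cmod (f s $ n) \<le> B" using assms(2) unfolding coeff_bounded_def by blast
  have m: "{a..<b} \<inter> {0..} \<in> sets half_line" by (rule sets_half_line_interval)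
  show "integrable half_line (\<lambda>s. f s $ n)"
  proof (rule integrableI_bounded_set[OF m])
    show "(\<lambda>s. f s $ n) \<in> borel_measurable half_line"
      using assms(1) borel_imp_half_line unfolding coeff_measurable_def by blast
    show "emeasure half_line ({a..<b} \<inter> {0..}) < \<infinity>"
      by (rule finite_half_line_interval)
  qed (use B assms(3) in \<open>auto intro!: AE_I2\<close>)
qed

lemma coeff_integrable_add:
  "coeff_integrable f \<Longrightarrow> coeff_integrable g \<Longrightarrow> coeff_integrable (\<lambda>s. f s + g s)"
  by (auto simp: coeff_integrable_def)

lemma coeff_integrable_cmult:
  "coeff_integrable f \<Longrightarrow> coeff_integrable (\<lambda>s. c * f s)"
  by (auto simp: coeff_integrable_def fps_mult_nth)

lemma coeff_integrable_sum:
  "(\<And>i. i \<in> A \<Longrightarrow> coeff_integrable (f i)) \<Longrightarrow> coeff_integrable (\<lambda>s. \<Sum>i\<in>A. f i s)"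
  by (auto simp: coeff_integrable_def fps_sum_nth)

lemma coeff_integral_zero [simp]: "coeff_integral (\<lambda>s. 0) = 0"
  by (rule fps_ext) simp

lemma coeff_integral_add:
  "coeff_integrable f \<Longrightarrow> coeff_integrable g \<Longrightarrow>
   coeff_integral (\<lambda>s. f s + g s) = coeff_integral f + coeff_integral g"
  by (rule fps_ext) (simp add: coeff_integrable_def)

lemma coeff_integral_diff:
  "coeff_integrable f \<Longrightarrow> coeff_integrable g \<Longrightarrow>
   coeff_integral (\<lambda>s. f s - g s) = coeff_integral f - coeff_integral g"
  by (rule fps_ext) (simp add: coeff_integrable_def)

lemma coeff_integral_cmult:
  "coeff_integrable f \<Longrightarrow> coeff_integral (\<lambda>s. c * f s) = c * coeff_integral f"
  by (rule fps_ext) (simp add: coeff_integrable_def fps_mult_nth)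

lemma coeff_integral_sum:
  "(\<And>i. i \<in> A \<Longrightarrow> coeff_integrable (f i)) \<Longrightarrow>
   coeff_integral (\<lambda>s. \<Sum>i\<in>A. f i s) = (\<Sum>i\<in>A. coeff_integral (f i))"
  by (rule fps_ext) (simp add: coeff_integrable_def fps_sum_nth)

lemma coeff_integral_const_nth:
  assumes "\<And>s. f s = fps_const (g s)"
  shows "coeff_integral f = fps_const (\<integral>s. g s \<partial>half_line)"
  by (rule fps_ext) (simp add: assms)

text \<open>Integrals over the half-line of coefficientwise bounded functions.\<close>

lemma coeff_bounded_coeff_integral:
  assumes g: "coeff_bounded (\<lambda>(z, s). g z s)" and supp: "\<And>z s. s \<notin> {a..<b} \<Longrightarrow> g z s = 0"
  shows "coeff_bounded (\<lambda>z. coeff_integral (g z))"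
  unfolding coeff_bounded_def
proof
  fix n
  obtain B where B: "\<And>z s. cmod (g z s $ n) \<le> B"
    using g unfolding coeff_bounded_def by force
  have B0: "B \<ge> 0" using B norm_ge_zero order_trans by blast
  have m: "{a..<b} \<inter> {0..} \<in> sets half_line" by (rule sets_half_line_interval)
  have fin: "emeasure half_line ({a..<b} \<inter> {0..}) < \<infinity>"
    by (rule finite_half_line_interval)
  have "cmod (coeff_integral (g z) $ n) \<le> B * measure half_line ({a..<b} \<inter> {0..})" for z
  proof (cases "integrable half_line (\<lambda>s. g z s $ n)")
    case True
    have "cmod (\<integral>s. g z s $ n \<partial>half_line) \<le> (\<integral>s. cmod (g z s $ n) \<partial>half_line)" by simp
    also have "\<dots> \<le> (\<integral>s. B * indicator ({a..<b} \<inter> {0..}) s \<partial>half_line)"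
    proof (rule integral_mono_AE)
      show "integrable half_line (\<lambda>s. B * indicator ({a..<b} \<inter> {0..}) s)"
        using m fin by (intro integrable_mult_right) simp
      show "AE s in half_line. cmod (g z s $ n) \<le> B * indicator ({a..<b} \<inter> {0..}) s"
        using B supp[of _ z] by (intro AE_I2) (auto simp: indicator_def)
    qed (use True in simp)
    also have "\<dots> = B * measure half_line ({a..<b} \<inter> {0..})"
      using m by (simp add: Int_assoc)
    finally show ?thesis by simp
  next
    case False
    then show ?thesis using B0 by (simp add: not_integrable_integral_eq)
  qed
  then show "\<exists>B. \<forall>z. cmod (coeff_integral (g z) $ n) \<le> B" by blast
qed

lemma coeff_measurable_coeff_integral:
  fixes g :: "'z::second_countable_topology \<Rightarrow> real \<Rightarrow> complex fps"
  assumes "coeff_measurable (\<lambda>(z, s). g z s)"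
  shows "coeff_measurable (\<lambda>z. coeff_integral (g z))"
  unfolding coeff_measurable_def
proof
  fix n
  have "(\<lambda>(z, s). g z s $ n) \<in> borel_measurable (borel \<Otimes>\<^sub>M borel)"
    using assms unfolding coeff_measurable_def by (simp add: borel_prod case_prod_unfold)
  then have "(\<lambda>(z, s). g z s $ n) \<in> borel_measurable (borel \<Otimes>\<^sub>M half_line)"
    by (rule measurable_compose[OF id_pair_borel_half_line])
  then show "(\<lambda>z. coeff_integral (g z) $ n) \<in> borel_measurable borel"
    unfolding coeff_integral_nth by (rule half_line.borel_measurable_lebesgue_integral)
qed

lemma coeff_tendsto_coeff_integral:
  assumes m: "\<And>k. coeff_measurable (g k)" and bd: "coeff_bounded (\<lambda>(k, s). g k s)"
    and supp: "\<And>k s. s \<notin> {a..<b} \<Longrightarrow> g k s = 0"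
    and lim: "\<And>s. coeff_tendsto (\<lambda>k. g k s) (l s)"
  shows "coeff_tendsto (\<lambda>k. coeff_integral (g k)) (coeff_integral l)"
  unfolding coeff_tendsto_def coeff_integral_nth
proof
  fix n
  obtain B where B: "\<And>k s. cmod (g k s $ n) \<le> B"
    using bd unfolding coeff_bounded_def by force
  have ms: "{a..<b} \<inter> {0..} \<in> sets half_line" by (rule sets_half_line_interval)
  have fin: "emeasure half_line ({a..<b} \<inter> {0..}) < \<infinity>"
    by (rule finite_half_line_interval)
  have mk: "(\<lambda>s. g k s $ n) \<in> borel_measurable borel" for k
    using m unfolding coeff_measurable_def by blast
  have lim': "(\<lambda>k. g k s $ n) \<longlonglongrightarrow> l s $ n" for s
    using lim unfolding coeff_tendsto_def by blast
  show "(\<lambda>k. \<integral>s. g k s $ n \<partial>half_line) \<longlonglongrightarrow> (\<integral>s. l s $ n \<partial>half_line)"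
  proof (rule integral_dominated_convergence)
    show "integrable half_line (\<lambda>s. B * indicator ({a..<b} \<inter> {0..}) s)"
      using ms fin by (intro integrable_mult_right) simp
    show "(\<lambda>s. l s $ n) \<in> borel_measurable half_line"
      by (rule borel_imp_half_line, rule borel_measurable_LIMSEQ_metric[OF mk]) (rule lim')
    show "AE s in half_line. cmod (g k s $ n) \<le> B * indicator ({a..<b} \<inter> {0..}) s" for k
      using B supp[of _ k] by (intro AE_I2) (auto simp: indicator_def)
  qed (use mk lim' borel_imp_half_line in auto)
qed

lemma coeff_integral_swap:
  fixes g :: "real \<Rightarrow> real \<Rightarrow> complex fps"
  assumes m: "coeff_measurable (\<lambda>(s, t). g s t)" and bd: "coeff_bounded (\<lambda>(s, t). g s t)"
    and supp: "\<And>s t. s \<notin> {a..<b} \<or> t \<notin> {a..<b} \<Longrightarrow> g s t = 0"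
  shows "coeff_integral (\<lambda>s. coeff_integral (g s)) = coeff_integral (\<lambda>t. coeff_integral (\<lambda>s. g s t))"
proof (rule fps_ext)
  fix n
  interpret pair_sigma_finite half_line half_line ..
  obtain B where B: "\<And>s t. cmod (g s t $ n) \<le> B"
    using bd unfolding coeff_bounded_def by force
  have ms: "{a..<b} \<inter> {0..} \<in> sets half_line" by (rule sets_half_line_interval)
  have fin: "emeasure half_line ({a..<b} \<inter> {0..}) < \<infinity>"
    by (rule finite_half_line_interval)
  let ?A = "({a..<b} \<inter> {0..}) \<times> ({a..<b} \<inter> {0..})"
  have "integrable (half_line \<Otimes>\<^sub>M half_line) (\<lambda>(s, t). g s t $ n)"
  proof (rule integrableI_bounded_set[of ?A])
    show "?A \<in> sets (half_line \<Otimes>\<^sub>M half_line)" using ms by auto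
    show "emeasure (half_line \<Otimes>\<^sub>M half_line) ?A < \<infinity>"
      using ms fin by (simp add: half_line.emeasure_pair_measure_Times ennreal_mult_less_top)
    have "(\<lambda>(s, t). g s t $ n) \<in> borel_measurable (borel \<Otimes>\<^sub>M borel)"
      using m unfolding coeff_measurable_def by (simp add: borel_prod case_prod_unfold)
    then show "(\<lambda>(s, t). g s t $ n) \<in> borel_measurable (half_line \<Otimes>\<^sub>M half_line)"
      by (rule measurable_compose[OF id_pair_half_line])
  next
    show "AE z in half_line \<Otimes>\<^sub>M half_line. z \<notin> ?A \<longrightarrow> (case z of (s, t) \<Rightarrow> g s t $ n) = 0"
    proof (rule AE_I2, rule impI)
      fix z assume "z \<in> space (half_line \<Otimes>\<^sub>M half_line)" and "z \<notin> ?A"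
      moreover from this(1) have "fst z \<ge> 0" "snd z \<ge> 0" by (auto simp: space_pair_measure)
      ultimately have "fst z \<notin> {a..<b} \<or> snd z \<notin> {a..<b}"
        by (auto simp: mem_Times_iff)
      then show "(case z of (s, t) \<Rightarrow> g s t $ n) = 0"
        using supp[of "fst z" "snd z"] by (simp add: case_prod_unfold)
    qed
  qed (use B in \<open>auto intro!: AE_I2\<close>)
  from Fubini_integral[OF this]
  show "coeff_integral (\<lambda>s. coeff_integral (g s)) $ n = coeff_integral (\<lambda>t. coeff_integral (\<lambda>s. g s t)) $ n"
    by simp
qed

(*PART2*)
lemma permutes_lt: "\<pi> permutes {..<p::nat} \<Longrightarrow> i < p \<Longrightarrow> \<pi> i < p"
  using permutes_in_image[of \<pi> "{..<p}" i] by simp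

definition skip :: "nat \<Rightarrow> nat \<Rightarrow> nat" where
  "skip i r = (if r < i then r else Suc r)"

definition permanent :: "nat \<Rightarrow> (nat \<Rightarrow> nat \<Rightarrow> 'a::comm_ring_1) \<Rightarrow> 'a" where
  "permanent p m = (\<Sum>\<pi> | \<pi> permutes {..<p}. \<Prod>i<p. m i (\<pi> i))"

definition permanent_minor :: "nat \<Rightarrow> nat \<Rightarrow> nat \<Rightarrow> (nat \<Rightarrow> nat \<Rightarrow> 'a::comm_ring_1) \<Rightarrow> 'a" where
  "permanent_minor p i j m = permanent p (\<lambda>r s. m (skip i r) (skip j s))"

lemma permanent_0 [simp]: "permanent 0 m = 1"
  by (simp add: permanent_def permutes_empty)

lemma permanent_cong:
  assumes "\<And>i j. i < p \<Longrightarrow> j < p \<Longrightarrow> m i j = m' i j"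
  shows "permanent p m = permanent p m'"
  unfolding permanent_def
  by (intro sum.cong prod.cong refl assms) (auto dest: permutes_in_image)

lemma permanent_permute:
  assumes \<sigma>: "\<sigma> permutes {..<p}" and \<tau>: "\<tau> permutes {..<p}"
  shows "permanent p (\<lambda>i j. m (\<sigma> i) (\<tau> j)) = permanent p m"
proof -
  have "permanent p (\<lambda>i j. m (\<sigma> i) (\<tau> j)) = (\<Sum>\<pi> | \<pi> permutes {..<p}. \<Prod>i<p. m (\<sigma> i) ((\<tau> \<circ> \<pi>) i))"
    by (simp add: permanent_def)
  also have "\<dots> = (\<Sum>\<pi> | \<pi> permutes {..<p}. \<Prod>i<p. m (\<sigma> i) (\<pi> i))"
    by (rule setum_permutations_compose_left[OF \<tau>, symmetric])
  also have "\<dots> = (\<Sum>\<pi> | \<pi> permutes {..<p}. \<Prod>i<p. m (\<sigma> i) ((\<pi> \<circ> \<sigma>) i))"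
    by (rule sum_permutations_compose_right[OF \<sigma>])
  also have "\<dots> = (\<Sum>\<pi> | \<pi> permutes {..<p}. \<Prod>i<p. m i (\<pi> i))"
    by (intro sum.cong refl, subst (2) prod.permute[OF \<sigma>]) (simp add: comp_def)
  finally show ?thesis by (simp add: permanent_def)
qed

lemma bij_betw_skip:
  assumes "i < Suc p"
  shows "bij_betw (skip i) {..<p} ({..<Suc p} - {i})"
  unfolding bij_betw_def
proof
  show "inj_on (skip i) {..<p}" by (auto simp: inj_on_def skip_def split: if_splits)
  show "skip i ` {..<p} = {..<Suc p} - {i}"
  proof (intro set_eqI iffI)
    fix r assume r: "r \<in> {..<Suc p} - {i}"
    then have "r = skip i (if r < i then r else r - 1)" "(if r < i then r else r - 1) < p"
      using assms by (auto simp: skip_def)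
    then show "r \<in> skip i ` {..<p}" by blast
  qed (use assms in \<open>auto simp: skip_def\<close>)
qed

definition shift :: "nat \<Rightarrow> nat \<Rightarrow> nat \<Rightarrow> nat" where
  "shift p i r = (if r < p then skip i r else if r = p then i else r)"

lemma shift_permutes:
  assumes "i < Suc p" shows "shift p i permutes {..<Suc p}"
proof (rule bij_imp_permutes)
  have "inj_on (shift p i) {..<Suc p}"
    using assms by (auto simp: inj_on_def shift_def skip_def split: if_splits)
  moreover have "shift p i ` {..<Suc p} \<subseteq> {..<Suc p}"
    using assms by (auto simp: shift_def skip_def)
  ultimately show "bij_betw (shift p i) {..<Suc p} {..<Suc p}"
    using endo_inj_surj[of "{..<Suc p}"] by (simp add: bij_betw_def)
qed (auto simp: shift_def)

lemma permanent_minor_eq: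
  assumes i: "i < Suc p" and j: "j < Suc p"
  shows "(\<Sum>\<pi> | \<pi> permutes {..<Suc p} \<and> \<pi> i = j. \<Prod>r\<in>{..<Suc p} - {i}. m r (\<pi> r)) =
    permanent_minor p i j m"
proof -
  let ?s = "shift p i" and ?t = "shift p j"
  note s = shift_permutes[OF i] and t = shift_permutes[OF j]
  have sub: "q permutes {..<Suc p}" if "q permutes {..<p}" for q
    using that by (rule permutes_subset) auto
  have bij: "bij_betw (\<lambda>q. ?t \<circ> q \<circ> inv ?s) {q. q permutes {..<p}}
    {\<pi>. \<pi> permutes {..<Suc p} \<and> \<pi> i = j}"
  proof (rule bij_betw_byWitness[where f' = "\<lambda>\<pi>. inv ?t \<circ> \<pi> \<circ> ?s"])
    show "\<forall>q\<in>{q. q permutes {..<p}}. inv ?t \<circ> (?t \<circ> q \<circ> inv ?s) \<circ> ?s = q"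
      by (simp add: fun_eq_iff permutes_inverses[OF s] permutes_inverses[OF t])
    show "\<forall>\<pi>\<in>{\<pi>. \<pi> permutes {..<Suc p} \<and> \<pi> i = j}. ?t \<circ> (inv ?t \<circ> \<pi> \<circ> ?s) \<circ> inv ?s = \<pi>"
      by (simp add: fun_eq_iff permutes_inverses[OF s] permutes_inverses[OF t])
    have "inv ?s i = p" by (rule permutes_inv_eq[OF s, THEN iffD2]) (simp add: shift_def)
    moreover have "?t (q p) = j" if "q permutes {..<p}" for q
      using permutes_not_in[OF that, of p] by (simp add: shift_def)
    ultimately show "(\<lambda>q. ?t \<circ> q \<circ> inv ?s) ` {q. q permutes {..<p}} \<subseteq>
        {\<pi>. \<pi> permutes {..<Suc p} \<and> \<pi> i = j}"
      using sub s t by (auto intro!: permutes_compose permutes_inv)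
    have "inv ?t j = p" by (rule permutes_inv_eq[OF t, THEN iffD2]) (simp add: shift_def)
    then have fix_p: "(inv ?t \<circ> \<pi> \<circ> ?s) p = p" if "\<pi> i = j" for \<pi>
      using that by (simp add: shift_def)
    have "inv ?t \<circ> \<pi> \<circ> ?s permutes {..<p}" if "\<pi> permutes {..<Suc p}" "\<pi> i = j" for \<pi>
    proof (rule permutes_superset)
      show "inv ?t \<circ> \<pi> \<circ> ?s permutes {..<Suc p}"
        using that s t by (intro permutes_compose permutes_inv) auto
      show "(inv ?t \<circ> \<pi> \<circ> ?s) x = x" if "x \<in> {..<Suc p} - {..<p}" for x
        using that fix_p[of \<pi>] \<open>\<pi> i = j\<close> by (auto simp: less_Suc_eq)
    qed
    then show "(\<lambda>\<pi>. inv ?t \<circ> \<pi> \<circ> ?s) ` {\<pi>. \<pi> permutes {..<Suc p} \<and> \<pi> i = j} \<subseteq> {q. q permutes {..<p}}"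
      by blast
  qed
  have "(\<Sum>\<pi> | \<pi> permutes {..<Suc p} \<and> \<pi> i = j. \<Prod>r\<in>{..<Suc p} - {i}. m r (\<pi> r)) =
    (\<Sum>q | q permutes {..<p}. \<Prod>r\<in>{..<Suc p} - {i}. m r ((?t \<circ> q \<circ> inv ?s) r))"
    by (rule sum.reindex_bij_betw[OF bij, symmetric])
  also have "\<dots> = (\<Sum>q | q permutes {..<p}. \<Prod>r<p. m (skip i r) (skip j (q r)))"
  proof (rule sum.cong[OF refl])
    fix q assume "q \<in> {q. q permutes {..<p}}"
    then have q: "q r < p" if "r < p" for r using that permutes_in_image[of q "{..<p}" r] by simp
    have "inv ?s (skip i r) = r" if "r < p" for r
      using that by (intro permutes_inv_eq[OF s, THEN iffD2]) (simp add: shift_def)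
    then have "(?t \<circ> q \<circ> inv ?s) (skip i r) = skip j (q r)" if "r < p" for r
      using that q by (simp add: shift_def)
    then show "(\<Prod>r\<in>{..<Suc p} - {i}. m r ((?t \<circ> q \<circ> inv ?s) r)) = (\<Prod>r<p. m (skip i r) (skip j (q r)))"
      by (subst prod.reindex_bij_betw[OF bij_betw_skip[OF i], symmetric]) simp
  qed
  finally show ?thesis by (simp add: permanent_minor_def permanent_def)
qed

lemma permanent_split:
  assumes i: "i < Suc p" and j: "j < Suc p"
  shows "(\<Sum>\<pi> | \<pi> permutes {..<Suc p} \<and> \<pi> i = j. \<Prod>r<Suc p. m r (\<pi> r)) = m i j * permanent_minor p i j m"
proof -
  have "(\<Prod>r<Suc p. m r (\<pi> r)) = m i j * (\<Prod>r\<in>{..<Suc p} - {i}. m r (\<pi> r))" if "\<pi> i = j" for \<pi>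
    using that i by (subst prod.remove[of _ i]) auto
  then show ?thesis
    by (simp add: permanent_minor_eq[OF assms, symmetric] sum_distrib_left)
qed

lemma permanent_row:
  assumes i: "i < Suc p"
  shows "permanent (Suc p) m = (\<Sum>j<Suc p. m i j * permanent_minor p i j m)"
proof -
  have "permanent (Suc p) m =
    (\<Sum>j<Suc p. \<Sum>\<pi> | \<pi> permutes {..<Suc p} \<and> \<pi> i = j. \<Prod>r<Suc p. m r (\<pi> r))"
    unfolding permanent_def
    by (subst sum.group[of "{\<pi>. \<pi> permutes {..<Suc p}}" "{..<Suc p}" "\<lambda>\<pi>. \<pi> i", symmetric])
      (use i in \<open>auto simp: finite_permutations permutes_lt intro!: sum.cong\<close>)
  also have "\<dots> = (\<Sum>j<Suc p. m i j * permanent_minor p i j m)"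
    by (intro sum.cong refl permanent_split i) simp
  finally show ?thesis .
qed

lemma permanent_transpose: "permanent p (\<lambda>i j. m j i) = permanent p m"
proof -
  have "(\<Prod>i<p. m i (inv \<pi> i)) = (\<Prod>i<p. m (\<pi> i) i)" if "\<pi> permutes {..<p}" for \<pi>
    using that by (subst prod.permute[OF that]) (simp add: comp_def permutes_inverses)
  then have "(\<Sum>\<pi> | \<pi> permutes {..<p}. \<Prod>i<p. m i (inv \<pi> i)) = permanent p (\<lambda>i j. m j i)"
    unfolding permanent_def by (intro sum.cong) auto
  then show ?thesis
    unfolding permanent_def by (subst (2) sum_permutations_inverse) simp
qed

lemma fps_deriv_prod':
  fixes f :: "'i \<Rightarrow> 'a::comm_ring_1 fps"
  assumes "finite A"
  shows "fps_deriv (\<Prod>i\<in>A. f i) = (\<Sum>i\<in>A. fps_deriv (f i) * (\<Prod>r\<in>A - {i}. f r))"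
  using assms
proof (induction A rule: finite_induct)
  case (insert x A)
  have "insert x A - {i} = insert x (A - {i})" if "i \<in> A" for i using that insert by auto
  moreover have "insert x A - {x} = A" using insert by auto
  ultimately show ?case
    using insert by (simp add: sum_distrib_left mult_ac cong: sum.cong)
qed simp

lemma fps_deriv_permanent:
  fixes m :: "nat \<Rightarrow> nat \<Rightarrow> 'a::comm_ring_1 fps"
  shows "fps_deriv (permanent (Suc p) m) =
    (\<Sum>i<Suc p. \<Sum>j<Suc p. fps_deriv (m i j) * permanent_minor p i j m)"
proof -
  let ?P = "{\<pi>. \<pi> permutes {..<Suc p}}"
  have "fps_deriv (permanent (Suc p) m) =
    (\<Sum>i<Suc p. \<Sum>\<pi>\<in>?P. fps_deriv (m i (\<pi> i)) * (\<Prod>r\<in>{..<Suc p} - {i}. m r (\<pi> r)))"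
    unfolding permanent_def fps_deriv_sum
    by (subst sum.swap) (simp only: fps_deriv_prod' finite_lessThan)
  also have "\<dots> = (\<Sum>i<Suc p. \<Sum>j<Suc p. \<Sum>\<pi> | \<pi> \<in> ?P \<and> \<pi> i = j.
      fps_deriv (m i (\<pi> i)) * (\<Prod>r\<in>{..<Suc p} - {i}. m r (\<pi> r)))"
    by (intro sum.cong refl, subst sum.group) (auto simp: finite_permutations permutes_lt)
  also have "\<dots> = (\<Sum>i<Suc p. \<Sum>j<Suc p. fps_deriv (m i j) * permanent_minor p i j m)"
    by (intro sum.cong refl) (simp add: permanent_minor_eq[symmetric] sum_distrib_left)
  finally show ?thesis .
qed

(*PART3*)
type_synonym series_vec = "nat \<Rightarrow> nat \<Rightarrow> (nat \<Rightarrow> real) \<Rightarrow> (nat \<Rightarrow> real) \<Rightarrow> complex fps"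

definition coeff_vec :: "nat \<Rightarrow> series_vec \<Rightarrow> fock2" where
  "coeff_vec n G = (\<lambda>p q x y. G p q x y $ n)"

definition flip :: "series_vec \<Rightarrow> series_vec" where
  "flip G = (\<lambda>p q x y. G q p y x)"

definition annih_left :: "(real \<Rightarrow> complex fps) \<Rightarrow> series_vec \<Rightarrow> series_vec" where
  "annih_left f G = (\<lambda>p q x y.
     fps_const (of_real (sqrt (real (Suc p)))) * coeff_integral (\<lambda>s. f s * G (Suc p) q (x(p := s)) y))"

definition creat_left :: "(real \<Rightarrow> complex fps) \<Rightarrow> series_vec \<Rightarrow> series_vec" where
  "creat_left \<phi> G = (\<lambda>p q x y.
     fps_const (of_real (1 / sqrt (real p))) * (\<Sum>i<p. \<phi> (x i) * G (p - 1) q (delete_point p i x) y))"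

definition annih_right :: "(real \<Rightarrow> complex fps) \<Rightarrow> series_vec \<Rightarrow> series_vec" where
  "annih_right f G = flip (annih_left f (flip G))"

definition creat_right :: "(real \<Rightarrow> complex fps) \<Rightarrow> series_vec \<Rightarrow> series_vec" where
  "creat_right \<phi> G = flip (creat_left \<phi> (flip G))"

lemma flip_flip [simp]: "flip (flip G) = G"
  by (simp add: flip_def)

definition time_indicator :: "real \<Rightarrow> real \<Rightarrow> complex fps" where
  "time_indicator t s = fps_const (indicator {0..<t} s)"

lemma time_indicator_nth: "time_indicator t s $ n = (if n = 0 then indicator {0..<t} s else 0)"
  by (simp add: time_indicator_def)

lemma on_left_annih: "on_left (annih t) (coeff_vec n G) = coeff_vec n (annih_left (time_indicator t) G)"
proof -
  have "cnj (indicator {0..<t} s :: complex) = indicator {0..<t} s" for s by (simp add: indicator_def)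
  then show ?thesis
    by (simp add: fun_eq_iff on_left_def annih_def annihilation_def coeff_vec_def annih_left_def
      time_indicator_def)
qed

lemma on_right_annih: "on_right (annih t) (coeff_vec n G) = coeff_vec n (annih_right (time_indicator t) G)"
proof -
  have "cnj (indicator {0..<t} s :: complex) = indicator {0..<t} s" for s by (simp add: indicator_def)
  then show ?thesis
    by (simp add: fun_eq_iff on_right_def annih_def annihilation_def coeff_vec_def annih_right_def annih_left_def
      time_indicator_def flip_def)
qed

lemma on_left_creat: "on_left (creat t) (coeff_vec n G) = coeff_vec n (creat_left (time_indicator t) G)"
  by (simp add: fun_eq_iff on_left_def creat_def creation_def coeff_vec_def creat_left_def
      time_indicator_def fps_sum_nth)

lemma on_right_creat: "on_right (creat t) (coeff_vec n G) = coeff_vec n (creat_right (time_indicator t) G)"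
  by (simp add: fun_eq_iff on_right_def creat_def creation_def coeff_vec_def creat_right_def creat_left_def
      time_indicator_def fps_sum_nth flip_def)

definition cst :: "complex \<Rightarrow> complex fps" where "cst c = fps_const c"

definition Q_series :: "real \<Rightarrow> (real \<Rightarrow> complex fps) \<Rightarrow> series_vec \<Rightarrow> series_vec" where
  "Q_series \<sigma> f G = (\<lambda>p q x y.
     cst (of_real (c_plus \<sigma>)) * (annih_left f G p q x y + creat_left f G p q x y) +
     cst (of_real (c_minus \<sigma>)) * (annih_right f G p q x y + creat_right f G p q x y))"

definition P_series :: "real \<Rightarrow> (real \<Rightarrow> complex fps) \<Rightarrow> series_vec \<Rightarrow> series_vec" where
  "P_series \<sigma> f G = (\<lambda>p q x y.
     - (cst \<i> * cst (of_real (c_plus \<sigma>)) * (annih_left f G p q x y - creat_left f G p q x y)) +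
     cst \<i> * cst (of_real (c_minus \<sigma>)) * (annih_right f G p q x y - creat_right f G p q x y))"

lemma on_left_plus: "on_left (X + Y) \<Psi> p q x y = on_left X \<Psi> p q x y + on_left Y \<Psi> p q x y"
  by (simp add: on_left_def)
lemma on_left_minus: "on_left (X - Y) \<Psi> p q x y = on_left X \<Psi> p q x y - on_left Y \<Psi> p q x y"
  by (simp add: on_left_def)
lemma on_right_plus: "on_right (X + Y) \<Psi> p q x y = on_right X \<Psi> p q x y + on_right Y \<Psi> p q x y"
  by (simp add: on_right_def)
lemma on_right_minus: "on_right (X - Y) \<Psi> p q x y = on_right X \<Psi> p q x y - on_right Y \<Psi> p q x y"
  by (simp add: on_right_def)

lemma Q_bm_coeff_vec: "Q_bm \<sigma> t (coeff_vec n G) = coeff_vec n (Q_series \<sigma> (time_indicator t) G)"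
  unfolding Q_bm_def comp_def plus_fun_apply scale_def on_left_plus on_right_plus
    on_left_annih on_left_creat on_right_annih on_right_creat fun_eq_iff
  by (simp add: coeff_vec_def Q_series_def cst_def)

lemma P_bm_coeff_vec: "P_bm \<sigma> t (coeff_vec n G) = coeff_vec n (P_series \<sigma> (time_indicator t) G)"
  unfolding P_bm_def comp_def plus_fun_apply scale_def on_left_minus on_right_minus
    on_left_annih on_left_creat on_right_annih on_right_creat fun_eq_iff
  by (simp add: coeff_vec_def P_series_def cst_def fps_mult_left_const_nth mult.assoc)

definition test_fun :: "(real \<Rightarrow> complex fps) \<Rightarrow> bool" where
  "test_fun f \<longleftrightarrow> coeff_measurable f \<and> coeff_bounded f"

lemma test_fun_diff: "test_fun f \<Longrightarrow> test_fun g \<Longrightarrow> test_fun (\<lambda>s. f s - g s)"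
  by (simp add: test_fun_def coeff_measurable_diff coeff_bounded_diff)

lemma test_fun_time_indicator: "test_fun (time_indicator t)"
  unfolding test_fun_def
proof
  have "(\<lambda>s. indicator {0..<t} s :: complex) \<in> borel_measurable borel" by simp
  then show "coeff_measurable (time_indicator t)"
    unfolding coeff_measurable_def time_indicator_nth by auto
  show "coeff_bounded (time_indicator t)"
    unfolding coeff_bounded_def time_indicator_nth by (auto simp: indicator_def intro!: exI[of _ 1])
qed

definition integrable_left :: "series_vec \<Rightarrow> bool" where
  "integrable_left G \<longleftrightarrow> (\<forall>f p q x y. test_fun f \<longrightarrow> coeff_integrable (\<lambda>s. f s * G (Suc p) q (x(p := s)) y))"

lemma integrable_leftD:
  "integrable_left G \<Longrightarrow> test_fun f \<Longrightarrow> coeff_integrable (\<lambda>s. f s * G (Suc p) q (x(p := s)) y)"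
  by (simp add: integrable_left_def)

lemma annih_left_diff_fun:
  assumes "integrable_left G" "test_fun f" "test_fun g"
  shows "annih_left (\<lambda>s. f s - g s) G p q x y = annih_left f G p q x y - annih_left g G p q x y"
  using assms by (simp add: annih_left_def left_diff_distrib coeff_integral_diff integrable_leftD
      flip: right_diff_distrib)

lemma annih_left_lin:
  assumes "integrable_left G" "integrable_left H" "test_fun f"
  shows "annih_left f (\<lambda>p q x y. c * G p q x y + d * H p q x y) p q x y =
    c * annih_left f G p q x y + d * annih_left f H p q x y"
proof -
  have eq: "f s * (c * g + d * h) = c * (f s * g) + d * (f s * h)" for s g h
    by (simp add: algebra_simps)
  show ?thesis
    using assms unfolding annih_left_def eq
    by (simp add: coeff_integral_add coeff_integral_cmult coeff_integrable_cmult integrable_leftD algebra_simps)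
qed

lemma creat_left_diff_fun:
  "creat_left (\<lambda>s. f s - g s) G p q x y = creat_left f G p q x y - creat_left g G p q x y"
  by (simp add: creat_left_def left_diff_distrib sum_subtractf right_diff_distrib)

lemma creat_left_lin_fun:
  "creat_left (\<lambda>s. c * f s + d * g s) G p q x y = c * creat_left f G p q x y + d * creat_left g G p q x y"
  by (simp add: creat_left_def distrib_right distrib_left sum.distrib sum_distrib_left mult_ac)

lemma creat_left_lin:
  "creat_left f (\<lambda>p q x y. c * G p q x y + d * H p q x y) p q x y =
    c * creat_left f G p q x y + d * creat_left f H p q x y"
  by (simp add: creat_left_def distrib_right distrib_left sum.distrib sum_distrib_left mult_ac)

lemma flip_lin: "flip (\<lambda>p q x y. c * G p q x y + d * H p q x y) = (\<lambda>p q x y. c * flip G p q x y + d * flip H p q x y)"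
  by (simp add: flip_def)

lemma annih_right_diff_fun:
  assumes "integrable_left (flip G)" "test_fun f" "test_fun g"
  shows "annih_right (\<lambda>s. f s - g s) G p q x y = annih_right f G p q x y - annih_right g G p q x y"
  using annih_left_diff_fun[OF assms] by (simp add: annih_right_def flip_def)

lemma annih_right_lin:
  assumes "integrable_left (flip G)" "integrable_left (flip H)" "test_fun f"
  shows "annih_right f (\<lambda>p q x y. c * G p q x y + d * H p q x y) p q x y =
    c * annih_right f G p q x y + d * annih_right f H p q x y"
  using annih_left_lin[OF assms] by (simp add: annih_right_def flip_def)

lemma creat_right_diff_fun:
  "creat_right (\<lambda>s. f s - g s) G p q x y = creat_right f G p q x y - creat_right g G p q x y"
  by (simp add: creat_right_def flip_def creat_left_diff_fun)

lemma creat_right_lin_fun: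
  "creat_right (\<lambda>s. c * f s + d * g s) G p q x y = c * creat_right f G p q x y + d * creat_right g G p q x y"
  by (simp add: creat_right_def flip_def creat_left_lin_fun)

lemma creat_right_lin:
  "creat_right f (\<lambda>p q x y. c * G p q x y + d * H p q x y) p q x y =
    c * creat_right f G p q x y + d * creat_right f H p q x y"
  by (simp add: creat_right_def flip_def creat_left_lin)

definition integrable_vec :: "series_vec \<Rightarrow> bool" where
  "integrable_vec G \<longleftrightarrow> integrable_left G \<and> integrable_left (flip G)"

lemma integrable_left_lin:
  assumes "integrable_left G" "integrable_left H"
  shows "integrable_left (\<lambda>p q x y. c * G p q x y + d * H p q x y)"
  unfolding integrable_left_def
proof (intro allI impI)
  fix f p q x y assume f: "test_fun f"
  have eq: "f s * (c * g + d * h) = c * (f s * g) + d * (f s * h)" for s g h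
    by (simp add: algebra_simps)
  show "coeff_integrable (\<lambda>s. f s * (c * G (Suc p) q (x(p := s)) y + d * H (Suc p) q (x(p := s)) y))"
    unfolding eq using assms f by (intro coeff_integrable_add coeff_integrable_cmult integrable_leftD)
qed

lemma integrable_vec_lin:
  assumes "integrable_vec G" "integrable_vec H"
  shows "integrable_vec (\<lambda>p q x y. c * G p q x y + d * H p q x y)"
  using assms by (simp add: integrable_vec_def integrable_left_lin flip_lin)

lemma Q_series_diff:
  assumes "integrable_vec G" "test_fun f" "test_fun g"
  shows "Q_series \<sigma> (\<lambda>s. f s - g s) G = Q_series \<sigma> f G - Q_series \<sigma> g G"
  using assms unfolding integrable_vec_def fun_eq_iff
  by (simp add: Q_series_def annih_left_diff_fun annih_right_diff_fun creat_left_diff_fun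
    creat_right_diff_fun algebra_simps)

lemma P_series_diff:
  assumes "integrable_vec G" "test_fun f" "test_fun g"
  shows "P_series \<sigma> (\<lambda>s. f s - g s) G = P_series \<sigma> f G - P_series \<sigma> g G"
  using assms unfolding integrable_vec_def fun_eq_iff
  by (simp add: P_series_def annih_left_diff_fun annih_right_diff_fun creat_left_diff_fun
    creat_right_diff_fun algebra_simps)

text \<open>The canonical commutation relations.\<close>

lemma delete_point_last:
  assumes "i < p" shows "delete_point (Suc p) i (x(p := s)) = (delete_point p i x)(p - 1 := s)"
  using assms by (auto simp: delete_point_def fun_eq_iff)

lemma delete_point_same: "delete_point (Suc p) p (x(p := s)) = restrict x {..<p}"
  by (auto simp: delete_point_def fun_eq_iff)

definition left_local :: "series_vec \<Rightarrow> bool" where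
  "left_local G \<longleftrightarrow> (\<forall>p q x y. G p q (restrict x {..<p}) y = G p q x y)"

lemma creat_left_Suc:
  assumes "left_local G"
  shows "f s * creat_left \<phi> G (Suc p) q (x(p := s)) y =
    fps_const (of_real (1 / sqrt (real (Suc p)))) * (G p q x y * (f s * \<phi> s) +
      (\<Sum>i<p. \<phi> (x i) * (f s * G (Suc (p - 1)) q ((delete_point p i x)(p - 1 := s)) y)))"
proof -
  have "(\<Sum>i<Suc p. \<phi> ((x(p := s)) i) * G (Suc p - 1) q (delete_point (Suc p) i (x(p := s))) y) =
    (\<Sum>i<p. \<phi> (x i) * G (Suc (p - 1)) q ((delete_point p i x)(p - 1 := s)) y) + \<phi> s * G p q x y"
    unfolding sum.lessThan_Suc
    using assms by (intro arg_cong2[where f = "(+)"] sum.cong refl)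
      (auto simp: delete_point_last delete_point_same left_local_def)
  then show ?thesis
    unfolding creat_left_def by (simp only:) (simp only: distrib_left sum_distrib_left mult_ac add_ac)
qed

lemma integrable_creat_left:
  assumes "integrable_left G" "left_local G" "\<And>f. test_fun f \<Longrightarrow> coeff_integrable (\<lambda>s. f s * \<phi> s)"
  shows "integrable_left (creat_left \<phi> G)"
  unfolding integrable_left_def creat_left_Suc[OF assms(2)]
  by (intro allI impI coeff_integrable_cmult coeff_integrable_add coeff_integrable_sum
      integrable_leftD[OF assms(1)] assms(3))

lemma integrable_creat_right:
  assumes "integrable_left G"
  shows "integrable_left (creat_right \<phi> G)"
proof -
  have eq: "f s * creat_right \<phi> G (Suc p) q (x(p := s)) y =
    fps_const (of_real (1 / sqrt (real q))) * (\<Sum>j<q. \<phi> (y j) * (f s * G (Suc p) (q - 1) (x(p := s)) (delete_point q j y)))"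
    for f s p q x y
    by (simp add: creat_right_def creat_left_def flip_def sum_distrib_left mult_ac)
  show ?thesis
    using assms unfolding integrable_left_def eq
    by (auto intro!: coeff_integrable_cmult coeff_integrable_sum)
qed

lemma fps_const_sqrt_cancel:
  "fps_const (of_real (sqrt (real (Suc p)))) * (fps_const (of_real (1 / sqrt (real (Suc p)))) * h) = (h :: complex fps)"
proof -
  have "(of_real (sqrt (real (Suc p))) :: complex) * of_real (1 / sqrt (real (Suc p))) = 1"
    by (simp flip: of_real_mult)
  then show ?thesis by (simp only: mult.assoc[symmetric] fps_const_mult) simp
qed

lemma annih_left_creat_left:
  assumes int: "integrable_left G" and loc: "left_local G"
    and f: "test_fun f" and \<phi>: "coeff_integrable (\<lambda>s. f s * \<phi> s)"
  shows "annih_left f (creat_left \<phi> G) p q x y =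
    coeff_integral (\<lambda>s. f s * \<phi> s) * G p q x y + creat_left \<phi> (annih_left f G) p q x y"
proof -
  have "annih_left f (creat_left \<phi> G) p q x y =
    G p q x y * coeff_integral (\<lambda>s. f s * \<phi> s) +
      (\<Sum>i<p. \<phi> (x i) * coeff_integral (\<lambda>s. f s * G (Suc (p - 1)) q ((delete_point p i x)(p - 1 := s)) y))"
    unfolding annih_left_def creat_left_Suc[OF loc]
    by (subst coeff_integral_cmult coeff_integral_add coeff_integral_sum |
        intro coeff_integrable_cmult coeff_integrable_add coeff_integrable_sum integrable_leftD int f \<phi> |
        rule fps_const_sqrt_cancel)+
  moreover have "creat_left \<phi> (annih_left f G) p q x y =
      (\<Sum>i<p. \<phi> (x i) * coeff_integral (\<lambda>s. f s * G (Suc (p - 1)) q ((delete_point p i x)(p - 1 := s)) y))"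
  proof (cases p)
    case (Suc r)
    show ?thesis
      by (simp add: Suc creat_left_def annih_left_def sum_distrib_left mult_ac fps_const_sqrt_cancel del: of_nat_Suc of_real_divide)
  qed (simp add: creat_left_def)
  ultimately show ?thesis by (simp add: mult.commute)
qed

lemma annih_left_creat_right:
  assumes int: "integrable_left G" and f: "test_fun f"
  shows "annih_left f (creat_right \<chi> G) p q x y = creat_right \<chi> (annih_left f G) p q x y"
proof -
  have eq: "f s * creat_right \<phi> G (Suc p) q (x(p := s)) y =
    fps_const (of_real (1 / sqrt (real q))) * (\<Sum>j<q. \<phi> (y j) * (f s * G (Suc p) (q - 1) (x(p := s)) (delete_point q j y)))"
    for s p q x y \<phi>
    by (simp add: creat_right_def creat_left_def flip_def sum_distrib_left mult_ac)
  have "annih_left f (creat_right \<chi> G) p q x y = fps_const (of_real (sqrt (real (Suc p)))) *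
    (fps_const (of_real (1 / sqrt (real q))) *
      (\<Sum>j<q. \<chi> (y j) * coeff_integral (\<lambda>s. f s * G (Suc p) (q - 1) (x(p := s)) (delete_point q j y))))"
    unfolding annih_left_def eq
    by (subst coeff_integral_cmult coeff_integral_sum |
        intro coeff_integrable_cmult coeff_integrable_sum integrable_leftD int f | rule refl)+
  then show ?thesis
    by (simp add: creat_right_def creat_left_def annih_left_def flip_def sum_distrib_left mult_ac)
qed

lemma creat_left_creat_right:
  "creat_left \<phi> (creat_right \<chi> G) p q x y = creat_right \<chi> (creat_left \<phi> G) p q x y"
  unfolding creat_right_def creat_left_def flip_def
  by (simp add: sum_distrib_left mult_ac) (subst sum.swap, simp add: mult_ac)

(*PART4*)
locale time_interval =
  fixes a b :: real
  assumes a_nonneg: "0 \<le> a" and a_less_b: "a < b"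
begin

definition supported :: "(real \<Rightarrow> complex fps) \<Rightarrow> bool" where
  "supported \<phi> \<longleftrightarrow> test_fun \<phi> \<and> (\<forall>s. s \<notin> {a..<b} \<longrightarrow> \<phi> s = 0)"

definition bounded_kernel :: "(real \<Rightarrow> real \<Rightarrow> complex fps) \<Rightarrow> bool" where
  "bounded_kernel K \<longleftrightarrow> coeff_measurable (\<lambda>(s, t). K s t) \<and> coeff_bounded (\<lambda>(s, t). K s t) \<and>
     (\<forall>s t. s \<notin> {a..<b} \<or> t \<notin> {a..<b} \<longrightarrow> K s t = 0)"

lemma supported_integrable:
  assumes "test_fun f" "supported \<phi>" shows "coeff_integrable (\<lambda>s. f s * \<phi> s)"
  using assms unfolding supported_def test_fun_def
  by (intro coeff_integrableI[of _ a b] coeff_measurable_mult coeff_bounded_mult) auto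

lemma kernel_transpose: assumes "bounded_kernel K" shows "bounded_kernel (\<lambda>s t. K t s)"
proof -
  have c: "continuous_on UNIV (\<lambda>p::real \<times> real. (snd p, fst p))" by (intro continuous_intros)
  have "coeff_measurable (\<lambda>p. case (snd p, fst p) of (s, t) \<Rightarrow> K s t)"
    using assms unfolding bounded_kernel_def by (intro coeff_measurable_compose[OF _ c]) blast
  moreover have "coeff_bounded (\<lambda>p. case (snd p, fst p) of (s, t) \<Rightarrow> K s t)"
    using assms coeff_bounded_compose[of "\<lambda>(s, t). K s t" "\<lambda>p. (snd p, fst p)"]
    unfolding bounded_kernel_def by blast
  ultimately show ?thesis
    using assms unfolding bounded_kernel_def case_prod_unfold fst_conv snd_conv by blast
qed

lemma kernel_section: assumes "bounded_kernel K" shows "supported (\<lambda>s. K s t)"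
proof -
  have c: "continuous_on UNIV (\<lambda>s::real. (s, t))" by (intro continuous_intros)
  have "coeff_measurable (\<lambda>s. case (s, t) of (s, t) \<Rightarrow> K s t)"
    using assms unfolding bounded_kernel_def by (intro coeff_measurable_compose[OF _ c]) blast
  moreover have "coeff_bounded (\<lambda>s. case (s, t) of (s, t) \<Rightarrow> K s t)"
    using assms coeff_bounded_compose[of "\<lambda>(s, t). K s t" "\<lambda>s. (s, t)"]
    unfolding bounded_kernel_def by blast
  ultimately show ?thesis
    using assms unfolding supported_def bounded_kernel_def test_fun_def by simp
qed

lemma kernel_section': "bounded_kernel K \<Longrightarrow> supported (K s)"
  by (rule kernel_section[OF kernel_transpose])

definition act :: "(real \<Rightarrow> real \<Rightarrow> complex fps) \<Rightarrow> (real \<Rightarrow> complex fps) \<Rightarrow> real \<Rightarrow> complex fps" where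
  "act K f s = coeff_integral (\<lambda>t. f t * K s t)"

lemma act_diff:
  assumes "bounded_kernel K" "test_fun f" "test_fun g"
  shows "act K (\<lambda>s. f s - g s) s = act K f s - act K g s"
  unfolding act_def left_diff_distrib
  by (intro coeff_integral_diff supported_integrable assms kernel_section')

lemma supported_act:
  assumes K: "bounded_kernel K" and f: "test_fun f" shows "supported (act K f)"
proof -
  have c: "continuous_on UNIV (snd :: real \<times> real \<Rightarrow> real)" by (rule continuous_on_snd) (rule continuous_on_id)
  have "coeff_measurable (\<lambda>z. f (snd z) * (case z of (s, t) \<Rightarrow> K s t))"
    using K f c unfolding bounded_kernel_def test_fun_def
    by (intro coeff_measurable_mult) (auto intro: coeff_measurable_compose[of f snd])
  then have m: "coeff_measurable (\<lambda>(s, t). f t * K s t)" by (simp add: case_prod_unfold)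
  have "coeff_bounded (\<lambda>z. f (snd z) * (case z of (s, t) \<Rightarrow> K s t))"
    using K f unfolding bounded_kernel_def test_fun_def
    by (intro coeff_bounded_mult) (auto intro: coeff_bounded_compose[of f snd])
  then have bd: "coeff_bounded (\<lambda>(s, t). f t * K s t)" by (simp add: case_prod_unfold)
  have "coeff_measurable (act K f)"
    using coeff_measurable_coeff_integral[OF m] by (simp add: act_def[abs_def])
  moreover have "coeff_bounded (act K f)"
    using coeff_bounded_coeff_integral[OF bd, of a b] K by (simp add: act_def[abs_def] bounded_kernel_def)
  moreover have "act K f s = 0" if "s \<notin> {a..<b}" for s
    using K that by (simp add: act_def bounded_kernel_def)
  ultimately show ?thesis by (simp add: supported_def test_fun_def)
qed

lemma supported_lin:
  assumes "supported f" "supported g" shows "supported (\<lambda>s. c * f s + d * g s)"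
  using assms unfolding supported_def test_fun_def
  by (auto intro!: coeff_measurable_add coeff_measurable_mult coeff_bounded_add coeff_bounded_mult)

lemma supported_test: "supported f \<Longrightarrow> test_fun f" by (simp add: supported_def)

end

definition pair_state :: "complex fps \<Rightarrow> (real \<Rightarrow> real \<Rightarrow> complex fps) \<Rightarrow> series_vec" where
  "pair_state C K = (\<lambda>p q x y.
     if p = q then C * cst (1 / fact p) * permanent p (\<lambda>i j. K (x i) (y j)) else 0)"

lemma left_local_pair_state: "left_local (pair_state C K)"
proof -
  have "permanent p (\<lambda>i j. K (restrict x {..<p} i) (y j)) = permanent p (\<lambda>i j. K (x i) (y j))" for p x y
    by (rule permanent_cong) simp
  then show ?thesis by (simp add: left_local_def pair_state_def)
qed

lemma flip_pair_state: "flip (pair_state C K) = pair_state C (\<lambda>s t. K t s)"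
proof -
  have "permanent p (\<lambda>i j. K (y i) (x j)) = permanent p (\<lambda>i j. K (y j) (x i))" for p x y
    using permanent_transpose[of p "\<lambda>i j. K (y j) (x i)"] by simp
  then show ?thesis by (auto simp: flip_def pair_state_def fun_eq_iff)
qed

lemma delete_point_skip: "r < p \<Longrightarrow> delete_point (Suc p) i x r = x (skip i r)"
  by (simp add: delete_point_def skip_def)

lemma pair_state_Suc:
  "pair_state C K (Suc p) q (x(p := s)) y =
    (if q = Suc p then C * cst (1 / fact (Suc p)) *
       (\<Sum>j<Suc p. K s (y j) * permanent p (\<lambda>r u. K (x r) (delete_point (Suc p) j y u))) else 0)"
proof -
  have "permanent_minor p p j (\<lambda>i j. K ((x(p := s)) i) (y j)) =
    permanent p (\<lambda>r u. K (x r) (delete_point (Suc p) j y u))" for j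
    unfolding permanent_minor_def by (rule permanent_cong) (auto simp: delete_point_skip skip_def)
  then show ?thesis
    by (simp add: pair_state_def permanent_row[of p p] del: sum.lessThan_Suc fact_Suc)
qed

context time_interval
begin

lemma integrable_pair_state:
  assumes "bounded_kernel K" shows "integrable_left (pair_state C K)"
  unfolding integrable_left_def
proof (intro allI impI)
  fix f p q and x y :: "nat \<Rightarrow> real" assume f: "test_fun f"
  have eq: "f s * pair_state C K (Suc p) q (x(p := s)) y =
    (if q = Suc p then C * cst (1 / fact (Suc p)) else 0) *
       (\<Sum>j<Suc p. permanent p (\<lambda>r u. K (x r) (delete_point (Suc p) j y u)) * (f s * K s (y j)))" for s
    unfolding pair_state_Suc by (simp add: sum_distrib_left mult_ac del: sum.lessThan_Suc fact_Suc)
  show "coeff_integrable (\<lambda>s. f s * pair_state C K (Suc p) q (x(p := s)) y)"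
    unfolding eq
    by (intro coeff_integrable_cmult coeff_integrable_sum supported_integrable f kernel_section assms)
qed

lemma cst_mult: "cst c * cst d = cst (c * d)" by (simp add: cst_def)

lemma sqrt_fact_cancel:
  "fps_const (of_real (sqrt (real (Suc p)))) * cst (1 / fact (Suc p)) =
   fps_const (of_real (1 / sqrt (real (Suc p)))) * cst (1 / fact p)"
proof -
  have "of_real (sqrt (real (Suc p))) * (1 / fact (Suc p)) = of_real (1 / sqrt (real (Suc p))) * (1 / fact p :: complex)"
  proof -
    have "sqrt (real (Suc p)) * (1 / fact (Suc p)) = 1 / sqrt (real (Suc p)) * (1 / fact p)"
      using sqrt_divide_self_eq[of "real (Suc p)"]
      by (simp only: fact_Suc of_nat_0_le_iff inverse_eq_divide times_divide_eq_right mult_1_right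
          mult_1_left divide_divide_eq_left[symmetric] of_nat_mult simp_thms of_nat_id)
    then have "complex_of_real (sqrt (real (Suc p)) * (1 / fact (Suc p))) =
      complex_of_real (1 / sqrt (real (Suc p)) * (1 / fact p))" by (rule arg_cong)
    then show ?thesis by (simp only: of_real_mult of_real_fact of_real_divide of_real_1)
  qed
  then show ?thesis by (simp only: cst_def fps_const_mult)
qed

lemma annih_left_pair_state:
  assumes K: "bounded_kernel K" and f: "test_fun f"
  shows "annih_left f (pair_state C K) = creat_right (act (\<lambda>s t. K t s) f) (pair_state C K)"
proof (intro ext)
  fix p q and x y :: "nat \<Rightarrow> real"
  let ?m = "\<lambda>j. permanent p (\<lambda>r u. K (x r) (delete_point (Suc p) j y u))"
  have eq: "f s * pair_state C K (Suc p) q (x(p := s)) y =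
    (if q = Suc p then C * cst (1 / fact (Suc p)) else 0) * (\<Sum>j<Suc p. ?m j * (f s * K s (y j)))" for s
    unfolding pair_state_Suc by (simp add: sum_distrib_left mult_ac del: sum.lessThan_Suc fact_Suc)
  have "annih_left f (pair_state C K) p q x y = fps_const (of_real (sqrt (real (Suc p)))) *
     ((if q = Suc p then C * cst (1 / fact (Suc p)) else 0) *
       (\<Sum>j<Suc p. ?m j * coeff_integral (\<lambda>s. f s * K s (y j))))"
    unfolding annih_left_def eq
    by (subst coeff_integral_cmult coeff_integral_sum |
        intro coeff_integrable_cmult coeff_integrable_sum supported_integrable f kernel_section assms | rule refl)+
  also have "\<dots> = creat_right (act (\<lambda>s t. K t s) f) (pair_state C K) p q x y"
  proof (cases "q = Suc p")
    case True
    have "fps_const (of_real (sqrt (real (Suc p)))) * (C * cst (1 / fact (Suc p)) * S) =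
      fps_const (of_real (1 / sqrt (real (Suc p)))) * (C * cst (1 / fact p) * S)" for S :: "complex fps"
      using arg_cong[OF sqrt_fact_cancel[of p], of "\<lambda>k. k * (C * S)"] by (simp only: mult_ac)
    then have "fps_const (of_real (sqrt (real (Suc p)))) * (C * cst (1 / fact (Suc p)) *
        (\<Sum>j<Suc p. ?m j * coeff_integral (\<lambda>s. f s * K s (y j)))) =
      fps_const (of_real (1 / sqrt (real (Suc p)))) * (C * cst (1 / fact p) *
        (\<Sum>j<Suc p. ?m j * coeff_integral (\<lambda>s. f s * K s (y j))))" .
    also have "\<dots> = creat_right (act (\<lambda>s t. K t s) f) (pair_state C K) p q x y"
      using True
      by (simp add: creat_right_def creat_left_def flip_def pair_state_def act_def sum_distrib_left mult_ac
          del: sum.lessThan_Suc fact_Suc of_nat_Suc)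
    finally show ?thesis using True by simp
  next
    case False
    then show ?thesis
      by (cases q) (auto simp: creat_right_def creat_left_def flip_def pair_state_def)
  qed
  finally show "annih_left f (pair_state C K) p q x y =
      creat_right (act (\<lambda>s t. K t s) f) (pair_state C K) p q x y" .
qed

lemma annih_right_pair_state:
  assumes K: "bounded_kernel K" and f: "test_fun f"
  shows "annih_right f (pair_state C K) = creat_left (act K f) (pair_state C K)"
  unfolding annih_right_def flip_pair_state annih_left_pair_state[OF kernel_transpose[OF K] f]
  by (simp add: creat_right_def flip_pair_state)

lemma integrable_vec_pair_state: "bounded_kernel K \<Longrightarrow> integrable_vec (pair_state C K)"
  using integrable_pair_state[of K] integrable_pair_state[OF kernel_transpose[of K]]
  by (simp only: integrable_vec_def flip_pair_state)

lemma integrable_vec_creat_left: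
  assumes "bounded_kernel K" "supported \<phi>" shows "integrable_vec (creat_left \<phi> (pair_state C K))"
proof -
  have "flip (creat_left \<phi> (pair_state C K)) = creat_right \<phi> (pair_state C (\<lambda>s t. K t s))"
    by (simp add: creat_right_def flip_pair_state)
  then show ?thesis unfolding integrable_vec_def
    using assms integrable_pair_state[OF kernel_transpose[OF assms(1)]]
    by (simp add: integrable_creat_left integrable_creat_right integrable_pair_state left_local_pair_state
        supported_integrable)
qed

lemma flip_creat_right: "flip (creat_right \<phi> (pair_state C K)) = creat_left \<phi> (pair_state C (\<lambda>s t. K t s))"
  by (simp add: creat_right_def flip_pair_state)

lemma integrable_vec_creat_right:
  assumes "bounded_kernel K" "supported \<phi>" shows "integrable_vec (creat_right \<phi> (pair_state C K))"
  unfolding integrable_vec_def flip_creat_right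
  using assms integrable_pair_state[OF kernel_transpose[OF assms(1)]]
  by (simp add: integrable_creat_left integrable_creat_right integrable_pair_state left_local_pair_state
      supported_integrable)

lemma annih_right_creat_right:
  assumes "bounded_kernel K" "test_fun f" "supported \<phi>"
  shows "annih_right f (creat_right \<phi> (pair_state C K)) p q x y =
    coeff_integral (\<lambda>s. f s * \<phi> s) * pair_state C K p q x y + creat_right \<phi> (annih_right f (pair_state C K)) p q x y"
proof -
  have "integrable_left (flip (pair_state C K))" "left_local (flip (pair_state C K))"
    using integrable_pair_state[OF kernel_transpose[OF assms(1)]]
    by (simp_all add: flip_pair_state left_local_pair_state)
  from annih_left_creat_left[OF this assms(2) supported_integrable[OF assms(2,3)], of q p y x]
  show ?thesis by (simp add: annih_right_def creat_right_def) (simp add: flip_def)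
qed


end

(*PART5*)
definition pair_creation :: "(real \<Rightarrow> real \<Rightarrow> complex fps) \<Rightarrow> complex fps \<Rightarrow> (real \<Rightarrow> real \<Rightarrow> complex fps) \<Rightarrow> series_vec" where
  "pair_creation M C K = (\<lambda>p q x y.
     if p = q then C * cst (1 / fact p) *
       (\<Sum>i<p. \<Sum>j<p. M (x i) (y j) * permanent_minor (p - 1) i j (\<lambda>r u. K (x r) (y u))) else 0)"

lemma pair_creation_lin:
  "pair_creation (\<lambda>s t. c * M s t + d * M' s t) C K p q x y =
    c * pair_creation M C K p q x y + d * pair_creation M' C K p q x y"
  by (simp add: pair_creation_def distrib_left distrib_right sum.distrib sum_distrib_left mult_ac)

lemma pair_creation_sum:
  "pair_creation (\<lambda>s t. \<Sum>j\<in>A. M j s t) C K p q x y = (\<Sum>j\<in>A. pair_creation (M j) C K p q x y)"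
proof (induction A rule: infinite_finite_induct)
  case (insert j A)
  then show ?case using pair_creation_lin[of 1 "M j" 1 "\<lambda>s t. \<Sum>j\<in>A. M j s t" C K p q x y] by simp
qed (simp_all add: pair_creation_def)

lemma creat_creat_pair_state:
  "creat_left \<phi> (creat_right \<chi> (pair_state C K)) p q x y = pair_creation (\<lambda>s t. \<phi> s * \<chi> t) C K p q x y"
proof (cases "p = q \<and> p > 0")
  case True
  then obtain r where r: "p = Suc r" "q = Suc r" by (cases p) auto
  have minor: "permanent_minor r i j (\<lambda>r u. K (x r) (y u)) =
      permanent r (\<lambda>u v. K (delete_point (Suc r) i x u) (delete_point (Suc r) j y v))" for i j
    unfolding permanent_minor_def by (rule permanent_cong) (simp add: delete_point_skip)
  define k where "k = fps_const (complex_of_real (1 / sqrt (real (Suc r))))"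
  have "complex_of_real (1 / sqrt (real (Suc r))) * (of_real (1 / sqrt (real (Suc r))) * (1 / fact r)) =
    1 / fact (Suc r)"
  proof -
    have "1 / sqrt (real (Suc r)) * (1 / sqrt (real (Suc r)) * (1 / fact r)) = 1 / fact (Suc r)"
      by (simp only: times_divide_eq_right mult_1_right mult_1_left divide_divide_eq_left fact_Suc of_nat_mult
        of_nat_id real_sqrt_mult_self mult.assoc[symmetric] abs_of_nat times_divide_eq_left)
    then have "complex_of_real (1 / sqrt (real (Suc r)) * (1 / sqrt (real (Suc r)) * (1 / fact r))) =
      complex_of_real (1 / fact (Suc r))" by (rule arg_cong)
    then show ?thesis by (simp only: of_real_mult of_real_fact of_real_divide of_real_1)
  qed
  then have c: "k * (k * cst (1 / fact r)) = cst (1 / fact (Suc r))"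
    unfolding k_def by (simp only: cst_def fps_const_mult)
  let ?S = "\<Sum>i<Suc r. \<Sum>j<Suc r. \<phi> (x i) * \<chi> (y j) * permanent_minor r i j (\<lambda>r u. K (x r) (y u))"
  have "creat_left \<phi> (creat_right \<chi> (pair_state C K)) p q x y =
    k * (\<Sum>i<Suc r. \<phi> (x i) * (k * (\<Sum>j<Suc r. \<chi> (y j) *
      (C * cst (1 / fact r) * permanent_minor r i j (\<lambda>r u. K (x r) (y u))))))"
    by (simp only: r creat_left_def creat_right_def flip_def pair_state_def minor k_def diff_Suc_1 if_True simp_thms)
  also have "\<dots> = k * (k * cst (1 / fact r)) * (C * ?S)"
    by (simp only: sum_distrib_left mult_ac)
  finally show ?thesis unfolding c by (simp add: r pair_creation_def mult_ac del: sum.lessThan_Suc fact_Suc)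
next
  case False
  then show ?thesis
    by (cases p; cases q) (auto simp: creat_left_def creat_right_def flip_def pair_state_def pair_creation_def)
qed

lemma fps_deriv_cst [simp]: "fps_deriv (cst c) = 0"
  by (simp add: cst_def)

lemma fps_deriv_pair_state:
  "fps_deriv (pair_state C K p q x y) =
    pair_state (fps_deriv C) K p q x y + pair_creation (\<lambda>s t. fps_deriv (K s t)) C K p q x y"
proof (cases "p = q \<and> p > 0")
  case True
  then obtain r where "p = Suc r" "q = Suc r" by (cases p) auto
  then show ?thesis
    by (simp add: pair_state_def pair_creation_def fps_deriv_permanent mult_ac
        del: sum.lessThan_Suc fact_Suc)
qed (auto simp: pair_state_def pair_creation_def)

context time_interval
begin

definition up :: "real \<Rightarrow> (real \<Rightarrow> real \<Rightarrow> complex fps) \<Rightarrow> (real \<Rightarrow> complex fps) \<Rightarrow> real \<Rightarrow> complex fps" where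
  "up \<sigma> K f s = cst (of_real (c_plus \<sigma>)) * f s + cst (of_real (c_minus \<sigma>)) * act K f s"

definition vp :: "real \<Rightarrow> (real \<Rightarrow> real \<Rightarrow> complex fps) \<Rightarrow> (real \<Rightarrow> complex fps) \<Rightarrow> real \<Rightarrow> complex fps" where
  "vp \<sigma> K f t = cst (of_real (c_minus \<sigma>)) * f t + cst (of_real (c_plus \<sigma>)) * act (\<lambda>s t. K t s) f t"

lemma Q_series_pair_state:
  assumes "bounded_kernel K" "test_fun f"
  shows "Q_series \<sigma> f (pair_state C K) = (\<lambda>p q x y.
    1 * creat_left (up \<sigma> K f) (pair_state C K) p q x y + 1 * creat_right (vp \<sigma> K f) (pair_state C K) p q x y)"
  unfolding Q_series_def annih_left_pair_state[OF assms] annih_right_pair_state[OF assms]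
    up_def[abs_def] vp_def[abs_def] creat_left_lin_fun creat_right_lin_fun
  by (simp add: algebra_simps)

lemma P_series_pair_state:
  assumes "bounded_kernel K" "test_fun f"
  shows "P_series \<sigma> f (pair_state C K) = (\<lambda>p q x y.
    cst \<i> * creat_left (up \<sigma> K f) (pair_state C K) p q x y + (- cst \<i>) * creat_right (vp \<sigma> K f) (pair_state C K) p q x y)"
  unfolding P_series_def annih_left_pair_state[OF assms] annih_right_pair_state[OF assms]
    up_def[abs_def] vp_def[abs_def] creat_left_lin_fun creat_right_lin_fun
  by (simp add: algebra_simps)

lemma supported_up: "bounded_kernel K \<Longrightarrow> supported f \<Longrightarrow> supported (up \<sigma> K f)"
  unfolding up_def[abs_def] by (intro supported_lin supported_act supported_test)

lemma supported_vp: "bounded_kernel K \<Longrightarrow> supported f \<Longrightarrow> supported (vp \<sigma> K f)"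
  unfolding vp_def[abs_def] by (intro supported_lin supported_act[OF kernel_transpose] supported_test)

lemma area_term:
  assumes K: "bounded_kernel K" and f: "test_fun f" and g: "supported g" and fg: "\<And>s. f s * g s = 0"
  shows "P_series \<sigma> f (Q_series \<sigma> g (pair_state C K)) p q x y - Q_series \<sigma> f (P_series \<sigma> g (pair_state C K)) p q x y =
    2 * (- cst \<i> * (cst (of_real (c_plus \<sigma> * c_minus \<sigma>)) *
        (coeff_integral (\<lambda>s. f s * act K g s) - coeff_integral (\<lambda>s. f s * act (\<lambda>s t. K t s) g s)) * pair_state C K p q x y +
      pair_creation (\<lambda>s t. up \<sigma> K g s * vp \<sigma> K f t - up \<sigma> K f s * vp \<sigma> K g t) C K p q x y))"
proof -
  let ?X = "pair_state C K"
  let ?c = "cst (of_real (c_plus \<sigma>))" and ?d = "cst (of_real (c_minus \<sigma>))"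
  define u where "u = creat_left (up \<sigma> K g) ?X"
  define v where "v = creat_right (vp \<sigma> K g) ?X"
  note sg = supported_up[OF K g] supported_vp[OF K g]
  have Kt: "bounded_kernel (\<lambda>s t. K t s)" by (rule kernel_transpose[OF K])
  have iu: "integrable_left u" "integrable_left (flip u)" and iv: "integrable_left v" "integrable_left (flip v)"
    using integrable_vec_creat_left[OF K sg(1)] integrable_vec_creat_right[OF K sg(2)]
    unfolding u_def v_def integrable_vec_def by blast+
  have ii: "cst \<i> * cst \<i> = -1" "cst \<i> * (cst \<i> * z) = - z" for z
    by (simp_all add: cst_def flip: mult.assoc fps_const_neg)
  have "P_series \<sigma> f (Q_series \<sigma> g ?X) p q x y - Q_series \<sigma> f (P_series \<sigma> g ?X) p q x y =
    2 * (- cst \<i> * ((?c * annih_left f u p q x y + ?d * creat_right f u p q x y) -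
       (?d * annih_right f v p q x y + ?c * creat_left f v p q x y)))"
    unfolding Q_series_pair_state[OF K supported_test[OF g]] P_series_pair_state[OF K supported_test[OF g]]
      u_def[symmetric] v_def[symmetric]
    unfolding P_series_def Q_series_def annih_left_lin[OF iu(1) iv(1) f] annih_right_lin[OF iu(2) iv(2) f]
      creat_left_lin creat_right_lin
    by (simp add: algebra_simps ii)
  also have "?c * annih_left f u p q x y + ?d * creat_right f u p q x y =
    ?c * coeff_integral (\<lambda>s. f s * up \<sigma> K g s) * ?X p q x y +
    creat_left (up \<sigma> K g) (creat_right (vp \<sigma> K f) ?X) p q x y"
    unfolding u_def
    by (simp add: annih_left_creat_left integrable_pair_state K left_local_pair_state f supported_integrable sg
        annih_left_pair_state creat_left_creat_right[symmetric] vp_def[abs_def])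
      (simp only: creat_left_creat_right creat_right_lin_fun, simp add: algebra_simps)
  also have "?d * annih_right f v p q x y + ?c * creat_left f v p q x y =
    ?d * coeff_integral (\<lambda>s. f s * vp \<sigma> K g s) * ?X p q x y +
    creat_left (up \<sigma> K f) (creat_right (vp \<sigma> K g) ?X) p q x y"
    unfolding v_def
    by (simp add: annih_right_creat_right K f sg annih_right_pair_state)
      (simp only: creat_left_creat_right[symmetric] up_def[abs_def] creat_left_lin_fun, simp add: algebra_simps)
  also have "coeff_integral (\<lambda>s. f s * up \<sigma> K g s) = ?d * coeff_integral (\<lambda>s. f s * act K g s)"
    by (simp add: up_def distrib_left mult.left_commute[of "f _"] fg coeff_integral_cmult supported_integrable f
        supported_act K supported_test[OF g])
  also have "coeff_integral (\<lambda>s. f s * vp \<sigma> K g s) = ?c * coeff_integral (\<lambda>s. f s * act (\<lambda>s t. K t s) g s)"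
    by (simp add: vp_def distrib_left mult.left_commute[of "f _"] fg coeff_integral_cmult supported_integrable f
        supported_act Kt supported_test[OF g])
  also have "2 * (- cst \<i> * (?c * (?d * coeff_integral (\<lambda>s. f s * act K g s)) * ?X p q x y +
      creat_left (up \<sigma> K g) (creat_right (vp \<sigma> K f) ?X) p q x y -
      (?d * (?c * coeff_integral (\<lambda>s. f s * act (\<lambda>s t. K t s) g s)) * ?X p q x y +
      creat_left (up \<sigma> K f) (creat_right (vp \<sigma> K g) ?X) p q x y))) =
    2 * (- cst \<i> * (?c * ?d *
        (coeff_integral (\<lambda>s. f s * act K g s) - coeff_integral (\<lambda>s. f s * act (\<lambda>s t. K t s) g s)) * ?X p q x y +
      pair_creation (\<lambda>s t. 1 * (up \<sigma> K g s * vp \<sigma> K f t) + (-1) * (up \<sigma> K f s * vp \<sigma> K g t)) C K p q x y))"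
    unfolding creat_creat_pair_state pair_creation_lin by (simp add: algebra_simps)
  finally show ?thesis by (simp add: cst_mult)
qed

end

(*PART6*)
lemma coeff_integral_lincomb:
  assumes "\<And>j. j \<in> A \<Longrightarrow> coeff_integrable (f j)" "\<And>j. j \<in> A \<Longrightarrow> coeff_integrable (g j)"
  shows "coeff_integral (\<lambda>u. \<Sum>j\<in>A. c j * f j u + d j * g j u) =
    (\<Sum>j\<in>A. c j * coeff_integral (f j) + d j * coeff_integral (g j))"
  using assms
  by (simp add: coeff_integral_sum coeff_integrable_add coeff_integrable_cmult coeff_integral_add coeff_integral_cmult)

context time_interval
begin

definition past_ind :: "(nat \<Rightarrow> real) \<Rightarrow> nat \<Rightarrow> real \<Rightarrow> complex fps" where
  "past_ind t j s = time_indicator (t j) s - time_indicator a s"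

definition step_ind :: "(nat \<Rightarrow> real) \<Rightarrow> nat \<Rightarrow> real \<Rightarrow> complex fps" where
  "step_ind t j s = time_indicator (t (Suc j)) s - time_indicator (t j) s"

lemma partition_mono:
  assumes "is_partition a b N t" "i \<le> j" "j \<le> N" shows "t i \<le> t j"
  using assms(2,3)
proof (induction j rule: dec_induct)
  case (step m)
  then have "t m < t (Suc m)" using assms(1) by (simp add: is_partition_def)
  with step show ?case by simp
qed simp

lemma partition_range:
  assumes "is_partition a b N t" "j \<le> N" shows "a \<le> t j" "t j \<le> b"
  using partition_mono[OF assms(1), of 0 j] partition_mono[OF assms(1), of j N] assms
  by (auto simp: is_partition_def)

lemma past_ind_eq: "a \<le> t j \<Longrightarrow> past_ind t j s = (if a \<le> s \<and> s < t j then 1 else 0)"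
  using a_nonneg by (auto simp: past_ind_def time_indicator_def indicator_def)

lemma step_ind_eq:
  "a \<le> t j \<Longrightarrow> t j \<le> t (Suc j) \<Longrightarrow> step_ind t j s = (if t j \<le> s \<and> s < t (Suc j) then 1 else 0)"
  using a_nonneg by (auto simp: step_ind_def time_indicator_def indicator_def)

lemma test_before: "test_fun (past_ind t j)" and test_within: "test_fun (step_ind t j)"
  unfolding past_ind_def[abs_def] step_ind_def[abs_def] by (intro test_fun_diff test_fun_time_indicator)+

lemma supported_before: "is_partition a b N t \<Longrightarrow> j \<le> N \<Longrightarrow> supported (past_ind t j)"
  unfolding supported_def using partition_range[of N t j]
  by (auto simp: past_ind_eq test_before)

lemma supported_within: 
  assumes "is_partition a b N t" "j < N" shows "supported (step_ind t j)"
  unfolding supported_def using partition_range[OF assms(1), of j] partition_range[OF assms(1), of "Suc j"] assms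
    partition_mono[OF assms(1), of j "Suc j"]
  by (auto simp: step_ind_eq test_within)

definition riemann_trace :: "real \<Rightarrow> (real \<Rightarrow> real \<Rightarrow> complex fps) \<Rightarrow> nat \<Rightarrow> (nat \<Rightarrow> real) \<Rightarrow> complex fps" where
  "riemann_trace \<sigma> K N t = (\<Sum>j<N. - cst \<i> * (cst (of_real (c_plus \<sigma> * c_minus \<sigma>)) *
     (coeff_integral (\<lambda>s. past_ind t j s * act K (step_ind t j) s) -
      coeff_integral (\<lambda>s. past_ind t j s * act (\<lambda>s t. K t s) (step_ind t j) s))))"

definition riemann_kernel ::
  "real \<Rightarrow> (real \<Rightarrow> real \<Rightarrow> complex fps) \<Rightarrow> nat \<Rightarrow> (nat \<Rightarrow> real) \<Rightarrow> real \<Rightarrow> real \<Rightarrow> complex fps" where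
  "riemann_kernel \<sigma> K N t r s = (\<Sum>j<N. - cst \<i> *
     (up \<sigma> K (step_ind t j) r * vp \<sigma> K (past_ind t j) s - up \<sigma> K (past_ind t j) r * vp \<sigma> K (step_ind t j) s))"

lemma fock2_sum_apply: "(\<Sum>j\<in>A. F j) \<Psi> p q x y = (\<Sum>j\<in>A. F j \<Psi> p q x y)"
  for F :: "'i \<Rightarrow> fock2 \<Rightarrow> fock2"
  by (induction A rule: infinite_finite_induct) simp_all

lemma fock2_diff_apply: "(F - G) \<Psi> p q x y = F \<Psi> p q x y - G \<Psi> p q x y"
  for F :: "fock2 \<Rightarrow> fock2"
  by simp

lemma coeff_vec_diff: "coeff_vec n G - coeff_vec n H = coeff_vec n (G - H)"
  by (simp add: coeff_vec_def fun_eq_iff)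

lemma Q_bm_increment:
  assumes "integrable_vec G"
  shows "(Q_bm \<sigma> t' - Q_bm \<sigma> t) (coeff_vec n G) =
    coeff_vec n (Q_series \<sigma> (\<lambda>s. time_indicator t' s - time_indicator t s) G)"
  using assms by (simp add: Q_bm_coeff_vec coeff_vec_diff Q_series_diff test_fun_time_indicator)

lemma P_bm_increment:
  assumes "integrable_vec G"
  shows "(P_bm \<sigma> t' - P_bm \<sigma> t) (coeff_vec n G) =
    coeff_vec n (P_series \<sigma> (\<lambda>s. time_indicator t' s - time_indicator t s) G)"
  using assms by (simp add: P_bm_coeff_vec coeff_vec_diff P_series_diff test_fun_time_indicator)

lemma area_sum_pair_state:
  assumes part: "is_partition a b N t" and K: "bounded_kernel K"
  shows "area_sum \<sigma> a N t (coeff_vec n (pair_state C K)) = coeff_vec n (\<lambda>p q x y.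
    riemann_trace \<sigma> K N t * pair_state C K p q x y + pair_creation (riemann_kernel \<sigma> K N t) C K p q x y)"
proof (intro ext)
  fix p q and x y :: "nat \<Rightarrow> real"
  let ?X = "pair_state C K"
  let ?PQ = "\<lambda>j. P_series \<sigma> (past_ind t j) (Q_series \<sigma> (step_ind t j) ?X)"
  let ?QP = "\<lambda>j. Q_series \<sigma> (past_ind t j) (P_series \<sigma> (step_ind t j) ?X)"
  let ?tr = "\<lambda>j. - cst \<i> * (cst (of_real (c_plus \<sigma> * c_minus \<sigma>)) *
     (coeff_integral (\<lambda>s. past_ind t j s * act K (step_ind t j) s) -
      coeff_integral (\<lambda>s. past_ind t j s * act (\<lambda>s t. K t s) (step_ind t j) s)))"
  let ?M = "\<lambda>j r s. up \<sigma> K (step_ind t j) r * vp \<sigma> K (past_ind t j) s - up \<sigma> K (past_ind t j) r * vp \<sigma> K (step_ind t j) s"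
  have term_j: "?PQ j p q x y - ?QP j p q x y = 2 * (?tr j * ?X p q x y - cst \<i> * pair_creation (?M j) C K p q x y)"
    if "j < N" for j
  proof -
    have "past_ind t j s * step_ind t j s = 0" for s
      using partition_range[OF part, of j] partition_mono[OF part, of j "Suc j"] that
      by (auto simp: past_ind_eq step_ind_eq)
    from area_term[OF K test_before supported_within[OF part that] this, of \<sigma> C p q x y]
    show ?thesis by (simp add: algebra_simps)
  qed
  have PQ: "((P_bm \<sigma> (t j) - P_bm \<sigma> a) \<circ> (Q_bm \<sigma> (t (Suc j)) - Q_bm \<sigma> (t j))) (coeff_vec n ?X) =
      coeff_vec n (?PQ j)" if "j < N" for j
  proof -
    note w = supported_within[OF part that]
    have "integrable_vec (Q_series \<sigma> (step_ind t j) ?X)"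
      unfolding Q_series_pair_state[OF K test_within]
      by (intro integrable_vec_lin integrable_vec_creat_left integrable_vec_creat_right K supported_up supported_vp w)
    then show ?thesis
      using integrable_vec_pair_state[OF K]
      by (simp add: Q_bm_increment P_bm_increment step_ind_def[abs_def] past_ind_def[abs_def] del: minus_apply)
  qed
  have QP: "((Q_bm \<sigma> (t j) - Q_bm \<sigma> a) \<circ> (P_bm \<sigma> (t (Suc j)) - P_bm \<sigma> (t j))) (coeff_vec n ?X) =
      coeff_vec n (?QP j)" if "j < N" for j
  proof -
    note w = supported_within[OF part that]
    have "integrable_vec (P_series \<sigma> (step_ind t j) ?X)"
      unfolding P_series_pair_state[OF K test_within]
      by (intro integrable_vec_lin integrable_vec_creat_left integrable_vec_creat_right K supported_up supported_vp w)
    then show ?thesis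
      using integrable_vec_pair_state[OF K]
      by (simp add: Q_bm_increment P_bm_increment step_ind_def[abs_def] past_ind_def[abs_def] del: minus_apply)
  qed
  have two: "(2 * h) $ n = 2 * h $ n" for h :: "complex fps" by (simp only: mult_2 fps_add_nth)
  have "area_sum \<sigma> a N t (coeff_vec n ?X) p q x y =
    1 / 2 * (\<Sum>j<N. coeff_vec n (?PQ j) p q x y - coeff_vec n (?QP j) p q x y)"
    unfolding area_sum_def comp_apply[of "scale _"] scale_def fock2_sum_apply
    by (intro arg_cong2[where f = "(*)"] sum.cong refl) (simp only: fock2_diff_apply PQ QP lessThan_iff)
  also have "\<dots> = 1 / 2 * (\<Sum>j<N. (2 * (?tr j * ?X p q x y - cst \<i> * pair_creation (?M j) C K p q x y)) $ n)"
    by (intro arg_cong2[where f = "(*)"] sum.cong refl) (simp add: coeff_vec_def term_j flip: fps_sub_nth)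
  also have "\<dots> = (\<Sum>j<N. (?tr j * ?X p q x y - cst \<i> * pair_creation (?M j) C K p q x y) $ n)"
    unfolding two sum_distrib_left[symmetric] by simp
  also have "\<dots> = (\<Sum>j<N. ?tr j * ?X p q x y - cst \<i> * pair_creation (?M j) C K p q x y) $ n"
    by (simp add: fps_sum_nth)
  also have "(\<Sum>j<N. ?tr j * ?X p q x y - cst \<i> * pair_creation (?M j) C K p q x y) =
    riemann_trace \<sigma> K N t * ?X p q x y + pair_creation (riemann_kernel \<sigma> K N t) C K p q x y"
  proof -
    have "pair_creation (\<lambda>r s. - cst \<i> * ?M j r s) C K p q x y = - cst \<i> * pair_creation (?M j) C K p q x y" for j
      using pair_creation_lin[of "- cst \<i>" "?M j" 0 "?M j" C K p q x y] by simp
    then show ?thesis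
      unfolding riemann_kernel_def[abs_def] pair_creation_sum riemann_trace_def
      by (simp add: sum_distrib_right sum_subtractf)
        (simp add: sum_negf)
  qed
  finally show "area_sum \<sigma> a N t (coeff_vec n ?X) p q x y = coeff_vec n (\<lambda>p q x y.
    riemann_trace \<sigma> K N t * ?X p q x y + pair_creation (riemann_kernel \<sigma> K N t) C K p q x y) p q x y"
    by (simp add: coeff_vec_def)
qed

text \<open>Composition of kernels.\<close>

definition kernel_comp :: "(real \<Rightarrow> real \<Rightarrow> complex fps) \<Rightarrow> (real \<Rightarrow> real \<Rightarrow> complex fps) \<Rightarrow> real \<Rightarrow> real \<Rightarrow> complex fps" where
  "kernel_comp K L s t = coeff_integral (\<lambda>r. K s r * L r t)"

definition kernel_trace :: "(real \<Rightarrow> real \<Rightarrow> complex fps) \<Rightarrow> complex fps" where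
  "kernel_trace K = coeff_integral (\<lambda>s. K s s)"

definition step_kernel :: "nat \<Rightarrow> (nat \<Rightarrow> real) \<Rightarrow> real \<Rightarrow> real \<Rightarrow> complex fps" where
  "step_kernel N t r s = (\<Sum>j<N. - cst \<i> * (step_ind t j r * past_ind t j s - past_ind t j r * step_ind t j s))"

lemma compose_step_kernel:
  assumes part: "is_partition a b N t" and K: "bounded_kernel K"
  shows "kernel_comp (step_kernel N t) K r s = (\<Sum>j<N. - cst \<i> *
    (step_ind t j r * act (\<lambda>s t. K t s) (past_ind t j) s - past_ind t j r * act (\<lambda>s t. K t s) (step_ind t j) s))"
proof -
  note int = supported_integrable[OF test_before kernel_section[OF K]]
    supported_integrable[OF test_within kernel_section[OF K]]
  have eq: "step_kernel N t r u * K u s = (\<Sum>j<N. (- cst \<i> * step_ind t j r) * (past_ind t j u * K u s) +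
      (cst \<i> * past_ind t j r) * (step_ind t j u * K u s))" for u
    unfolding step_kernel_def sum_distrib_right by (intro sum.cong) (simp_all add: algebra_simps)
  show ?thesis
    unfolding kernel_comp_def eq act_def
    by (subst coeff_integral_lincomb[OF int]) (simp add: algebra_simps)
qed

lemma compose_step_kernel_right:
  assumes part: "is_partition a b N t" and K: "bounded_kernel K"
  shows "kernel_comp K (step_kernel N t) r s = (\<Sum>j<N. - cst \<i> *
    (act K (step_ind t j) r * past_ind t j s - act K (past_ind t j) r * step_ind t j s))"
proof -
  note int = supported_integrable[OF test_within kernel_section'[OF K]]
    supported_integrable[OF test_before kernel_section'[OF K]]
  have eq: "K r u * step_kernel N t u s = (\<Sum>j<N. (- cst \<i> * past_ind t j s) * (step_ind t j u * K r u) +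
      (cst \<i> * step_ind t j s) * (past_ind t j u * K r u))" for u
    unfolding step_kernel_def sum_distrib_left by (intro sum.cong) (simp_all add: algebra_simps)
  show ?thesis
    unfolding kernel_comp_def eq act_def
    by (subst coeff_integral_lincomb[OF int]) (simp add: algebra_simps)
qed

lemma compose_compose_step_kernel:
  assumes part: "is_partition a b N t" and K: "bounded_kernel K"
  shows "kernel_comp K (kernel_comp (step_kernel N t) K) r s = (\<Sum>j<N. - cst \<i> *
    (act K (step_ind t j) r * act (\<lambda>s t. K t s) (past_ind t j) s -
     act K (past_ind t j) r * act (\<lambda>s t. K t s) (step_ind t j) s))"
proof -
  note int = supported_integrable[OF test_within kernel_section'[OF K]]
    supported_integrable[OF test_before kernel_section'[OF K]]
  have eq: "K r u * kernel_comp (step_kernel N t) K u s =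
     (\<Sum>j<N. (- cst \<i> * act (\<lambda>s t. K t s) (past_ind t j) s) * (step_ind t j u * K r u) +
      (cst \<i> * act (\<lambda>s t. K t s) (step_ind t j) s) * (past_ind t j u * K r u))" for u
    unfolding compose_step_kernel[OF part K] sum_distrib_left by (intro sum.cong) (simp_all add: algebra_simps)
  show ?thesis
    unfolding kernel_comp_def[of K "kernel_comp (step_kernel N t) K"] eq act_def[of K]
    by (subst coeff_integral_lincomb[OF int]) (simp add: algebra_simps)
qed

lemma riemann_kernel_eq:
  fixes \<sigma> :: real
  assumes part: "is_partition a b N t" and K: "bounded_kernel K"
  defines "c \<equiv> cst (of_real (c_plus \<sigma>))" and "d \<equiv> cst (of_real (c_minus \<sigma>))" and "h \<equiv> step_kernel N t"
  shows "riemann_kernel \<sigma> K N t r s = c * d * h r s + c * c * kernel_comp h K r s + d * d * kernel_comp K h r s +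
    c * d * kernel_comp K (kernel_comp h K) r s"
  unfolding h_def compose_compose_step_kernel[OF part K] compose_step_kernel[OF part K]
    compose_step_kernel_right[OF part K] step_kernel_def riemann_kernel_def up_def vp_def
    sum_distrib_left sum.distrib[symmetric]
  by (intro sum.cong refl) (simp add: algebra_simps flip: c_def d_def)

lemma riemann_trace_eq:
  assumes part: "is_partition a b N t" and K: "bounded_kernel K"
  shows "riemann_trace \<sigma> K N t = cst (of_real (c_plus \<sigma> * c_minus \<sigma>)) * kernel_trace (kernel_comp (step_kernel N t) K)"
proof -
  have Kt: "bounded_kernel (\<lambda>s t. K t s)" by (rule kernel_transpose[OF K])
  have swap: "coeff_integral (\<lambda>s. step_ind t j s * act (\<lambda>s t. K t s) (past_ind t j) s) =
      coeff_integral (\<lambda>s. past_ind t j s * act K (step_ind t j) s)" if "j < N" for j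
  proof -
    let ?g = "\<lambda>s r. step_ind t j s * (past_ind t j r * K r s)"
    have c: "continuous_on UNIV (fst :: real \<times> real \<Rightarrow> real)" "continuous_on UNIV (snd :: real \<times> real \<Rightarrow> real)"
      by (auto intro: continuous_on_fst continuous_on_snd continuous_on_id)
    have m: "coeff_measurable (\<lambda>z. step_ind t j (fst z) * (past_ind t j (snd z) * (case z of (s, r) \<Rightarrow> K r s)))"
      using Kt test_before[of t j] test_within[of t j] unfolding bounded_kernel_def test_fun_def
      by (intro coeff_measurable_mult coeff_measurable_compose[OF _ c(1)] coeff_measurable_compose[OF _ c(2)]) blast+
    have bd: "coeff_bounded (\<lambda>z. step_ind t j (fst z) * (past_ind t j (snd z) * (case z of (s, r) \<Rightarrow> K r s)))"
      using Kt test_before[of t j] test_within[of t j] unfolding bounded_kernel_def test_fun_def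
      by (intro coeff_bounded_mult coeff_bounded_compose[of "step_ind t j" fst] coeff_bounded_compose[of "past_ind t j" snd]) blast+
    have "coeff_integral (\<lambda>s. coeff_integral (?g s)) = coeff_integral (\<lambda>r. coeff_integral (\<lambda>s. ?g s r))"
      by (rule coeff_integral_swap[of _ a b]) (use m bd K in \<open>auto simp: case_prod_unfold bounded_kernel_def\<close>)
    moreover have "coeff_integral (?g s) = step_ind t j s * act (\<lambda>s t. K t s) (past_ind t j) s" for s
      unfolding act_def by (intro coeff_integral_cmult supported_integrable test_before kernel_section K)
    moreover have "coeff_integral (\<lambda>s. ?g s r) = past_ind t j r * act K (step_ind t j) r" for r
      unfolding act_def mult.left_commute[of "step_ind t j _"]
      by (intro coeff_integral_cmult supported_integrable test_within kernel_section' K)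
    ultimately show ?thesis by simp
  qed
  have int: "coeff_integrable (\<lambda>s. step_ind t j s * act (\<lambda>s t. K t s) (past_ind t j) s)"
     "coeff_integrable (\<lambda>s. past_ind t j s * act (\<lambda>s t. K t s) (step_ind t j) s)" for j
    by (intro supported_integrable supported_act Kt test_before test_within)+
  have eq: "kernel_comp (step_kernel N t) K s s = (\<Sum>j<N. (- cst \<i>) * (step_ind t j s * act (\<lambda>s t. K t s) (past_ind t j) s) +
      cst \<i> * (past_ind t j s * act (\<lambda>s t. K t s) (step_ind t j) s))" for s
    unfolding compose_step_kernel[OF part K] by (intro sum.cong) (simp_all add: algebra_simps)
  have "kernel_trace (kernel_comp (step_kernel N t) K) =
    (\<Sum>j<N. (- cst \<i>) * coeff_integral (\<lambda>s. past_ind t j s * act K (step_ind t j) s) +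
      cst \<i> * coeff_integral (\<lambda>s. past_ind t j s * act (\<lambda>s t. K t s) (step_ind t j) s))"
    unfolding kernel_trace_def eq by (subst coeff_integral_lincomb[OF int]) (simp add: swap)
  then show ?thesis
    unfolding riemann_trace_def sum_distrib_left by (simp only: sum_distrib_left) (intro sum.cong refl, simp add: algebra_simps)
qed

end

(*PART7*)
context time_interval
begin

definition area_kernel :: "real \<Rightarrow> real \<Rightarrow> complex fps" where
  "area_kernel r s = (if r \<in> {a..<b} \<and> s \<in> {a..<b} then cst (- \<i> * of_real (sgn (r - s))) else 0)"

definition step_sum :: "nat \<Rightarrow> (nat \<Rightarrow> real) \<Rightarrow> real \<Rightarrow> real \<Rightarrow> complex fps" where
  "step_sum N t r s = (\<Sum>j<N. step_ind t j r * past_ind t j s)"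

lemma step_kernel_step_sum: "step_kernel N t r s = - cst \<i> * (step_sum N t r s - step_sum N t s r)"
  unfolding step_kernel_def step_sum_def
  by (simp add: sum_distrib_left sum_subtractf[symmetric] algebra_simps)

lemma partition_cell:
  fixes t :: "nat \<Rightarrow> real"
  assumes "t 0 \<le> r" "r < t N" shows "\<exists>j<N. t j \<le> r \<and> r < t (Suc j)"
  using assms(2)
proof (induction N)
  case (Suc N)
  then show ?case by (cases "r < t N") (auto simp: less_Suc_eq)
qed (use assms(1) in simp)

lemma step_sum_cell:
  assumes part: "is_partition a b N t" and j: "j < N" "t j \<le> r" "r < t (Suc j)"
  shows "step_sum N t r s = past_ind t j s"
proof -
  have "step_ind t i r = (if i = j then 1 else 0)" if "i < N" for i
  proof -
    have "t (Suc i) \<le> t j" if "i < j" using partition_mono[OF part, of "Suc i" j] that j by simp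
    moreover have "t (Suc j) \<le> t i" if "j < i" using partition_mono[OF part, of "Suc j" i] that \<open>i < N\<close> by simp
    ultimately show ?thesis
      using partition_range[OF part, of i] partition_mono[OF part, of i "Suc i"] that j
      by (cases i j rule: linorder_cases) (auto simp: step_ind_eq)
  qed
  then show ?thesis
    unfolding step_sum_def using j(1) by (simp add: if_distrib[of "\<lambda>z. z * _"] cong: if_cong)
qed

lemma step_sum_outside:
  assumes part: "is_partition a b N t" and r: "r \<notin> {a..<b}"
  shows "step_sum N t r s = 0"
  unfolding step_sum_def using supported_within[OF part] r by (simp add: supported_def)

lemma step_sum_cases:
  assumes part: "is_partition a b N t"
  shows "step_sum N t r s = 0 \<or> step_sum N t r s = 1"
proof (cases "r \<in> {a..<b}")
  case True
  then obtain j where j: "j < N" "t j \<le> r" "r < t (Suc j)"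
    using partition_cell[of t r N] part by (auto simp: is_partition_def)
  show ?thesis
    using partition_range[OF part, of j] j(1) by (simp add: step_sum_cell[OF part j] past_ind_eq)
qed (simp add: step_sum_outside[OF part])

lemma step_sum_le:
  assumes part: "is_partition a b N t" and "r \<le> s"
  shows "step_sum N t r s = 0"
proof (cases "r \<in> {a..<b}")
  case True
  then obtain j where j: "j < N" "t j \<le> r" "r < t (Suc j)"
    using partition_cell[of t r N] part by (auto simp: is_partition_def)
  show ?thesis
    using partition_range[OF part, of j] j assms(2) by (simp add: step_sum_cell[OF part j] past_ind_eq)
qed (simp add: step_sum_outside[OF part])

lemma step_sum_greater:
  assumes part: "is_partition a b N t" and r: "r \<in> {a..<b}" and s: "a \<le> s"
    and mesh: "\<And>j. j < N \<Longrightarrow> t (Suc j) - t j < r - s"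
  shows "step_sum N t r s = 1"
proof -
  obtain j where j: "j < N" "t j \<le> r" "r < t (Suc j)"
    using partition_cell[of t r N] part r by (auto simp: is_partition_def)
  show ?thesis
    using partition_range[OF part, of j] j mesh[of j] s by (simp add: step_sum_cell[OF part j] past_ind_eq)
qed

lemma step_sum_outside_right:
  assumes part: "is_partition a b N t" and s: "s \<notin> {a..<b}"
  shows "step_sum N t r s = 0"
  unfolding step_sum_def using supported_before[OF part] s by (simp add: supported_def)

lemma step_kernel_tendsto:
  assumes part: "\<And>k. is_partition a b (N k) (t k)"
    and mesh: "\<And>k j. j < N k \<Longrightarrow> t k (Suc j) - t k j < \<delta> k" and \<delta>: "\<delta> \<longlonglongrightarrow> 0"
  shows "coeff_tendsto (\<lambda>k. step_kernel (N k) (t k) r s) (area_kernel r s)"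
proof -
  have ev: "\<forall>\<^sub>F k in sequentially. step_sum (N k) (t k) r s = (if r \<in> {a..<b} \<and> s \<in> {a..<b} \<and> s < r then 1 else 0)"
    for r s
  proof (cases "r \<in> {a..<b} \<and> s \<in> {a..<b} \<and> s < r")
    case True
    then have "\<forall>\<^sub>F k in sequentially. \<delta> k < r - s" using \<delta> by (intro order_tendstoD) auto
    then show ?thesis
    proof eventually_elim
      case (elim k)
      have "step_sum (N k) (t k) r s = 1"
        using True elim mesh by (intro step_sum_greater[OF part]) (auto intro: less_trans)
      with True show ?case by simp
    qed
  next
    case False
    then have "step_sum (N k) (t k) r s = 0" for k
      using step_sum_outside[OF part] step_sum_outside_right[OF part] step_sum_le[OF part] by (meson not_less)
    with False show ?thesis by simp
  qed
  have "\<forall>\<^sub>F k in sequentially. step_kernel (N k) (t k) r s = area_kernel r s"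
    using ev[of r s] ev[of s r]
  proof eventually_elim
    case (elim k)
    show ?case
      unfolding step_kernel_step_sum elim area_kernel_def
      by (cases r s rule: linorder_cases) (auto simp: cst_def)
  qed
  then show ?thesis
    unfolding coeff_tendsto_def by (auto intro!: tendsto_eventually elim: eventually_mono)
qed

definition kernel_conv :: "(nat \<Rightarrow> real \<Rightarrow> real \<Rightarrow> complex fps) \<Rightarrow> (real \<Rightarrow> real \<Rightarrow> complex fps) \<Rightarrow> bool" where
  "kernel_conv h l \<longleftrightarrow> (\<forall>k. bounded_kernel (h k)) \<and> coeff_bounded (\<lambda>(k, r, s). h k r s) \<and>
     (\<forall>r s. coeff_tendsto (\<lambda>k. h k r s) (l r s))"

lemma bounded_kernel_step:
  assumes "is_partition a b N t" shows "bounded_kernel (step_kernel N t)"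
proof -
  have c: "continuous_on UNIV (fst :: real \<times> real \<Rightarrow> real)" "continuous_on UNIV (snd :: real \<times> real \<Rightarrow> real)"
    by (auto intro: continuous_on_fst continuous_on_snd continuous_on_id)
  have st: "coeff_measurable (step_ind t j)" "coeff_measurable (past_ind t j)" 
    "coeff_bounded (step_ind t j)" "coeff_bounded (past_ind t j)" for j
    using test_before test_within by (auto simp: test_fun_def)
  have "coeff_measurable (\<lambda>z. step_kernel N t (fst z) (snd z))"
    unfolding step_kernel_def
    by (intro coeff_measurable_sum coeff_measurable_mult coeff_measurable_diff coeff_measurable_const
        coeff_measurable_compose[OF _ c(1)] coeff_measurable_compose[OF _ c(2)] st)
  moreover have "coeff_bounded (\<lambda>z. step_kernel N t (fst z) (snd z))"
    unfolding step_kernel_def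
    by (intro coeff_bounded_sum coeff_bounded_mult coeff_bounded_diff coeff_bounded_const
        coeff_bounded_compose[of "step_ind t _" fst] coeff_bounded_compose[of "past_ind t _" fst]
        coeff_bounded_compose[of "step_ind t _" snd] coeff_bounded_compose[of "past_ind t _" snd] st)
  ultimately show ?thesis
    unfolding bounded_kernel_def
    using step_sum_outside[OF assms] step_sum_outside_right[OF assms]
    by (auto simp: case_prod_unfold step_kernel_step_sum)
qed

lemma kernel_conv_step:
  assumes part: "\<And>k. is_partition a b (N k) (t k)"
    and mesh: "\<And>k j. j < N k \<Longrightarrow> t k (Suc j) - t k j < \<delta> k" and \<delta>: "\<delta> \<longlonglongrightarrow> 0"
  shows "kernel_conv (\<lambda>k. step_kernel (N k) (t k)) area_kernel"
proof -
  have bd: "coeff_bounded (\<lambda>(k, r, s). step_sum (N k) (t k) r s)"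
    unfolding coeff_bounded_def
  proof
    fix n
    have "cmod (step_sum (N k) (t k) r s $ n) \<le> 1" for k r s
      using step_sum_cases[OF part[of k], of r s] by (auto simp: fps_one_nth)
    then show "\<exists>B. \<forall>z. cmod ((case z of (k, r, s) \<Rightarrow> step_sum (N k) (t k) r s) $ n) \<le> B" by auto
  qed
  have "coeff_bounded (\<lambda>z. - cst \<i> * ((case z of (k, r, s) \<Rightarrow> step_sum (N k) (t k) r s) -
     (case (fst z, snd (snd z), fst (snd z)) of (k, r, s) \<Rightarrow> step_sum (N k) (t k) r s)))"
    by (intro coeff_bounded_mult coeff_bounded_const coeff_bounded_diff bd coeff_bounded_compose[OF bd])
  then have "coeff_bounded (\<lambda>(k, r, s). step_kernel (N k) (t k) r s)"
    by (simp add: step_kernel_step_sum case_prod_unfold)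
  then show ?thesis
    unfolding kernel_conv_def using bounded_kernel_step[OF part] step_kernel_tendsto[OF assms] by simp
qed

lemma compose_measurable:
  assumes "bounded_kernel K" "bounded_kernel L"
  shows "coeff_measurable (\<lambda>(z, r). K (fst z) r * L r (snd z))"
proof -
  have c: "continuous_on UNIV (\<lambda>w::(real \<times> real) \<times> real. (fst (fst w), snd w))"
    "continuous_on UNIV (\<lambda>w::(real \<times> real) \<times> real. (snd w, snd (fst w)))"
    by (intro continuous_intros)+
  have "coeff_measurable (\<lambda>w. (case (fst (fst w), snd w) of (s, r) \<Rightarrow> K s r) *
      (case (snd w, snd (fst w)) of (r, t) \<Rightarrow> L r t))"
    using assms unfolding bounded_kernel_def
    by (intro coeff_measurable_mult coeff_measurable_compose[OF _ c(1)] coeff_measurable_compose[OF _ c(2)]) auto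
  then show ?thesis by (simp add: case_prod_unfold)
qed

lemma compose_measurable_section:
  assumes "bounded_kernel K" "bounded_kernel L"
  shows "coeff_measurable (\<lambda>r. K s r * L r t)"
  using kernel_section'[OF assms(1), of s] kernel_section[OF assms(2), of t]
  by (auto simp: supported_def test_fun_def intro: coeff_measurable_mult)

lemma bounded_kernel_compose:
  assumes K: "bounded_kernel K" and L: "bounded_kernel L"
  shows "bounded_kernel (kernel_comp K L)"
proof -
  have Kb: "coeff_bounded (\<lambda>(s, t). K s t)" and Lb: "coeff_bounded (\<lambda>(s, t). L s t)"
    using K L by (auto simp: bounded_kernel_def)
  have m: "coeff_measurable (\<lambda>z. kernel_comp K L (fst z) (snd z))"
    unfolding kernel_comp_def by (rule coeff_measurable_coeff_integral[OF compose_measurable[OF K L]])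
  have "coeff_bounded (\<lambda>w. (case (fst (fst w), snd w) of (s, r) \<Rightarrow> K s r) *
      (case (snd w, snd (fst w)) of (r, t) \<Rightarrow> L r t))"
    by (intro coeff_bounded_mult coeff_bounded_compose[OF Kb] coeff_bounded_compose[OF Lb])
  then have "coeff_bounded (\<lambda>(z, r). K (fst z) r * L r (snd z))" by (simp add: case_prod_unfold)
  then have bd: "coeff_bounded (\<lambda>z. kernel_comp K L (fst z) (snd z))"
    unfolding kernel_comp_def by (rule coeff_bounded_coeff_integral[of _ a b]) (use K in \<open>simp add: bounded_kernel_def\<close>)
  have "kernel_comp K L s t = 0" if "s \<notin> {a..<b} \<or> t \<notin> {a..<b}" for s t
    using that K L by (auto simp: kernel_comp_def bounded_kernel_def)
  with m bd show ?thesis by (simp add: bounded_kernel_def case_prod_unfold)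
qed

lemma kernel_conv_compose:
  assumes h: "kernel_conv h l" and K: "kernel_conv K m"
  shows "kernel_conv (\<lambda>k. kernel_comp (h k) (K k)) (kernel_comp l m)"
  unfolding kernel_conv_def
proof (intro conjI allI)
  have hb: "coeff_bounded (\<lambda>(k, r, s). h k r s)" and Kb: "coeff_bounded (\<lambda>(k, r, s). K k r s)"
    and hk: "bounded_kernel (h k)" and Kk: "bounded_kernel (K k)" for k
    using h K by (auto simp: kernel_conv_def)
  show "bounded_kernel (kernel_comp (h k) (K k))" for k
    by (rule bounded_kernel_compose[OF hk Kk])
  have "coeff_bounded (\<lambda>w. (case (fst (fst w), fst (snd (fst w)), snd w) of (k, s, r) \<Rightarrow> h k s r) *
      (case (fst (fst w), snd w, snd (snd (fst w))) of (k, r, t) \<Rightarrow> K k r t))"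
    by (intro coeff_bounded_mult coeff_bounded_compose[OF hb] coeff_bounded_compose[OF Kb])
  then have bd: "coeff_bounded (\<lambda>(z, r). h (fst z) (fst (snd z)) r * K (fst z) r (snd (snd z)))"
    by (simp add: case_prod_unfold)
  have "coeff_bounded (\<lambda>z. kernel_comp (h (fst z)) (K (fst z)) (fst (snd z)) (snd (snd z)))"
    unfolding kernel_comp_def using coeff_bounded_coeff_integral[OF bd, of a b] hk by (simp add: bounded_kernel_def)
  then show "coeff_bounded (\<lambda>(k, r, s). kernel_comp (h k) (K k) r s)" by (simp add: case_prod_unfold)
  show "coeff_tendsto (\<lambda>k. kernel_comp (h k) (K k) r s) (kernel_comp l m r s)" for r s
    unfolding kernel_comp_def
  proof (rule coeff_tendsto_coeff_integral[of _ a b])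
    show "coeff_measurable (\<lambda>u. h k r u * K k u s)" for k
      by (rule compose_measurable_section[OF hk Kk])
    show "coeff_bounded (\<lambda>(k, u). h k r u * K k u s)"
      using coeff_bounded_compose[OF bd, of "\<lambda>w. ((fst w, r, s), snd w)"] by (simp add: case_prod_unfold)
    show "coeff_tendsto (\<lambda>k. h k r u * K k u s) (l r u * m u s)" for u
      using h K by (intro coeff_tendsto_mult) (auto simp: kernel_conv_def)
  qed (use hk in \<open>simp add: bounded_kernel_def\<close>)
qed

lemma kernel_conv_const: "bounded_kernel K \<Longrightarrow> kernel_conv (\<lambda>k. K) K"
  using coeff_bounded_compose[of "\<lambda>(r, s). K r s" snd]
  by (simp add: kernel_conv_def bounded_kernel_def case_prod_unfold)

lemma bounded_kernel_lin:
  assumes "bounded_kernel K" "bounded_kernel L"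
  shows "bounded_kernel (\<lambda>r s. c * K r s + d * L r s)"
proof -
  have "coeff_measurable (\<lambda>z. c * (case z of (r, s) \<Rightarrow> K r s) + d * (case z of (r, s) \<Rightarrow> L r s))"
    "coeff_bounded (\<lambda>z. c * (case z of (r, s) \<Rightarrow> K r s) + d * (case z of (r, s) \<Rightarrow> L r s))"
    using assms unfolding bounded_kernel_def
    by (intro coeff_measurable_add coeff_measurable_mult coeff_measurable_const
        coeff_bounded_add coeff_bounded_mult coeff_bounded_const; blast)+
  then show ?thesis using assms by (simp add: bounded_kernel_def case_prod_unfold)
qed

lemma kernel_conv_lin:
  assumes "kernel_conv h l" "kernel_conv K m"
  shows "kernel_conv (\<lambda>k r s. c * h k r s + d * K k r s) (\<lambda>r s. c * l r s + d * m r s)"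
proof -
  have "coeff_bounded (\<lambda>z. c * (case z of (k, r, s) \<Rightarrow> h k r s) + d * (case z of (k, r, s) \<Rightarrow> K k r s))"
    using assms unfolding kernel_conv_def
    by (intro coeff_bounded_add coeff_bounded_mult coeff_bounded_const; blast)
  moreover have "coeff_tendsto (\<lambda>k. c * h k r s + d * K k r s) (c * l r s + d * m r s)" for r s
    using assms unfolding kernel_conv_def
    by (intro coeff_tendsto_add coeff_tendsto_mult coeff_tendsto_const; blast)
  ultimately show ?thesis
    using assms by (simp add: kernel_conv_def case_prod_unfold bounded_kernel_lin)
qed

lemma kernel_trace_tendsto:
  assumes "kernel_conv h l"
  shows "coeff_tendsto (\<lambda>k. kernel_trace (h k)) (kernel_trace l)" and "coeff_bounded (\<lambda>k. kernel_trace (h k))"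
proof -
  have hb: "coeff_bounded (\<lambda>(k, r, s). h k r s)" and hk: "bounded_kernel (h k)" for k
    using assms by (auto simp: kernel_conv_def)
  have bd: "coeff_bounded (\<lambda>(k, s). h k s s)"
    using coeff_bounded_compose[OF hb, of "\<lambda>w. (fst w, snd w, snd w)"] by (simp add: case_prod_unfold)
  have c: "continuous_on UNIV (\<lambda>s::real. (s, s))" by (intro continuous_intros)
  have "coeff_measurable (\<lambda>s. case (s, s) of (r, s) \<Rightarrow> h k r s)" for k
    using hk[of k] unfolding bounded_kernel_def by (intro coeff_measurable_compose[OF _ c]) blast
  then have "coeff_measurable (\<lambda>s. h k s s)" for k by simp
  then show "coeff_tendsto (\<lambda>k. kernel_trace (h k)) (kernel_trace l)"
    unfolding kernel_trace_def
    by (rule coeff_tendsto_coeff_integral[OF _ bd, of a b]) (use assms hk in \<open>auto simp: kernel_conv_def bounded_kernel_def\<close>)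
  show "coeff_bounded (\<lambda>k. kernel_trace (h k))"
    unfolding kernel_trace_def
    by (rule coeff_bounded_coeff_integral[OF bd, of a b]) (use hk in \<open>simp add: bounded_kernel_def\<close>)
qed

definition limit_kernel :: "real \<Rightarrow> (real \<Rightarrow> real \<Rightarrow> complex fps) \<Rightarrow> real \<Rightarrow> real \<Rightarrow> complex fps" where
  "limit_kernel \<sigma> K r s = (let c = cst (of_real (c_plus \<sigma>)); d = cst (of_real (c_minus \<sigma>)); h = area_kernel in
     c * d * h r s + c * c * kernel_comp h K r s + d * d * kernel_comp K h r s + c * d * kernel_comp K (kernel_comp h K) r s)"

definition limit_trace :: "real \<Rightarrow> (real \<Rightarrow> real \<Rightarrow> complex fps) \<Rightarrow> complex fps" where
  "limit_trace \<sigma> K = cst (of_real (c_plus \<sigma> * c_minus \<sigma>)) * kernel_trace (kernel_comp area_kernel K)"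

lemma riemann_conv:
  assumes part: "\<And>k. is_partition a b (N k) (t k)"
    and mesh: "\<And>k j. j < N k \<Longrightarrow> t k (Suc j) - t k j < \<delta> k" and \<delta>: "\<delta> \<longlonglongrightarrow> 0"
    and K: "bounded_kernel K"
  shows "kernel_conv (\<lambda>k. riemann_kernel \<sigma> K (N k) (t k)) (limit_kernel \<sigma> K)"
    and "coeff_tendsto (\<lambda>k. riemann_trace \<sigma> K (N k) (t k)) (limit_trace \<sigma> K)"
    and "coeff_bounded (\<lambda>k. riemann_trace \<sigma> K (N k) (t k))"
proof -
  let ?h = "\<lambda>k. step_kernel (N k) (t k)"
  let ?c = "cst (of_real (c_plus \<sigma>))" and ?d = "cst (of_real (c_minus \<sigma>))"
  note h = kernel_conv_step[OF part mesh \<delta>] and Kc = kernel_conv_const[OF K]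
  note hK = kernel_conv_compose[OF h Kc]
  have "kernel_conv (\<lambda>k r s. 1 * (?c * ?d * ?h k r s + ?c * ?c * kernel_comp (?h k) K r s) +
      1 * (?d * ?d * kernel_comp K (?h k) r s + ?c * ?d * kernel_comp K (kernel_comp (?h k) K) r s))
    (\<lambda>r s. 1 * (?c * ?d * area_kernel r s + ?c * ?c * kernel_comp area_kernel K r s) +
      1 * (?d * ?d * kernel_comp K area_kernel r s + ?c * ?d * kernel_comp K (kernel_comp area_kernel K) r s))"
    by (intro kernel_conv_lin h hK kernel_conv_compose[OF Kc h] kernel_conv_compose[OF Kc hK])
  moreover have "riemann_kernel \<sigma> K (N k) (t k) = (\<lambda>r s. 1 * (?c * ?d * ?h k r s + ?c * ?c * kernel_comp (?h k) K r s) +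
      1 * (?d * ?d * kernel_comp K (?h k) r s + ?c * ?d * kernel_comp K (kernel_comp (?h k) K) r s))" for k
    by (intro ext) (simp add: riemann_kernel_eq[OF part K])
  moreover have "limit_kernel \<sigma> K = (\<lambda>r s. 1 * (?c * ?d * area_kernel r s + ?c * ?c * kernel_comp area_kernel K r s) +
      1 * (?d * ?d * kernel_comp K area_kernel r s + ?c * ?d * kernel_comp K (kernel_comp area_kernel K) r s))"
    by (intro ext) (simp add: limit_kernel_def Let_def add.assoc)
  ultimately show "kernel_conv (\<lambda>k. riemann_kernel \<sigma> K (N k) (t k)) (limit_kernel \<sigma> K)" by simp
  show "coeff_tendsto (\<lambda>k. riemann_trace \<sigma> K (N k) (t k)) (limit_trace \<sigma> K)"
    unfolding riemann_trace_eq[OF part K] limit_trace_def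
    by (intro coeff_tendsto_mult coeff_tendsto_const kernel_trace_tendsto(1)[OF hK])
  show "coeff_bounded (\<lambda>k. riemann_trace \<sigma> K (N k) (t k))"
    unfolding riemann_trace_eq[OF part K]
    by (intro coeff_bounded_mult coeff_bounded_const kernel_trace_tendsto(2)[OF hK])
qed

end

(*PART8*)
lemma borel_equality_set:
  fixes f g :: "'a \<Rightarrow> complex"
  assumes "f \<in> borel_measurable M" "g \<in> borel_measurable M"
  shows "{z \<in> space M. f z = g z} \<in> sets M"
proof -
  have "(\<lambda>z. f z - g z) \<in> borel_measurable M" using assms by (rule borel_measurable_diff)
  from measurable_sets[OF this, of "{0}"] show ?thesis by (simp add: vimage_def Int_def conj_commute)
qed

abbreviation points :: "nat \<Rightarrow> (nat \<Rightarrow> real) measure" where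
  "points n \<equiv> \<Pi>\<^sub>M i\<in>{..<n}. half_line"

interpretation half_lines: product_sigma_finite "\<lambda>_::nat. half_line"
  by (simp add: product_sigma_finite_def sigma_finite_half_line)

lemma sigma_finite_points: "sigma_finite_measure (points n)"
  by (rule half_lines.sigma_finite) simp

definition insert_point :: "nat \<Rightarrow> nat \<Rightarrow> (nat \<Rightarrow> real) \<Rightarrow> real \<Rightarrow> nat \<Rightarrow> real" where
  "insert_point p i x s = (\<lambda>j\<in>{..<Suc p}. if j < i then x j else if j = i then s else x (j - 1))"

lemma insert_point_last: "x \<in> space (points p) \<Longrightarrow> insert_point p p x s = x(p := s)"
  by (auto simp: insert_point_def space_PiM PiE_def extensional_def fun_eq_iff)

lemma delete_insert_point: "x \<in> space (points p) \<Longrightarrow> i < Suc p \<Longrightarrow> delete_point (Suc p) i (insert_point p i x s) = x"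
  by (auto simp: insert_point_def delete_point_def space_PiM PiE_def extensional_def fun_eq_iff)

lemma insert_point_skip: "i < Suc p \<Longrightarrow> r < p \<Longrightarrow> insert_point p i x s (skip i r) = x r"
  by (auto simp: insert_point_def skip_def)

lemma insert_point_at: "i < Suc p \<Longrightarrow> insert_point p i x s i = s"
  by (auto simp: insert_point_def)

lemma measurable_coordinate: "i < n \<Longrightarrow> (\<lambda>x. x i) \<in> points n \<rightarrow>\<^sub>M half_line"
  by (rule measurable_component_singleton) simp

lemma measurable_insert_point:
  assumes "i < Suc p"
  shows "(\<lambda>z. insert_point p i (fst z) (snd z)) \<in> points p \<Otimes>\<^sub>M half_line \<rightarrow>\<^sub>M points (Suc p)"
  unfolding insert_point_def
proof (rule measurable_restrict)
  fix j assume "j \<in> {..<Suc p}"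
  then consider "j < i" "j < p" | "j = i" | "\<not> j < i" "j \<noteq> i" "j - 1 < p" using assms by force
  then show "(\<lambda>z. if j < i then fst z j else if j = i then snd z else fst z (j - 1)) \<in>
      points p \<Otimes>\<^sub>M half_line \<rightarrow>\<^sub>M half_line"
    by cases (auto intro: measurable_compose[OF measurable_fst measurable_coordinate])
qed

lemma measurable_delete_point: "delete_point n i \<in> points n \<rightarrow>\<^sub>M points (n - 1)"
  unfolding delete_point_def[abs_def]
proof (rule measurable_restrict)
  fix j assume "j \<in> {..<n - 1}"
  then show "(\<lambda>x. if j < i then x j else x (Suc j)) \<in> points n \<rightarrow>\<^sub>M half_line"
    by (cases "j < i") (auto intro!: measurable_component_singleton)
qed

lemma distr_insert_point:
  assumes i: "i < Suc p"
  shows "distr (points p \<Otimes>\<^sub>M half_line) (points (Suc p)) (\<lambda>z. insert_point p i (fst z) (snd z)) = points (Suc p)"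
proof (rule half_lines.PiM_eqI)
  fix A assume A: "\<And>j. j \<in> {..<Suc p} \<Longrightarrow> A j \<in> sets half_line"
  interpret P: sigma_finite_measure "points p" by (rule sigma_finite_points)
  have iff: "insert_point p i x s \<in> Pi\<^sub>E {..<Suc p} A \<longleftrightarrow> x \<in> (\<Pi>\<^sub>E r\<in>{..<p}. A (skip i r)) \<and> s \<in> A i"
    if x: "x \<in> space (points p)" for x s
  proof -
    have "insert_point p i x s \<in> extensional {..<Suc p}" unfolding insert_point_def by (rule restrict_extensional)
    then have "insert_point p i x s \<in> Pi\<^sub>E {..<Suc p} A \<longleftrightarrow> (\<forall>j\<in>{..<Suc p}. insert_point p i x s j \<in> A j)"
      by (simp only: PiE_def Pi_iff Int_iff simp_thms)
    also have "\<dots> \<longleftrightarrow> (\<forall>j\<in>{..<Suc p} - {i}. insert_point p i x s j \<in> A j) \<and> s \<in> A i"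
      using i by (metis Diff_iff insert_point_at lessThan_iff singletonD)
    also have "(\<forall>j\<in>{..<Suc p} - {i}. insert_point p i x s j \<in> A j) \<longleftrightarrow> (\<forall>r\<in>{..<p}. x r \<in> A (skip i r))"
      unfolding bij_betw_imp_surj_on[OF bij_betw_skip[OF i], symmetric] by (simp add: insert_point_skip[OF i])
    also have "\<dots> \<longleftrightarrow> x \<in> (\<Pi>\<^sub>E r\<in>{..<p}. A (skip i r))"
      using x by (auto simp: space_PiM PiE_def)
    finally show ?thesis .
  qed
  have Ar: "A (skip i r) \<in> sets half_line" if "r < p" for r
    using A[of "skip i r"] bij_betwE[OF bij_betw_skip[OF i]] that by auto
  have sub: "(\<Pi>\<^sub>E r\<in>{..<p}. A (skip i r)) \<subseteq> space (points p)"
    using Ar[THEN sets.sets_into_space] by (auto simp: space_PiM PiE_def Pi_def)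
  have "(\<lambda>z. insert_point p i (fst z) (snd z)) -` Pi\<^sub>E {..<Suc p} A \<inter> space (points p \<Otimes>\<^sub>M half_line) =
    (\<Pi>\<^sub>E r\<in>{..<p}. A (skip i r)) \<times> A i"
    using iff sub sets.sets_into_space[OF A[of i]] i by (auto simp: space_pair_measure)
  moreover have "Pi\<^sub>E {..<Suc p} A \<in> sets (points (Suc p))" using A by (intro sets_PiM_I_finite) auto
  moreover have "(\<Pi>\<^sub>E r\<in>{..<p}. A (skip i r)) \<in> sets (points p)" using Ar by (intro sets_PiM_I_finite) auto
  ultimately have "emeasure (distr (points p \<Otimes>\<^sub>M half_line) (points (Suc p)) (\<lambda>z. insert_point p i (fst z) (snd z)))
      (Pi\<^sub>E {..<Suc p} A) = emeasure (points p) (\<Pi>\<^sub>E r\<in>{..<p}. A (skip i r)) * emeasure half_line (A i)"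
    using A[of i] i
    by (simp add: emeasure_distr measurable_insert_point half_line.emeasure_pair_measure_Times)
  also have "emeasure (points p) (\<Pi>\<^sub>E r\<in>{..<p}. A (skip i r)) = (\<Prod>r<p. emeasure half_line (A (skip i r)))"
    using Ar by (intro half_lines.emeasure_PiM) auto
  also have "\<dots> = (\<Prod>j\<in>{..<Suc p} - {i}. emeasure half_line (A j))"
    by (rule prod.reindex_bij_betw[OF bij_betw_skip[OF i]])
  also have "\<dots> * emeasure half_line (A i) = (\<Prod>j\<in>{..<Suc p}. emeasure half_line (A j))"
    using i by (subst (2) prod.remove[of _ i]) (auto simp: mult.commute)
  finally show "emeasure (distr (points p \<Otimes>\<^sub>M half_line) (points (Suc p)) (\<lambda>z. insert_point p i (fst z) (snd z)))
      (Pi\<^sub>E {..<Suc p} A) = (\<Prod>j\<in>{..<Suc p}. emeasure half_line (A j))" .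
qed simp_all

lemma AE_insert_point:
  assumes "AE x in points (Suc p). R x"
  shows "AE x in points p. AE s in half_line. R (x(p := s))"
proof -
  interpret pair_sigma_finite "points p" half_line
    by (intro pair_sigma_finite.intro sigma_finite_points sigma_finite_half_line)
  have "AE z in points p \<Otimes>\<^sub>M half_line. R (insert_point p p (fst z) (snd z))"
    by (rule AE_distrD[OF measurable_insert_point], simp, subst distr_insert_point, simp, rule assms)
  from AE_pair[OF this] have "AE x in points p. AE s in half_line. R (insert_point p p x s)" by simp
  then show ?thesis by (rule AE_mp) (auto intro!: AE_I2 simp: insert_point_last)
qed

lemma AE_delete_point:
  assumes R: "AE x in points p. R x" and i: "i < Suc p"
  shows "AE x in points (Suc p). R (delete_point (Suc p) i x)"
proof -
  interpret P: sigma_finite_measure "points p" by (rule sigma_finite_points)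
  obtain N where N: "{x \<in> space (points p). \<not> R x} \<subseteq> N" "N \<in> sets (points p)" "emeasure (points p) N = 0"
    using R by (auto elim: AE_E)
  have dm: "delete_point (Suc p) i \<in> points (Suc p) \<rightarrow>\<^sub>M points p"
    using measurable_delete_point[of "Suc p" i] by simp
  let ?N = "delete_point (Suc p) i -` N \<inter> space (points (Suc p))"
  have Nm: "?N \<in> sets (points (Suc p))" using dm N(2) by (rule measurable_sets)
  have "(\<lambda>z. insert_point p i (fst z) (snd z)) -` ?N \<inter> space (points p \<Otimes>\<^sub>M half_line) \<subseteq> N \<times> space half_line"
    by (auto simp: space_pair_measure delete_insert_point i)
  then have "emeasure (points p \<Otimes>\<^sub>M half_line) ((\<lambda>z. insert_point p i (fst z) (snd z)) -` ?N \<inter> space (points p \<Otimes>\<^sub>M half_line))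
      \<le> emeasure (points p \<Otimes>\<^sub>M half_line) (N \<times> space half_line)"
    by (rule emeasure_mono) (rule pair_measureI[OF N(2) sets.top])
  also have "\<dots> = 0"
    by (subst half_line.emeasure_pair_measure_Times[OF N(2) sets.top]) (simp add: N(3))
  finally have "emeasure (distr (points p \<Otimes>\<^sub>M half_line) (points (Suc p)) (\<lambda>z. insert_point p i (fst z) (snd z))) ?N = 0"
    using Nm i by (simp add: emeasure_distr measurable_insert_point)
  then have "emeasure (points (Suc p)) ?N = 0" by (simp add: distr_insert_point[OF i])
  then have "AE x in points (Suc p). x \<notin> ?N" using Nm by (intro AE_not_in) auto
  then show ?thesis
  proof (rule AE_mp, intro AE_I2 impI)
    fix x assume "x \<in> space (points (Suc p))" "x \<notin> ?N"
    then show "R (delete_point (Suc p) i x)" using N(1) measurable_space[OF dm, of x] by blast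
  qed
qed

definition fock_ae_eq :: "fock \<Rightarrow> fock \<Rightarrow> bool" where
  "fock_ae_eq \<psi> \<psi>' \<longleftrightarrow> (\<forall>n. \<psi> n \<in> borel_measurable (points n) \<and> \<psi>' n \<in> borel_measurable (points n) \<and>
     (AE x in points n. \<psi> n x = \<psi>' n x))"

lemma measurable_update_point:
  assumes "x \<in> space (points n)" shows "(\<lambda>s. x(n := s)) \<in> half_line \<rightarrow>\<^sub>M points (Suc n)"
proof -
  have "(\<lambda>s. insert_point n n (fst (x, s)) (snd (x, s))) \<in> half_line \<rightarrow>\<^sub>M points (Suc n)"
    using assms by (intro measurable_compose[OF _ measurable_insert_point]) auto
  then show ?thesis using insert_point_last[OF assms] by simp
qed

lemma annih_ae:
  assumes "fock_ae_eq \<psi> \<psi>'"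
  shows "AE x in points n. annih t \<psi> n x = annih t \<psi>' n x"
proof -
  have m: "\<psi> (Suc n) \<in> borel_measurable (points (Suc n))" "\<psi>' (Suc n) \<in> borel_measurable (points (Suc n))"
    and ae: "AE x in points (Suc n). \<psi> (Suc n) x = \<psi>' (Suc n) x"
    using assms by (auto simp: fock_ae_eq_def)
  have ind: "(\<lambda>s. cnj (indicator {0..<t} s)) \<in> borel_measurable half_line"
    by (rule borel_imp_half_line) (simp add: indicator_def[abs_def])
  from AE_insert_point[OF ae] show ?thesis
  proof (rule AE_mp, intro AE_I2 impI)
    fix x assume x: "x \<in> space (points n)"
      and eq: "AE s in half_line. \<psi> (Suc n) (x(n := s)) = \<psi>' (Suc n) (x(n := s))"
    note u = measurable_update_point[OF x]
    show "annih t \<psi> n x = annih t \<psi>' n x"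
      unfolding annih_def annihilation_def
      by (intro arg_cong2[where f = "(*)"] refl integral_cong_AE borel_measurable_times ind
          measurable_compose[OF u m(1)] measurable_compose[OF u m(2)])
        (use eq in auto)
  qed
qed

lemma creat_ae:
  assumes "fock_ae_eq \<psi> \<psi>'"
  shows "AE x in points n. creat t \<psi> n x = creat t \<psi>' n x"
proof -
  have "AE x in points n. \<forall>i\<in>{..<n}. \<psi> (n - 1) (delete_point n i x) = \<psi>' (n - 1) (delete_point n i x)"
  proof (rule AE_finite_allI)
    fix i assume "i \<in> {..<n}"
    then show "AE x in points n. \<psi> (n - 1) (delete_point n i x) = \<psi>' (n - 1) (delete_point n i x)"
    proof (cases n)
      case (Suc p)
      have "AE x in points p. \<psi> p x = \<psi>' p x" using assms unfolding fock_ae_eq_def by blast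
      from AE_delete_point[OF this] show ?thesis using \<open>i \<in> {..<n}\<close> unfolding Suc by simp
    qed simp
  qed simp
  then show ?thesis by (rule AE_mp) (auto intro!: AE_I2 simp: creat_def creation_def)
qed

lemma annih_measurable:
  assumes "\<And>n. (\<lambda>z. \<psi> n (fst z) (snd z)) \<in> borel_measurable (points n \<Otimes>\<^sub>M M)"
  shows "(\<lambda>z. annih t (\<lambda>n x. \<psi> n x (snd z)) m (fst z)) \<in> borel_measurable (points m \<Otimes>\<^sub>M M)"
proof -
  have "(\<lambda>w. (insert_point m m (fst (fst (fst w), snd w)) (snd (fst (fst w), snd w)), snd (fst w))) \<in>
      (points m \<Otimes>\<^sub>M M) \<Otimes>\<^sub>M half_line \<rightarrow>\<^sub>M points (Suc m) \<Otimes>\<^sub>M M"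
    by (intro measurable_Pair measurable_compose[OF _ measurable_insert_point]) simp_all
  from measurable_compose[OF this assms]
  have p: "(\<lambda>w. \<psi> (Suc m) (insert_point m m (fst (fst w)) (snd w)) (snd (fst w))) \<in>
      borel_measurable ((points m \<Otimes>\<^sub>M M) \<Otimes>\<^sub>M half_line)" by simp
  have ind: "(\<lambda>s. cnj (indicator {0..<t} s)) \<in> borel_measurable half_line"
    by (rule borel_imp_half_line) (simp add: indicator_def[abs_def])
  have "(\<lambda>z. \<integral>s. cnj (indicator {0..<t} s) * \<psi> (Suc m) (insert_point m m (fst z) s) (snd z) \<partial>half_line) \<in>
      borel_measurable (points m \<Otimes>\<^sub>M M)"
    by (rule half_line.borel_measurable_lebesgue_integral, unfold case_prod_unfold)
      (intro borel_measurable_times p measurable_compose[OF measurable_snd ind])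
  then have "(\<lambda>z. of_real (sqrt (real (Suc m))) *
      (\<integral>s. cnj (indicator {0..<t} s) * \<psi> (Suc m) (insert_point m m (fst z) s) (snd z) \<partial>half_line)) \<in>
      borel_measurable (points m \<Otimes>\<^sub>M M)"
    by (intro borel_measurable_times borel_measurable_const)
  then show ?thesis
    by (rule measurable_cong[THEN iffD1, rotated])
      (auto simp: annih_def annihilation_def space_pair_measure insert_point_last)
qed

lemma creat_measurable:
  assumes "\<And>n. (\<lambda>z. \<psi> n (fst z) (snd z)) \<in> borel_measurable (points n \<Otimes>\<^sub>M M)"
  shows "(\<lambda>z. creat t (\<lambda>n x. \<psi> n x (snd z)) m (fst z)) \<in> borel_measurable (points m \<Otimes>\<^sub>M M)"
  unfolding creat_def creation_def
proof (intro borel_measurable_divide borel_measurable_sum borel_measurable_times borel_measurable_const)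
  fix i assume i: "i \<in> {..<m}"
  have "(\<lambda>s. indicator {0..<t} s :: complex) \<in> borel_measurable half_line"
    by (rule borel_imp_half_line) (simp add: indicator_def[abs_def])
  then show "(\<lambda>z. indicator {0..<t} (fst z i) :: complex) \<in> borel_measurable (points m \<Otimes>\<^sub>M M)"
    using i by (intro measurable_compose[OF measurable_compose[OF measurable_fst measurable_coordinate]]) auto
  have "(\<lambda>z. (delete_point m i (fst z), snd z)) \<in> points m \<Otimes>\<^sub>M M \<rightarrow>\<^sub>M points (m - 1) \<Otimes>\<^sub>M M"
    by (intro measurable_Pair measurable_compose[OF measurable_fst measurable_delete_point] measurable_snd)
  from measurable_compose[OF this assms]
  show "(\<lambda>z. \<psi> (m - 1) (delete_point m i (fst z)) (snd z)) \<in> borel_measurable (points m \<Otimes>\<^sub>M M)" by simp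
qed

definition sector_fun :: "fock2 \<Rightarrow> nat \<Rightarrow> nat \<Rightarrow> (nat \<Rightarrow> real) \<times> (nat \<Rightarrow> real) \<Rightarrow> complex" where
  "sector_fun \<Psi> p q z = \<Psi> p q (fst z) (snd z)"

definition ae_eq :: "fock2 \<Rightarrow> fock2 \<Rightarrow> bool" where
  "ae_eq \<Psi> \<Psi>' \<longleftrightarrow> (\<forall>p q. sector_fun \<Psi> p q \<in> borel_measurable (sector p q) \<and>
     sector_fun \<Psi>' p q \<in> borel_measurable (sector p q) \<and>
     (AE z in sector p q. sector_fun \<Psi> p q z = sector_fun \<Psi>' p q z))"

lemma pair_sigma_finite_points: "pair_sigma_finite (points p) (points q)"
  by (intro pair_sigma_finite.intro sigma_finite_points)

lemma ae_eqI:
  assumes m: "\<And>p q. sector_fun \<Psi> p q \<in> borel_measurable (sector p q)" "\<And>p q. sector_fun \<Psi>' p q \<in> borel_measurable (sector p q)"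
    and ae: "\<And>p q. AE y in points q. AE x in points p. \<Psi> p q x y = \<Psi>' p q x y"
  shows "ae_eq \<Psi> \<Psi>'"
  unfolding ae_eq_def
proof (intro allI conjI m)
  fix p q
  interpret pair_sigma_finite "points p" "points q" by (rule pair_sigma_finite_points)
  have S: "{z \<in> space (sector p q). sector_fun \<Psi> p q z = sector_fun \<Psi>' p q z} \<in> sets (sector p q)"
    by (intro borel_equality_set m)
  then have "AE x in points p. AE y in points q. \<Psi> p q x y = \<Psi>' p q x y"
    using ae[of q p] ae[of p q] by (subst AE_commute) (simp_all add: sector_def sector_fun_def)
  then show "AE z in sector p q. sector_fun \<Psi> p q z = sector_fun \<Psi>' p q z"
    unfolding sector_def using S
    by (intro AE_pair_measure) (simp_all add: sector_def sector_fun_def)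
qed

lemma ae_eqI':
  assumes m: "\<And>p q. sector_fun \<Psi> p q \<in> borel_measurable (sector p q)" "\<And>p q. sector_fun \<Psi>' p q \<in> borel_measurable (sector p q)"
    and ae: "\<And>p q. AE x in points p. AE y in points q. \<Psi> p q x y = \<Psi>' p q x y"
  shows "ae_eq \<Psi> \<Psi>'"
  unfolding ae_eq_def
proof (intro allI conjI m)
  fix p q
  interpret pair_sigma_finite "points p" "points q" by (rule pair_sigma_finite_points)
  have S: "{z \<in> space (sector p q). sector_fun \<Psi> p q z = sector_fun \<Psi>' p q z} \<in> sets (sector p q)"
    by (intro borel_equality_set m)
  then show "AE z in sector p q. sector_fun \<Psi> p q z = sector_fun \<Psi>' p q z"
    unfolding sector_def using ae[of p q]
    by (intro AE_pair_measure) (simp_all add: sector_def sector_fun_def)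
qed

lemma ae_eqD:
  assumes "ae_eq \<Psi> \<Psi>'"
  shows "AE x in points p. AE y in points q. \<Psi> p q x y = \<Psi>' p q x y"
    and "AE y in points q. AE x in points p. \<Psi> p q x y = \<Psi>' p q x y"
proof -
  interpret pair_sigma_finite "points p" "points q" by (rule pair_sigma_finite_points)
  have ae: "AE z in points p \<Otimes>\<^sub>M points q. sector_fun \<Psi> p q z = sector_fun \<Psi>' p q z"
    and m: "sector_fun \<Psi> p q \<in> borel_measurable (sector p q)" "sector_fun \<Psi>' p q \<in> borel_measurable (sector p q)"
    using assms unfolding ae_eq_def sector_def by blast+
  have S: "{z \<in> space (sector p q). sector_fun \<Psi> p q z = sector_fun \<Psi>' p q z} \<in> sets (sector p q)"
    by (intro borel_equality_set m)
  show 1: "AE x in points p. AE y in points q. \<Psi> p q x y = \<Psi>' p q x y"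
    using AE_pair[OF ae] by (simp add: sector_fun_def)
  show "AE y in points q. AE x in points p. \<Psi> p q x y = \<Psi>' p q x y"
    using 1 S by (subst AE_commute[symmetric]) (simp_all add: sector_def sector_fun_def)
qed

lemma sector_swap: "(\<lambda>z. (snd z, fst z)) \<in> sector p q \<rightarrow>\<^sub>M points q \<Otimes>\<^sub>M points p"
  unfolding sector_def by (intro measurable_Pair measurable_fst measurable_snd)

lemma on_left_measurable:
  assumes "\<And>p q. sector_fun \<Psi> p q \<in> borel_measurable (sector p q)"
  shows "sector_fun (on_left (annih t) \<Psi>) p q \<in> borel_measurable (sector p q)"
    and "sector_fun (on_left (creat t) \<Psi>) p q \<in> borel_measurable (sector p q)"
  using annih_measurable[of "\<lambda>n x y. \<Psi> n q x y" "points q" t p] creat_measurable[of "\<lambda>n x y. \<Psi> n q x y" "points q" t p] assms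
  by (simp_all add: sector_fun_def[abs_def] on_left_def sector_def)

lemma on_right_measurable:
  assumes "\<And>p q. sector_fun \<Psi> p q \<in> borel_measurable (sector p q)"
  shows "sector_fun (on_right (annih t) \<Psi>) p q \<in> borel_measurable (sector p q)"
    and "sector_fun (on_right (creat t) \<Psi>) p q \<in> borel_measurable (sector p q)"
proof -
  have "(\<lambda>z. \<Psi> p n (snd z) (fst z)) \<in> borel_measurable (points n \<Otimes>\<^sub>M points p)" for n
    using measurable_compose[OF sector_swap[of n p, unfolded sector_def] assms[of p n, unfolded sector_def]]
    by (simp add: sector_fun_def)
  note m = measurable_compose[OF sector_swap[of p q] annih_measurable[of "\<lambda>n y x. \<Psi> p n x y", OF this, of t q]]
    measurable_compose[OF sector_swap[of p q] creat_measurable[of "\<lambda>n y x. \<Psi> p n x y", OF this, of t q]]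
  show "sector_fun (on_right (annih t) \<Psi>) p q \<in> borel_measurable (sector p q)"
    "sector_fun (on_right (creat t) \<Psi>) p q \<in> borel_measurable (sector p q)"
    using m by (simp_all add: sector_fun_def[abs_def] on_right_def)
qed

lemma section_measurable:
  assumes "sector_fun \<Psi> p q \<in> borel_measurable (sector p q)"
  shows "y \<in> space (points q) \<Longrightarrow> (\<lambda>x. \<Psi> p q x y) \<in> borel_measurable (points p)"
    and "x \<in> space (points p) \<Longrightarrow> (\<lambda>y. \<Psi> p q x y) \<in> borel_measurable (points q)"
proof -
  note m = assms[unfolded sector_def]
  show "(\<lambda>x. \<Psi> p q x y) \<in> borel_measurable (points p)" if "y \<in> space (points q)"
    using measurable_compose[OF measurable_Pair2'[OF that] m] by (simp add: sector_fun_def)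
  show "(\<lambda>y. \<Psi> p q x y) \<in> borel_measurable (points q)" if "x \<in> space (points p)"
    using measurable_compose[OF measurable_Pair1'[OF that] m] by (simp add: sector_fun_def)
qed

lemma ae_eq_on_left:
  assumes "ae_eq \<Psi> \<Psi>'"
  shows "ae_eq (on_left (annih t) \<Psi>) (on_left (annih t) \<Psi>')" and "ae_eq (on_left (creat t) \<Psi>) (on_left (creat t) \<Psi>')"
proof -
  have m: "sector_fun \<Psi> p q \<in> borel_measurable (sector p q)" "sector_fun \<Psi>' p q \<in> borel_measurable (sector p q)" for p q
    using assms by (auto simp: ae_eq_def)
  have "AE y in points q. \<forall>p. AE x in points p. \<Psi> p q x y = \<Psi>' p q x y" for q
    using ae_eqD(2)[OF assms] by (simp add: AE_all_countable)
  then have *: "AE y in points q. fock_ae_eq (\<lambda>p x. \<Psi> p q x y) (\<lambda>p x. \<Psi>' p q x y)" for q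
    by (rule AE_mp) (auto intro!: AE_I2 simp: fock_ae_eq_def section_measurable[OF m(1)] section_measurable[OF m(2)])
  show "ae_eq (on_left (annih t) \<Psi>) (on_left (annih t) \<Psi>')"
  proof (rule ae_eqI)
    show "AE y in points q. AE x in points p. on_left (annih t) \<Psi> p q x y = on_left (annih t) \<Psi>' p q x y" for p q
      using *[of q] by (rule AE_mp) (auto intro!: AE_I2 annih_ae simp: on_left_def)
  qed (use on_left_measurable m in blast)+
  show "ae_eq (on_left (creat t) \<Psi>) (on_left (creat t) \<Psi>')"
  proof (rule ae_eqI)
    show "AE y in points q. AE x in points p. on_left (creat t) \<Psi> p q x y = on_left (creat t) \<Psi>' p q x y" for p q
      using *[of q] by (rule AE_mp) (auto intro!: AE_I2 creat_ae simp: on_left_def)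
  qed (use on_left_measurable m in blast)+
qed

lemma ae_eq_on_right:
  assumes "ae_eq \<Psi> \<Psi>'"
  shows "ae_eq (on_right (annih t) \<Psi>) (on_right (annih t) \<Psi>')" and "ae_eq (on_right (creat t) \<Psi>) (on_right (creat t) \<Psi>')"
proof -
  have m: "sector_fun \<Psi> p q \<in> borel_measurable (sector p q)" "sector_fun \<Psi>' p q \<in> borel_measurable (sector p q)" for p q
    using assms by (auto simp: ae_eq_def)
  have "AE x in points p. \<forall>q. AE y in points q. \<Psi> p q x y = \<Psi>' p q x y" for p
    using ae_eqD(1)[OF assms] by (simp add: AE_all_countable)
  then have *: "AE x in points p. fock_ae_eq (\<lambda>q y. \<Psi> p q x y) (\<lambda>q y. \<Psi>' p q x y)" for p
    by (rule AE_mp) (auto intro!: AE_I2 simp: fock_ae_eq_def section_measurable[OF m(1)] section_measurable[OF m(2)])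
  show "ae_eq (on_right (annih t) \<Psi>) (on_right (annih t) \<Psi>')"
  proof (rule ae_eqI')
    show "AE x in points p. AE y in points q. on_right (annih t) \<Psi> p q x y = on_right (annih t) \<Psi>' p q x y" for p q
      using *[of p] by (rule AE_mp) (auto intro!: AE_I2 annih_ae simp: on_right_def)
  qed (use on_right_measurable m in blast)+
  show "ae_eq (on_right (creat t) \<Psi>) (on_right (creat t) \<Psi>')"
  proof (rule ae_eqI')
    show "AE x in points p. AE y in points q. on_right (creat t) \<Psi> p q x y = on_right (creat t) \<Psi>' p q x y" for p q
      using *[of p] by (rule AE_mp) (auto intro!: AE_I2 creat_ae simp: on_right_def)
  qed (use on_right_measurable m in blast)+
qed

lemma ae_eq_scale:
  assumes "ae_eq \<Psi> \<Psi>'" shows "ae_eq (scale c \<Psi>) (scale c \<Psi>')"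
  unfolding ae_eq_def
proof (intro allI conjI)
  fix p q
  have eq: "sector_fun (scale c A) p q = (\<lambda>z. c * sector_fun A p q z)" for A
    by (simp add: sector_fun_def fun_eq_iff scale_def)
  show "sector_fun (scale c \<Psi>) p q \<in> borel_measurable (sector p q)"
    "sector_fun (scale c \<Psi>') p q \<in> borel_measurable (sector p q)"
    unfolding eq using assms unfolding ae_eq_def by (intro borel_measurable_times borel_measurable_const; blast)+
  have "AE z in sector p q. sector_fun \<Psi> p q z = sector_fun \<Psi>' p q z"
    using assms unfolding ae_eq_def by blast
  then show "AE z in sector p q. sector_fun (scale c \<Psi>) p q z = sector_fun (scale c \<Psi>') p q z"
    unfolding eq by eventually_elim simp
qed

lemma ae_eq_add:
  assumes "ae_eq \<Psi> \<Psi>'" "ae_eq \<Phi> \<Phi>'" shows "ae_eq (\<Psi> + \<Phi>) (\<Psi>' + \<Phi>')"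
  unfolding ae_eq_def
proof (intro allI conjI)
  fix p q
  have eq: "sector_fun (A + B) p q = (\<lambda>z. sector_fun A p q z + sector_fun B p q z)" for A B
    by (simp add: sector_fun_def fun_eq_iff)
  show "sector_fun (\<Psi> + \<Phi>) p q \<in> borel_measurable (sector p q)"
    "sector_fun (\<Psi>' + \<Phi>') p q \<in> borel_measurable (sector p q)"
    unfolding eq using assms unfolding ae_eq_def by (intro borel_measurable_add; blast)+
  have "AE z in sector p q. sector_fun \<Psi> p q z = sector_fun \<Psi>' p q z"
    "AE z in sector p q. sector_fun \<Phi> p q z = sector_fun \<Phi>' p q z"
    using assms unfolding ae_eq_def by blast+
  then show "AE z in sector p q. sector_fun (\<Psi> + \<Phi>) p q z = sector_fun (\<Psi>' + \<Phi>') p q z"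
    unfolding eq by eventually_elim simp
qed

lemma ae_eq_diff:
  assumes "ae_eq \<Psi> \<Psi>'" "ae_eq \<Phi> \<Phi>'" shows "ae_eq (\<Psi> - \<Phi>) (\<Psi>' - \<Phi>')"
  unfolding ae_eq_def
proof (intro allI conjI)
  fix p q
  have eq: "sector_fun (A - B) p q = (\<lambda>z. sector_fun A p q z - sector_fun B p q z)" for A B
    by (simp add: sector_fun_def fun_eq_iff)
  show "sector_fun (\<Psi> - \<Phi>) p q \<in> borel_measurable (sector p q)"
    "sector_fun (\<Psi>' - \<Phi>') p q \<in> borel_measurable (sector p q)"
    unfolding eq using assms unfolding ae_eq_def by (intro borel_measurable_diff; blast)+
  have "AE z in sector p q. sector_fun \<Psi> p q z = sector_fun \<Psi>' p q z"
    "AE z in sector p q. sector_fun \<Phi> p q z = sector_fun \<Phi>' p q z"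
    using assms unfolding ae_eq_def by blast+
  then show "AE z in sector p q. sector_fun (\<Psi> - \<Phi>) p q z = sector_fun (\<Psi>' - \<Phi>') p q z"
    unfolding eq by eventually_elim simp
qed

definition respects_ae :: "(fock2 \<Rightarrow> fock2) \<Rightarrow> bool" where
  "respects_ae X \<longleftrightarrow> (\<forall>\<Psi> \<Psi>'. ae_eq \<Psi> \<Psi>' \<longrightarrow> ae_eq (X \<Psi>) (X \<Psi>'))"

lemma respects_ae_comp: "respects_ae X \<Longrightarrow> respects_ae Y \<Longrightarrow> respects_ae (X \<circ> Y)"
  by (simp add: respects_ae_def)

lemma respects_ae_add: "respects_ae X \<Longrightarrow> respects_ae Y \<Longrightarrow> respects_ae (X + Y)"
  by (simp add: respects_ae_def ae_eq_add)

lemma respects_ae_diff: "respects_ae X \<Longrightarrow> respects_ae Y \<Longrightarrow> respects_ae (X - Y)"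
  by (simp add: respects_ae_def ae_eq_diff)

lemma respects_ae_scale: "respects_ae (scale c)"
  by (simp add: respects_ae_def ae_eq_scale)

lemma respects_ae_zero: "respects_ae 0"
  by (simp add: respects_ae_def ae_eq_def sector_fun_def[abs_def])

lemma respects_ae_sum: "(\<And>j. j \<in> A \<Longrightarrow> respects_ae (F j)) \<Longrightarrow> respects_ae (\<Sum>j\<in>A. F j)"
  by (induction A rule: infinite_finite_induct) (auto intro: respects_ae_zero respects_ae_add)

lemma respects_ae_basic:
  "respects_ae (on_left (annih t + creat t))" "respects_ae (on_left (annih t - creat t))"
  "respects_ae (on_right (annih t + creat t))" "respects_ae (on_right (annih t - creat t))"
proof -
  have "on_left (X + Y) = on_left X + on_left Y" "on_left (X - Y) = on_left X - on_left Y"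
    "on_right (X + Y) = on_right X + on_right Y" "on_right (X - Y) = on_right X - on_right Y" for X Y
    by (simp_all add: fun_eq_iff on_left_def on_right_def)
  then show "respects_ae (on_left (annih t + creat t))" "respects_ae (on_left (annih t - creat t))"
    "respects_ae (on_right (annih t + creat t))" "respects_ae (on_right (annih t - creat t))"
    using ae_eq_on_left ae_eq_on_right
    by (auto simp: respects_ae_def intro!: ae_eq_add ae_eq_diff)
qed

lemma respects_ae_area_sum: "respects_ae (area_sum \<sigma> a N t)"
  unfolding area_sum_def Q_bm_def P_bm_def
  by (intro respects_ae_comp respects_ae_add respects_ae_diff respects_ae_scale respects_ae_sum respects_ae_basic)

(*PART9*)
lemma coeff_measurable_permanent:
  assumes "\<And>i j. coeff_measurable (\<lambda>z. m z i j)" shows "coeff_measurable (\<lambda>z. permanent p (m z))"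
  unfolding permanent_def by (intro coeff_measurable_sum coeff_measurable_prod assms)

lemma coeff_bounded_permanent:
  assumes "\<And>i j. coeff_bounded (\<lambda>z. m z i j)" shows "coeff_bounded (\<lambda>z. permanent p (m z))"
  unfolding permanent_def by (intro coeff_bounded_sum coeff_bounded_prod assms)

lemma permanent_zero_row:
  assumes "r < p" "\<And>j. m r j = 0" shows "permanent p m = 0"
  unfolding permanent_def by (intro sum.neutral ballI prod_zero) (use assms in auto)

lemma permanent_zero_column:
  assumes "r < p" "\<And>i. m i r = 0" shows "permanent p m = 0"
  unfolding permanent_transpose[of p m, symmetric] using assms by (rule permanent_zero_row)

lemma permanent_minor_zero_row:
  assumes "i < p" "i0 < p" "i0 \<noteq> i" "\<And>j. m i0 j = 0" shows "permanent_minor (p - 1) i j m = 0"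
proof -
  have "i0 \<in> skip i ` {..<p - 1}"
    using bij_betw_imp_surj_on[OF bij_betw_skip[of i "p - 1"]] assms by auto
  then obtain r where "r < p - 1" "skip i r = i0" by auto
  then show ?thesis unfolding permanent_minor_def by (intro permanent_zero_row) (use assms in auto)
qed

lemma permanent_minor_transpose: "permanent_minor p i j (\<lambda>r u. m u r) = permanent_minor p j i m"
  unfolding permanent_minor_def using permanent_transpose[of p "\<lambda>r s. m (skip j r) (skip i s)"] by simp

lemma permanent_minor_zero_column:
  assumes "j < p" "j0 < p" "j0 \<noteq> j" "\<And>i. m i j0 = 0" shows "permanent_minor (p - 1) i j m = 0"
  unfolding permanent_minor_transpose[of "p - 1" j i m, symmetric] using assms by (rule permanent_minor_zero_row)

text \<open>Low-order coefficients of a product of series without constant term.\<close>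

lemma prod_nth_low:
  fixes f :: "'i \<Rightarrow> complex fps"
  assumes "finite A" "\<And>i. i \<in> A \<Longrightarrow> f i $ 0 = 0" "n < card A"
  shows "(\<Prod>i\<in>A. f i) $ n = 0"
  using assms
proof (induction A arbitrary: n rule: finite_induct)
  case (insert x A)
  have "(f x * (\<Prod>i\<in>A. f i)) $ n = (\<Sum>k=0..n. f x $ k * (\<Prod>i\<in>A. f i) $ (n - k))"
    by (simp add: fps_mult_nth)
  also have "\<dots> = 0"
  proof (rule sum.neutral, rule ballI)
    fix k assume "k \<in> {0..n}"
    show "f x $ k * (\<Prod>i\<in>A. f i) $ (n - k) = 0"
    proof (cases "k = 0")
      case False
      then have "n - k < card A" using insert.prems(2) insert.hyps \<open>k \<in> {0..n}\<close> by auto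
      then show ?thesis using insert.IH[of "n - k"] insert.prems(1) by simp
    qed (use insert.prems(1) in simp)
  qed
  finally show ?case using insert.hyps by simp
qed simp

lemma mult_nth_low:
  fixes f g :: "complex fps"
  assumes "\<And>k. k \<le> n \<Longrightarrow> g $ k = 0" shows "(f * g) $ n = 0"
  unfolding fps_mult_nth by (intro sum.neutral ballI) (simp add: assms)

lemma permanent_nth_low:
  fixes m :: "nat \<Rightarrow> nat \<Rightarrow> complex fps"
  assumes "\<And>i j. m i j $ 0 = 0" "n < p" shows "permanent p m $ n = 0"
  unfolding permanent_def fps_sum_nth
  by (intro sum.neutral ballI prod_nth_low) (use assms in auto)

text \<open>Sectors.\<close>

lemma measurable_points_borel: "(\<lambda>x. x) \<in> points n \<rightarrow>\<^sub>M (borel :: (nat \<Rightarrow> real) measure)"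
proof (rule measurable_coordinatewise_then_product)
  fix i
  show "(\<lambda>x. x i) \<in> borel_measurable (points n)"
  proof (cases "i < n")
    case True
    have "(\<lambda>s. s) \<in> borel_measurable half_line" by (rule borel_imp_half_line) simp
    then show ?thesis using measurable_compose[OF measurable_coordinate[OF True]] by blast
  next
    case False
    have "x i = undefined" if "x \<in> space (points n)" for x
      using that False by (auto simp: space_PiM PiE_def extensional_def)
    then show ?thesis by (subst measurable_cong[where g = "\<lambda>_. undefined"]) auto
  qed
qed

lemma sector_measurable:
  assumes "coeff_measurable (\<lambda>z. G p q (fst z) (snd z))"
  shows "sector_fun (coeff_vec n G) p q \<in> borel_measurable (sector p q)"
proof -
  have "(\<lambda>z. (fst z, snd z)) \<in> sector p q \<rightarrow>\<^sub>M (borel \<Otimes>\<^sub>M borel :: ((nat \<Rightarrow> real) \<times> (nat \<Rightarrow> real)) measure)"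
    unfolding sector_def
    by (intro measurable_Pair measurable_compose[OF measurable_fst measurable_points_borel]
        measurable_compose[OF measurable_snd measurable_points_borel])
  then have "(\<lambda>z. z) \<in> sector p q \<rightarrow>\<^sub>M (borel :: ((nat \<Rightarrow> real) \<times> (nat \<Rightarrow> real)) measure)"
    by (simp add: borel_prod)
  moreover have "(\<lambda>z. G p q (fst z) (snd z) $ n) \<in> borel_measurable borel"
    using assms by (simp add: coeff_measurable_def)
  ultimately have "(\<lambda>z. G p q (fst z) (snd z) $ n) \<in> borel_measurable (sector p q)"
    by (rule measurable_compose)
  then show ?thesis by (simp add: sector_fun_def[abs_def] coeff_vec_def)
qed

lemma fock_norm_finite:
  assumes "\<And>p q. p > D \<or> q > D \<Longrightarrow> AE z in sector p q. sector_fun \<Psi> p q z = 0"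
  shows "fock_norm \<Psi> = sqrt (\<Sum>(p, q)\<in>{..D} \<times> {..D}. \<integral>z. (cmod (sector_fun \<Psi> p q z))\<^sup>2 \<partial>sector p q)"
proof -
  let ?I = "\<lambda>(p, q). \<integral>z. (cmod (sector_fun \<Psi> p q z))\<^sup>2 \<partial>sector p q"
  have "cnj w * w = complex_of_real ((cmod w)\<^sup>2)" for w
    by (simp only: complex_norm_square mult.commute)
  then have "fock_inner \<Psi> \<Psi> = (\<Sum>\<^sub>\<infinity>w\<in>UNIV. complex_of_real (?I w))"
    unfolding fock_inner_def sector_fun_def
    by (intro infsum_cong) (auto simp flip: integral_complex_of_real)
  also have "\<dots> = (\<Sum>\<^sub>\<infinity>w\<in>{..D} \<times> {..D}. complex_of_real (?I w))"
  proof (rule infsum_cong_neutral)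
    fix w assume "w \<in> UNIV - {..D} \<times> {..D}"
    then obtain p q where w: "w = (p, q)" "p > D \<or> q > D" by (cases w) auto
    have "AE z in sector p q. (cmod (sector_fun \<Psi> p q z))\<^sup>2 = 0"
      using assms[OF w(2)] by (rule AE_mp) (auto intro!: AE_I2)
    then have "(\<integral>z. (cmod (sector_fun \<Psi> p q z))\<^sup>2 \<partial>sector p q) = 0" by (rule integral_eq_zero_AE)
    then show "complex_of_real (?I w) = 0" by (simp add: w)
  qed auto
  also have "\<dots> = complex_of_real (\<Sum>w\<in>{..D} \<times> {..D}. ?I w)" by simp
  finally show ?thesis by (simp add: fock_norm_def)
qed

lemma fock_norm_nonneg: "fock_norm \<Psi> \<ge> 0"
proof -
  let ?I = "\<lambda>(p, q). \<integral>z. (cmod (sector_fun \<Psi> p q z))\<^sup>2 \<partial>sector p q"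
  have "cnj w * w = complex_of_real ((cmod w)\<^sup>2)" for w
    by (simp only: complex_norm_square mult.commute)
  then have eq: "fock_inner \<Psi> \<Psi> = (\<Sum>\<^sub>\<infinity>w\<in>UNIV. complex_of_real (?I w))"
    unfolding fock_inner_def sector_fun_def
    by (intro infsum_cong) (auto simp flip: integral_complex_of_real)
  have "Re (fock_inner \<Psi> \<Psi>) \<ge> 0"
  proof (cases "(\<lambda>w. complex_of_real (?I w)) summable_on UNIV")
    case True
    then show ?thesis unfolding eq infsum_Re[OF True, symmetric] by (intro infsum_nonneg) (simp add: case_prod_unfold)
  qed (simp add: eq infsum_not_exists)
  then show ?thesis by (simp add: fock_norm_def)
qed

lemma fock_norm_ae_eq:
  assumes "ae_eq \<Psi> \<Psi>'" shows "fock_norm \<Psi> = fock_norm \<Psi>'"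
proof -
  have "fock_inner \<Psi> \<Psi> = fock_inner \<Psi>' \<Psi>'"
    unfolding fock_inner_def
  proof (intro infsum_cong, clarify)
    fix p q
    have m: "sector_fun \<Psi> p q \<in> borel_measurable (sector p q)" "sector_fun \<Psi>' p q \<in> borel_measurable (sector p q)"
      and ae: "AE z in sector p q. sector_fun \<Psi> p q z = sector_fun \<Psi>' p q z"
      using assms unfolding ae_eq_def by blast+
    have c: "(\<lambda>z. cnj (f z) * f z) \<in> borel_measurable M" if "f \<in> borel_measurable M"
      for f :: "(nat \<Rightarrow> real) \<times> (nat \<Rightarrow> real) \<Rightarrow> complex" and M
    proof -
      have "cnj \<in> borel_measurable borel" by (intro borel_measurable_continuous_onI continuous_intros)
      from measurable_compose[OF that this] show ?thesis using that by (rule borel_measurable_times)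
    qed
    show "(\<integral>z. cnj (\<Psi> p q (fst z) (snd z)) * \<Psi> p q (fst z) (snd z) \<partial>sector p q) =
      (\<integral>z. cnj (\<Psi>' p q (fst z) (snd z)) * \<Psi>' p q (fst z) (snd z) \<partial>sector p q)"
      unfolding sector_fun_def[symmetric]
      by (rule integral_cong_AE[OF c[OF m(1)] c[OF m(2)]]) (use ae in \<open>rule AE_mp, auto intro!: AE_I2\<close>)
  qed
  then show ?thesis by (simp add: fock_norm_def)
qed

(*PART10*)
context time_interval
begin

definition tame_conv :: "(nat \<Rightarrow> series_vec) \<Rightarrow> series_vec \<Rightarrow> bool" where
  "tame_conv S G \<longleftrightarrow> (\<forall>p q.
     (\<forall>k. coeff_measurable (\<lambda>z. S k p q (fst z) (snd z))) \<and>
     coeff_bounded (\<lambda>(k, x, y). S k p q x y) \<and>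
     (\<forall>x y. coeff_tendsto (\<lambda>k. S k p q x y) (G p q x y)) \<and>
     (\<forall>k x y. (\<exists>i<p. x i \<notin> {a..<b}) \<or> (\<exists>j<q. y j \<notin> {a..<b}) \<longrightarrow> S k p q x y = 0))"

lemma kernel_entry_measurable:
  assumes "bounded_kernel K"
  shows "coeff_measurable (\<lambda>z. K (fst z (i::nat)) (snd z (j::nat)))"
proof -
  have c: "continuous_on UNIV (\<lambda>z::(nat \<Rightarrow> real) \<times> (nat \<Rightarrow> real). (fst z i, snd z j))"
    by (rule continuous_on_Pair[OF continuous_on_product_then_coordinatewise[OF continuous_on_fst[OF continuous_on_id]]
        continuous_on_product_then_coordinatewise[OF continuous_on_snd[OF continuous_on_id]]])
  have "coeff_measurable (\<lambda>z. case (fst z i, snd z j) of (s, t) \<Rightarrow> K s t)"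
    using assms unfolding bounded_kernel_def by (intro coeff_measurable_compose[OF _ c]) blast
  then show ?thesis by simp
qed

lemma kernel_entry_bounded:
  assumes "bounded_kernel K" shows "coeff_bounded (\<lambda>z. K (f z) (g z))"
  using coeff_bounded_compose[of "\<lambda>(s, t). K s t" "\<lambda>z. (f z, g z)"] assms unfolding bounded_kernel_def by auto

lemma tame_conv_pair_state:
  assumes K: "bounded_kernel K"
  shows "tame_conv (\<lambda>k. pair_state C K) (pair_state C K)"
  unfolding tame_conv_def
proof (intro allI conjI impI)
  fix p q
  have eq: "pair_state C K p q x y = (if p = q then C * cst (1 / fact p) else 0) * permanent p (\<lambda>i j. K (x i) (y j))"
    for x y by (simp add: pair_state_def)
  show "coeff_measurable (\<lambda>z. pair_state C K p q (fst z) (snd z))"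
    unfolding eq by (intro coeff_measurable_mult coeff_measurable_const coeff_measurable_permanent kernel_entry_measurable[OF K])
  show "coeff_bounded (\<lambda>(k, x, y). pair_state C K p q x y)"
    unfolding eq case_prod_unfold
    by (intro coeff_bounded_mult coeff_bounded_const coeff_bounded_permanent kernel_entry_bounded[OF K])
  fix x y :: "nat \<Rightarrow> real"
  assume out: "(\<exists>i<p. x i \<notin> {a..<b}) \<or> (\<exists>j<q. y j \<notin> {a..<b})"
  show "pair_state C K p q x y = 0"
  proof (cases "p = q")
    case True
    have "permanent p (\<lambda>i j. K (x i) (y j)) = 0"
      using out
    proof
      assume "\<exists>i<p. x i \<notin> {a..<b}"
      then obtain i where "i < p" "x i \<notin> {a..<b}" by blast
      then show ?thesis using K by (intro permanent_zero_row) (auto simp: bounded_kernel_def)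
    next
      assume "\<exists>j<q. y j \<notin> {a..<b}"
      then obtain j where "j < p" "y j \<notin> {a..<b}" using True by blast
      then show ?thesis using K by (intro permanent_zero_column) (auto simp: bounded_kernel_def)
    qed
    then show ?thesis unfolding eq by simp
  qed (simp add: pair_state_def)
qed simp

lemma tame_conv_pair_creation:
  assumes K: "bounded_kernel K" and M: "kernel_conv M m"
  shows "tame_conv (\<lambda>k. pair_creation (M k) C K) (pair_creation m C K)"
  unfolding tame_conv_def
proof (intro allI conjI impI)
  fix p q
  have eq: "pair_creation L C K p q x y = (if p = q then C * cst (1 / fact p) else 0) *
      (\<Sum>i<p. \<Sum>j<p. L (x i) (y j) * permanent_minor (p - 1) i j (\<lambda>r u. K (x r) (y u)))" for L x y
    by (simp add: pair_creation_def)
  have Mk: "bounded_kernel (M k)" and Mb: "coeff_bounded (\<lambda>(k, r, s). M k r s)"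
    and Ml: "coeff_tendsto (\<lambda>k. M k r s) (m r s)" for k r s
    using M by (auto simp: kernel_conv_def)
  show "coeff_measurable (\<lambda>z. pair_creation (M k) C K p q (fst z) (snd z))" for k
    unfolding eq permanent_minor_def
    by (intro coeff_measurable_mult coeff_measurable_const coeff_measurable_sum coeff_measurable_permanent
        kernel_entry_measurable[OF K] kernel_entry_measurable[OF Mk])
  have Mb': "coeff_bounded (\<lambda>w. M (fst w) (f w) (g w))" for f g :: "nat \<times> (nat \<Rightarrow> real) \<times> (nat \<Rightarrow> real) \<Rightarrow> real"
    using coeff_bounded_compose[OF Mb, of "\<lambda>w. (fst w, f w, g w)"] by simp
  show "coeff_bounded (\<lambda>(k, x, y). pair_creation (M k) C K p q x y)"
    unfolding eq case_prod_unfold permanent_minor_def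
    by (intro coeff_bounded_mult coeff_bounded_const coeff_bounded_sum coeff_bounded_permanent kernel_entry_bounded[OF K] Mb')
  fix x y :: "nat \<Rightarrow> real"
  show "coeff_tendsto (\<lambda>k. pair_creation (M k) C K p q x y) (pair_creation m C K p q x y)"
    unfolding eq by (intro coeff_tendsto_mult coeff_tendsto_const coeff_tendsto_sum Ml)
  fix k
  assume out: "(\<exists>i<p. x i \<notin> {a..<b}) \<or> (\<exists>j<q. y j \<notin> {a..<b})"
  show "pair_creation (M k) C K p q x y = 0"
  proof (cases "p = q")
    case True
    have "M k (x i) (y j) * permanent_minor (p - 1) i j (\<lambda>r u. K (x r) (y u)) = 0" if "i < p" "j < p" for i j
      using out
    proof
      assume "\<exists>i<p. x i \<notin> {a..<b}"
      then obtain i0 where "i0 < p" "x i0 \<notin> {a..<b}" by blast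
      then show ?thesis
        using permanent_minor_zero_row[of i p i0 "\<lambda>r u. K (x r) (y u)" j] that K Mk[of k]
        by (cases "i = i0") (auto simp: bounded_kernel_def)
    next
      assume "\<exists>j<q. y j \<notin> {a..<b}"
      then obtain j0 where "j0 < p" "y j0 \<notin> {a..<b}" using True by blast
      then show ?thesis
        using permanent_minor_zero_column[of j p j0 "\<lambda>r u. K (x r) (y u)" i] that K Mk[of k]
        by (cases "j = j0") (auto simp: bounded_kernel_def)
    qed
    then have "(\<Sum>i<p. \<Sum>j<p. M k (x i) (y j) * permanent_minor (p - 1) i j (\<lambda>r u. K (x r) (y u))) = 0"
      by (intro sum.neutral ballI) (simp only: lessThan_iff)
    then show ?thesis unfolding eq by (simp only: mult_zero_right)
  qed (simp add: pair_creation_def)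
qed

lemma tame_convD:
  assumes "tame_conv S G"
  shows "coeff_measurable (\<lambda>z. S k p q (fst z) (snd z))"
    and "coeff_bounded (\<lambda>(k, x, y). S k p q x y)"
    and "coeff_tendsto (\<lambda>k. S k p q x y) (G p q x y)"
    and "(\<exists>i<p. x i \<notin> {a..<b}) \<or> (\<exists>j<q. y j \<notin> {a..<b}) \<Longrightarrow> S k p q x y = 0"
proof -
  note c = assms[unfolded tame_conv_def, THEN spec, THEN spec, of p q]
  show "coeff_measurable (\<lambda>z. S k p q (fst z) (snd z))" by (rule c[THEN conjunct1, THEN spec])
  show "coeff_bounded (\<lambda>(k, x, y). S k p q x y)" by (rule c[THEN conjunct2, THEN conjunct1])
  show "coeff_tendsto (\<lambda>k. S k p q x y) (G p q x y)"
    by (rule c[THEN conjunct2, THEN conjunct2, THEN conjunct1, THEN spec, THEN spec])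
  show "(\<exists>i<p. x i \<notin> {a..<b}) \<or> (\<exists>j<q. y j \<notin> {a..<b}) \<Longrightarrow> S k p q x y = 0"
    by (rule c[THEN conjunct2, THEN conjunct2, THEN conjunct2, THEN spec, THEN spec, THEN spec, THEN mp])
qed

lemma tame_conv_lin:
  assumes S: "tame_conv S G" and T: "tame_conv T H" and c: "coeff_bounded c" "coeff_tendsto c d"
  shows "tame_conv (\<lambda>k p q x y. c k * S k p q x y + T k p q x y) (\<lambda>p q x y. d * G p q x y + H p q x y)"
  unfolding tame_conv_def
proof (intro allI conjI impI)
  fix p q
  note m = tame_convD(1)[OF S] tame_convD(1)[OF T] and bd = tame_convD(2)[OF S, of p q] tame_convD(2)[OF T, of p q]
    and lim = tame_convD(3)[OF S] tame_convD(3)[OF T]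
  show "coeff_measurable (\<lambda>z. c k * S k p q (fst z) (snd z) + T k p q (fst z) (snd z))" for k
    by (rule coeff_measurable_add[OF coeff_measurable_mult[OF coeff_measurable_const m(1)] m(2)])
  show "coeff_bounded (\<lambda>(k, x, y). c k * S k p q x y + T k p q x y)"
    using coeff_bounded_add[OF coeff_bounded_mult[OF coeff_bounded_compose[OF c(1), of fst] bd(1)] bd(2)]
    by (simp add: case_prod_unfold)
  show "coeff_tendsto (\<lambda>k. c k * S k p q x y + T k p q x y) (d * G p q x y + H p q x y)" for x y
    by (rule coeff_tendsto_add[OF coeff_tendsto_mult[OF c(2) lim(1)] lim(2)])
  show "c k * S k p q x y + T k p q x y = 0"
    if "(\<exists>i<p. x i \<notin> {a..<b}) \<or> (\<exists>j<q. y j \<notin> {a..<b})" for k x y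
  proof -
    show ?thesis by (simp only: tame_convD(4)[OF S that] tame_convD(4)[OF T that]) simp
  qed
qed

end

context time_interval
begin

definition interval_box :: "nat \<Rightarrow> nat \<Rightarrow> ((nat \<Rightarrow> real) \<times> (nat \<Rightarrow> real)) set" where
  "interval_box p q = (\<Pi>\<^sub>E i\<in>{..<p}. {a..<b}) \<times> (\<Pi>\<^sub>E i\<in>{..<q}. {a..<b})"

lemma interval_half_line: "{a..<b} \<inter> {0..} = {a..<b}"
  using a_nonneg by auto

lemma box_sets: "interval_box p q \<in> sets (sector p q)" and box_finite: "emeasure (sector p q) (interval_box p q) < \<infinity>"
proof -
  interpret Q: sigma_finite_measure "points q" by (rule sigma_finite_points)
  have I: "{a..<b} \<in> sets half_line" using sets_half_line_interval[of a b] by (simp only: interval_half_line)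
  have fin: "emeasure half_line {a..<b} < \<infinity>" using finite_half_line_interval[of a b] by (simp only: interval_half_line)
  have P: "(\<Pi>\<^sub>E i\<in>{..<n}. {a..<b}) \<in> sets (points n)" for n :: nat
    using I by (intro sets_PiM_I_finite) auto
  show "interval_box p q \<in> sets (sector p q)" unfolding interval_box_def sector_def by (intro pair_measureI P)
  have "emeasure (points n) (\<Pi>\<^sub>E i\<in>{..<n}. {a..<b}) < \<infinity>" for n :: nat
  proof -
    have "emeasure half_line {a..<b} ^ n < top"
    proof (induction n)
      case (Suc n)
      then show ?case using fin by (simp add: ennreal_mult_less_top)
    qed simp
    then show ?thesis by (subst half_lines.emeasure_PiM[OF finite_lessThan I]) simp
  qed
  then show "emeasure (sector p q) (interval_box p q) < \<infinity>"
    unfolding interval_box_def sector_def using P by (simp add: Q.emeasure_pair_measure_Times ennreal_mult_less_top)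
qed

lemma outside_box:
  assumes "z \<in> space (sector p q)" "z \<notin> interval_box p q"
  shows "(\<exists>i<p. fst z i \<notin> {a..<b}) \<or> (\<exists>j<q. snd z j \<notin> {a..<b})"
  using assms by (auto simp: interval_box_def sector_def space_pair_measure space_PiM PiE_def Pi_def mem_Times_iff)

lemma integrable_on_box:
  fixes f :: "_ \<Rightarrow> 'b::{banach, second_countable_topology}"
  assumes "f \<in> borel_measurable (sector p q)" "\<And>z. norm (f z) \<le> B"
    and "\<And>z. z \<in> space (sector p q) \<Longrightarrow> z \<notin> interval_box p q \<Longrightarrow> f z = 0"
  shows "integrable (sector p q) f"
  by (rule integrableI_bounded_set[OF box_sets assms(1) box_finite, where B = B])
    (use assms(2,3) in \<open>auto intro!: AE_I2\<close>)

lemma tame_conv_sector: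
  assumes S: "tame_conv S G"
  shows "sector_fun (coeff_vec n (S k)) p q \<in> borel_measurable (sector p q)"
    and "sector_fun (coeff_vec n G) p q \<in> borel_measurable (sector p q)"
    and "\<exists>B. \<forall>k z. cmod (sector_fun (coeff_vec n (S k)) p q z) \<le> B \<and> cmod (sector_fun (coeff_vec n G) p q z) \<le> B"
    and "z \<in> space (sector p q) \<Longrightarrow> z \<notin> interval_box p q \<Longrightarrow> sector_fun (coeff_vec n (S k)) p q z = 0"
    and "z \<in> space (sector p q) \<Longrightarrow> z \<notin> interval_box p q \<Longrightarrow> sector_fun (coeff_vec n G) p q z = 0"
    and "(\<lambda>k. sector_fun (coeff_vec n (S k)) p q z) \<longlonglongrightarrow> sector_fun (coeff_vec n G) p q z"
proof -
  show m: "sector_fun (coeff_vec n (S k)) p q \<in> borel_measurable (sector p q)" for k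
    by (rule sector_measurable) (rule tame_convD(1)[OF S])
  show lim: "(\<lambda>k. sector_fun (coeff_vec n (S k)) p q z) \<longlonglongrightarrow> sector_fun (coeff_vec n G) p q z" for z
    using tame_convD(3)[OF S] unfolding coeff_tendsto_def sector_fun_def coeff_vec_def by blast
  show "sector_fun (coeff_vec n G) p q \<in> borel_measurable (sector p q)"
    by (rule borel_measurable_LIMSEQ_metric[OF m lim])
  have "coeff_bounded (\<lambda>(k, x, y). S k p q x y)" by (rule tame_convD(2)[OF S])
  then obtain B where B: "\<And>k x y. cmod (S k p q x y $ n) \<le> B"
    unfolding coeff_bounded_def by force
  then have Bk: "cmod (sector_fun (coeff_vec n (S k)) p q z) \<le> B" for k z
    by (simp add: sector_fun_def coeff_vec_def)
  moreover have "cmod (sector_fun (coeff_vec n G) p q z) \<le> B" for z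
    by (rule LIMSEQ_le_const2[OF tendsto_norm[OF lim]]) (use Bk in auto)
  ultimately show "\<exists>B. \<forall>k z. cmod (sector_fun (coeff_vec n (S k)) p q z) \<le> B \<and> cmod (sector_fun (coeff_vec n G) p q z) \<le> B"
    by blast
  have z: "sector_fun (coeff_vec n (S k)) p q z = 0" if "z \<in> space (sector p q)" "z \<notin> interval_box p q" for k z
  proof -
    have "S k p q (fst z) (snd z) = 0" by (rule tame_convD(4)[OF S outside_box[OF that]])
    then show ?thesis by (simp add: sector_fun_def coeff_vec_def)
  qed
  then show "z \<in> space (sector p q) \<Longrightarrow> z \<notin> interval_box p q \<Longrightarrow> sector_fun (coeff_vec n (S k)) p q z = 0" .
  show "sector_fun (coeff_vec n G) p q z = 0" if "z \<in> space (sector p q)" "z \<notin> interval_box p q"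
    using lim[of z] z[OF that] by (simp add: LIMSEQ_const_iff)
qed

lemma fock_norm_tendsto:
  assumes S: "tame_conv S G" and D: "\<And>k p q x y. p > D \<or> q > D \<Longrightarrow> S k p q x y $ n = 0"
  shows "(\<lambda>k. fock_norm (coeff_vec n (S k) - coeff_vec n G)) \<longlonglongrightarrow> 0"
proof -
  note t = tame_conv_sector[OF S, where n = n]
  have G0: "G p q x y $ n = 0" if "p > D \<or> q > D" for p q x y
    using t(6)[where p = p and q = q and z = "(x, y)"] D[OF that] by (simp add: sector_fun_def coeff_vec_def LIMSEQ_const_iff)
  have eq: "sector_fun (\<Psi> - \<Phi>) p q z = sector_fun \<Psi> p q z - sector_fun \<Phi> p q z" for \<Psi> \<Phi> p q z
    by (simp add: sector_fun_def)
  have "fock_norm (coeff_vec n (S k) - coeff_vec n G) = sqrt (\<Sum>(p, q)\<in>{..D} \<times> {..D}.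
      \<integral>z. (cmod (sector_fun (coeff_vec n (S k)) p q z - sector_fun (coeff_vec n G) p q z))\<^sup>2 \<partial>sector p q)" for k
    by (subst fock_norm_finite[of D])
      (auto intro!: AE_I2 simp: eq, auto simp: sector_fun_def coeff_vec_def D G0)
  moreover have lim: "(\<lambda>k. \<integral>z. (cmod (sector_fun (coeff_vec n (S k)) p q z - sector_fun (coeff_vec n G) p q z))\<^sup>2 \<partial>sector p q)
      \<longlonglongrightarrow> (\<integral>z. 0 \<partial>sector p q)" for p q
  proof -
    obtain B where B: "\<And>k z. cmod (sector_fun (coeff_vec n (S k)) p q z) \<le> B" "\<And>z. cmod (sector_fun (coeff_vec n G) p q z) \<le> B"
      using t(3)[where p = p and q = q] by blast
    show ?thesis
    proof (rule integral_dominated_convergence)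
      show "integrable (sector p q) (\<lambda>z. (2 * B)\<^sup>2 * indicator (interval_box p q) z)"
        using box_sets box_finite by (intro integrable_mult_right) simp
      show "(\<lambda>z. (cmod (sector_fun (coeff_vec n (S k)) p q z - sector_fun (coeff_vec n G) p q z))\<^sup>2) \<in> borel_measurable (sector p q)" for k
        by (rule borel_measurable_power[OF measurable_compose[OF borel_measurable_diff[OF t(1) t(2)] borel_measurable_norm]])
      show "AE z in sector p q. (\<lambda>k. (cmod (sector_fun (coeff_vec n (S k)) p q z - sector_fun (coeff_vec n G) p q z))\<^sup>2) \<longlonglongrightarrow> 0"
      proof (rule AE_I2)
        fix z
        have "(\<lambda>k. (cmod (sector_fun (coeff_vec n (S k)) p q z - sector_fun (coeff_vec n G) p q z))\<^sup>2) \<longlonglongrightarrow>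
          (cmod (sector_fun (coeff_vec n G) p q z - sector_fun (coeff_vec n G) p q z))\<^sup>2"
          by (intro tendsto_intros t(6))
        then show "(\<lambda>k. (cmod (sector_fun (coeff_vec n (S k)) p q z - sector_fun (coeff_vec n G) p q z))\<^sup>2) \<longlonglongrightarrow> 0" by simp
      qed
      show "AE z in sector p q. norm ((cmod (sector_fun (coeff_vec n (S k)) p q z - sector_fun (coeff_vec n G) p q z))\<^sup>2)
          \<le> (2 * B)\<^sup>2 * indicator (interval_box p q) z" for k
      proof (rule AE_I2)
        fix z assume z: "z \<in> space (sector p q)"
        have "cmod (sector_fun (coeff_vec n (S k)) p q z - sector_fun (coeff_vec n G) p q z) \<le> 2 * B"
          using norm_triangle_ineq4[of "sector_fun (coeff_vec n (S k)) p q z" "sector_fun (coeff_vec n G) p q z"] B(1)[of k z] B(2)[of z] by linarith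
        then have "(cmod (sector_fun (coeff_vec n (S k)) p q z - sector_fun (coeff_vec n G) p q z))\<^sup>2 \<le> (2 * B)\<^sup>2"
          by (intro power_mono) auto
        then show "norm ((cmod (sector_fun (coeff_vec n (S k)) p q z - sector_fun (coeff_vec n G) p q z))\<^sup>2)
          \<le> (2 * B)\<^sup>2 * indicator (interval_box p q) z"
          using t(4,5)[OF z] by (cases "z \<in> interval_box p q") auto
      qed
    qed simp
  qed
  moreover have "(\<lambda>k. sqrt (\<Sum>w\<in>{..D} \<times> {..D}. case w of (p, q) \<Rightarrow>
      \<integral>z. (cmod (sector_fun (coeff_vec n (S k)) p q z - sector_fun (coeff_vec n G) p q z))\<^sup>2 \<partial>sector p q))
      \<longlonglongrightarrow> sqrt (\<Sum>w\<in>{..D} \<times> {..D}. 0)"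
    using lim by (intro tendsto_real_sqrt tendsto_sum) auto
  ultimately show ?thesis by simp
qed

end

(*PART11*)
lemma norm_diff_square_le: "(cmod (f - g))\<^sup>2 \<le> 2 * (cmod (h - f))\<^sup>2 + 2 * (cmod (h - g))\<^sup>2"
proof -
  have "cmod (f - g) \<le> cmod (h - f) + cmod (h - g)"
    using norm_triangle_ineq4[of "h - g" "h - f"] by simp
  then have "(cmod (f - g))\<^sup>2 \<le> (cmod (h - f) + cmod (h - g))\<^sup>2" by (intro power_mono) auto
  also have "\<dots> \<le> 2 * (cmod (h - f))\<^sup>2 + 2 * (cmod (h - g))\<^sup>2"
    using sum_squares_bound[of "cmod (h - f)" "cmod (h - g)"] by (simp add: power2_sum)
  finally show ?thesis .
qed

lemma square_integrable_diff:
  fixes f g :: "'a \<Rightarrow> complex"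
  assumes "f \<in> borel_measurable M" "g \<in> borel_measurable M"
    and "integrable M (\<lambda>z. (cmod (f z))\<^sup>2)" "integrable M (\<lambda>z. (cmod (g z))\<^sup>2)"
  shows "integrable M (\<lambda>z. (cmod (f z - g z))\<^sup>2)"
proof (rule Bochner_Integration.integrable_bound)
  show "integrable M (\<lambda>z. 2 * (cmod (f z))\<^sup>2 + 2 * (cmod (g z))\<^sup>2)"
    using assms by (intro Bochner_Integration.integrable_add integrable_mult_right)
  show "(\<lambda>z. (cmod (f z - g z))\<^sup>2) \<in> borel_measurable M"
    using assms by (intro borel_measurable_power measurable_compose[OF borel_measurable_diff borel_measurable_norm])
  show "AE z in M. norm ((cmod (f z - g z))\<^sup>2) \<le> norm (2 * (cmod (f z))\<^sup>2 + 2 * (cmod (g z))\<^sup>2)"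
  proof (rule AE_I2)
    fix z
    show "norm ((cmod (f z - g z))\<^sup>2) \<le> norm (2 * (cmod (f z))\<^sup>2 + 2 * (cmod (g z))\<^sup>2)"
      using norm_diff_square_le[of "f z" "g z" 0] by simp
  qed
qed

lemma square_mean_limit_unique:
  fixes f g :: "'a \<Rightarrow> complex"
  assumes f: "f \<in> borel_measurable M" "integrable M (\<lambda>z. (cmod (f z))\<^sup>2)"
    and g: "g \<in> borel_measurable M" "integrable M (\<lambda>z. (cmod (g z))\<^sup>2)"
    and h: "\<And>k. h k \<in> borel_measurable M" "\<And>k. integrable M (\<lambda>z. (cmod (h k z))\<^sup>2)"
    and lim: "(\<lambda>k. \<integral>z. (cmod (h k z - f z))\<^sup>2 \<partial>M) \<longlonglongrightarrow> 0" "(\<lambda>k. \<integral>z. (cmod (h k z - g z))\<^sup>2 \<partial>M) \<longlonglongrightarrow> 0"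
  shows "AE z in M. f z = g z"
proof -
  have fg: "integrable M (\<lambda>z. (cmod (f z - g z))\<^sup>2)" by (rule square_integrable_diff[OF f(1) g(1) f(2) g(2)])
  have hf: "integrable M (\<lambda>z. (cmod (h k z - f z))\<^sup>2)" "integrable M (\<lambda>z. (cmod (h k z - g z))\<^sup>2)" for k
    by (rule square_integrable_diff[OF h(1) f(1) h(2) f(2)], rule square_integrable_diff[OF h(1) g(1) h(2) g(2)])
  have "(\<integral>z. (cmod (f z - g z))\<^sup>2 \<partial>M) \<le> 2 * (\<integral>z. (cmod (h k z - f z))\<^sup>2 \<partial>M) + 2 * (\<integral>z. (cmod (h k z - g z))\<^sup>2 \<partial>M)" for k
  proof -
    have "(\<integral>z. (cmod (f z - g z))\<^sup>2 \<partial>M) \<le> (\<integral>z. 2 * (cmod (h k z - f z))\<^sup>2 + 2 * (cmod (h k z - g z))\<^sup>2 \<partial>M)"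
      by (intro integral_mono fg Bochner_Integration.integrable_add integrable_mult_right hf norm_diff_square_le)
    then show ?thesis using hf by simp
  qed
  moreover have "(\<lambda>k. 2 * (\<integral>z. (cmod (h k z - f z))\<^sup>2 \<partial>M) + 2 * (\<integral>z. (cmod (h k z - g z))\<^sup>2 \<partial>M)) \<longlonglongrightarrow> 2 * 0 + 2 * 0"
    by (intro tendsto_intros lim)
  ultimately have "(\<integral>z. (cmod (f z - g z))\<^sup>2 \<partial>M) \<le> 2 * 0 + 2 * 0"
    by (intro LIMSEQ_le_const[where a = "\<integral>z. (cmod (f z - g z))\<^sup>2 \<partial>M"]) auto
  moreover have "(\<integral>z. (cmod (f z - g z))\<^sup>2 \<partial>M) \<ge> 0" by simp
  ultimately have "(\<integral>z. (cmod (f z - g z))\<^sup>2 \<partial>M) = 0" by linarith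
  then have "AE z in M. (cmod (f z - g z))\<^sup>2 = 0"
    using integral_nonneg_eq_0_iff_AE[OF fg] by simp
  then show ?thesis by (rule AE_mp) (auto intro!: AE_I2)
qed

lemma sector_norm_le:
  assumes "\<And>p q. p > D \<or> q > D \<Longrightarrow> AE z in sector p q. sector_fun \<Psi> p q z = 0"
  shows "(\<integral>z. (cmod (sector_fun \<Psi> p q z))\<^sup>2 \<partial>sector p q) \<le> (fock_norm \<Psi>)\<^sup>2"
proof -
  let ?I = "\<lambda>(p, q). \<integral>z. (cmod (sector_fun \<Psi> p q z))\<^sup>2 \<partial>sector p q"
  have pos: "?I w \<ge> 0" for w by (simp add: case_prod_unfold)
  have "fock_norm \<Psi> = sqrt (\<Sum>w\<in>{..D} \<times> {..D}. ?I w)"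
    by (rule fock_norm_finite) (rule assms)
  moreover have "(\<Sum>w\<in>{..D} \<times> {..D}. ?I w) \<ge> 0" by (intro sum_nonneg pos)
  ultimately have eq: "(fock_norm \<Psi>)\<^sup>2 = (\<Sum>w\<in>{..D} \<times> {..D}. ?I w)" by simp
  show ?thesis
  proof (cases "p > D \<or> q > D")
    case True
    have "AE z in sector p q. (cmod (sector_fun \<Psi> p q z))\<^sup>2 = 0"
      using assms[OF True] by (rule AE_mp) (auto intro!: AE_I2)
    then have "(\<integral>z. (cmod (sector_fun \<Psi> p q z))\<^sup>2 \<partial>sector p q) = 0" by (rule integral_eq_zero_AE)
    then show ?thesis by simp
  next
    case False
    then have "?I (p, q) \<le> (\<Sum>w\<in>{..D} \<times> {..D}. ?I w)"
      using pos by (intro member_le_sum) auto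
    then show ?thesis by (simp add: eq)
  qed
qed

context time_interval
begin

lemma tame_square_integrable:
  assumes S: "tame_conv S G"
  shows "integrable (sector p q) (\<lambda>z. (cmod (sector_fun (coeff_vec n (S k)) p q z))\<^sup>2)"
    and "integrable (sector p q) (\<lambda>z. (cmod (sector_fun (coeff_vec n G) p q z))\<^sup>2)"
proof -
  note t = tame_conv_sector[OF S, where n = n]
  obtain B where B: "\<And>k z. cmod (sector_fun (coeff_vec n (S k)) p q z) \<le> B" "\<And>z. cmod (sector_fun (coeff_vec n G) p q z) \<le> B"
    using t(3)[where p = p and q = q] by blast
  show "integrable (sector p q) (\<lambda>z. (cmod (sector_fun (coeff_vec n (S k)) p q z))\<^sup>2)"
    using t(1) t(4) B(1) by (intro integrable_on_box[of _ _ _ "B\<^sup>2"] borel_measurable_power measurable_compose[OF _ borel_measurable_norm]) (auto intro: power_mono)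
  show "integrable (sector p q) (\<lambda>z. (cmod (sector_fun (coeff_vec n G) p q z))\<^sup>2)"
    using t(2) t(5) B(2) by (intro integrable_on_box[of _ _ _ "B\<^sup>2"] borel_measurable_power measurable_compose[OF _ borel_measurable_norm]) (auto intro: power_mono)
qed

lemma limit_unique:
  assumes fin: "finite_particle \<Phi>" and S: "tame_conv S G"
    and D: "\<And>k p q x y. p > D \<or> q > D \<Longrightarrow> S k p q x y $ n = 0"
    and conv: "(\<lambda>k. fock_norm (coeff_vec n (S k) - \<Phi>)) \<longlonglongrightarrow> 0"
  shows "ae_eq \<Phi> (coeff_vec n G)"
proof -
  note t = tame_conv_sector[OF S, where n = n]
  have G0: "G p q x y $ n = 0" if "p > D \<or> q > D" for p q x y
    using t(6)[where p = p and q = q and z = "(x, y)"] D[OF that] by (simp add: sector_fun_def coeff_vec_def LIMSEQ_const_iff)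
  have \<Phi>: "sector_fun \<Phi> p q \<in> borel_measurable (sector p q)" "integrable (sector p q) (\<lambda>z. (cmod (sector_fun \<Phi> p q z))\<^sup>2)" for p q
    using fin by (auto simp: finite_particle_def sector_fun_def[abs_def])
  have f: "finite {w. \<Phi> (fst w) (snd w) \<noteq> 0}" using fin by (simp add: finite_particle_def case_prod_unfold)
  define E where "E = Max (insert D ((\<lambda>w. max (fst w) (snd w)) ` {w. \<Phi> (fst w) (snd w) \<noteq> 0}))"
  have E: "D \<le> E" unfolding E_def using f by (intro Max_ge) auto
  have \<Phi>0: "\<Phi> p q = 0" if "p > E \<or> q > E" for p q
  proof (rule ccontr)
    assume "\<Phi> p q \<noteq> 0"
    then have "max p q \<le> E" unfolding E_def using f by (intro Max_ge) (auto intro!: image_eqI[of _ _ "(p, q)"])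
    with that show False by auto
  qed
  have eq: "sector_fun (\<Psi> - \<Psi>') p q z = sector_fun \<Psi> p q z - sector_fun \<Psi>' p q z" for \<Psi> \<Psi>' p q z
    by (simp add: sector_fun_def)
  have sq0: "(\<lambda>k. (fock_norm (F k))\<^sup>2) \<longlonglongrightarrow> 0" if "(\<lambda>k. fock_norm (F k)) \<longlonglongrightarrow> 0" for F :: "nat \<Rightarrow> fock2"
    using tendsto_power[OF that, of 2] by simp
  show ?thesis
    unfolding ae_eq_def
  proof (intro allI conjI \<Phi>(1) t(2))
    fix p q
    show "AE z in sector p q. sector_fun \<Phi> p q z = sector_fun (coeff_vec n G) p q z"
    proof (rule square_mean_limit_unique[OF \<Phi> t(2) tame_square_integrable(2)[OF S] t(1) tame_square_integrable(1)[OF S]])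
      show "(\<lambda>k. \<integral>z. (cmod (sector_fun (coeff_vec n (S k)) p q z - sector_fun \<Phi> p q z))\<^sup>2 \<partial>sector p q) \<longlonglongrightarrow> 0"
      proof (rule tendsto_sandwich[OF _ _ tendsto_const sq0[OF conv]])
        show "\<forall>\<^sub>F k in sequentially. (\<integral>z. (cmod (sector_fun (coeff_vec n (S k)) p q z - sector_fun \<Phi> p q z))\<^sup>2 \<partial>sector p q)
            \<le> (fock_norm (coeff_vec n (S k) - \<Phi>))\<^sup>2"
        proof (rule always_eventually, rule allI)
          fix k
          show "(\<integral>z. (cmod (sector_fun (coeff_vec n (S k)) p q z - sector_fun \<Phi> p q z))\<^sup>2 \<partial>sector p q)
            \<le> (fock_norm (coeff_vec n (S k) - \<Phi>))\<^sup>2"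
            unfolding eq[symmetric]
          proof (rule sector_norm_le[of E])
            fix p q assume "p > E \<or> q > E"
            then show "AE z in sector p q. sector_fun (coeff_vec n (S k) - \<Phi>) p q z = 0"
              using \<Phi>0[of p q] D[of p q k] E by (intro AE_I2) (auto simp: sector_fun_def coeff_vec_def)
          qed
        qed
      qed simp
      show "(\<lambda>k. \<integral>z. (cmod (sector_fun (coeff_vec n (S k)) p q z - sector_fun (coeff_vec n G) p q z))\<^sup>2 \<partial>sector p q) \<longlonglongrightarrow> 0"
      proof (rule tendsto_sandwich[OF _ _ tendsto_const sq0[OF fock_norm_tendsto[OF S D]]])
        show "\<forall>\<^sub>F k in sequentially. (\<integral>z. (cmod (sector_fun (coeff_vec n (S k)) p q z - sector_fun (coeff_vec n G) p q z))\<^sup>2 \<partial>sector p q)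
            \<le> (fock_norm (coeff_vec n (S k) - coeff_vec n G))\<^sup>2"
        proof (rule always_eventually, rule allI)
          fix k
          show "(\<integral>z. (cmod (sector_fun (coeff_vec n (S k)) p q z - sector_fun (coeff_vec n G) p q z))\<^sup>2 \<partial>sector p q)
            \<le> (fock_norm (coeff_vec n (S k) - coeff_vec n G))\<^sup>2"
            unfolding eq[symmetric]
          proof (rule sector_norm_le[of D])
            fix p q assume "p > D \<or> q > D"
            then show "AE z in sector p q. sector_fun (coeff_vec n (S k) - coeff_vec n G) p q z = 0"
              using G0[of p q] D[of p q k] by (intro AE_I2) (auto simp: sector_fun_def coeff_vec_def)
          qed
        qed
      qed simp_all
    qed
  qed
qed

lemma finite_particle_limit:
  assumes S: "tame_conv S G" and D: "\<And>p q x y. p > D \<or> q > D \<Longrightarrow> G p q x y $ n = 0"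
    and sym: "\<And>p q x y \<pi> \<rho>. \<pi> permutes {..<p} \<Longrightarrow> \<rho> permutes {..<q} \<Longrightarrow> G p q (x \<circ> \<pi>) (y \<circ> \<rho>) = G p q x y"
  shows "finite_particle (coeff_vec n G)"
  unfolding finite_particle_def
proof (intro conjI allI)
  have zero: "coeff_vec n G p q = 0" if "p > D \<or> q > D" for p q
    unfolding coeff_vec_def D[OF that] zero_fun_def ..
  have "p \<le> D \<and> q \<le> D" if "coeff_vec n G p q \<noteq> 0" for p q
  proof (rule ccontr)
    assume "\<not> (p \<le> D \<and> q \<le> D)"
    then have "p > D \<or> q > D" by linarith
    from zero[OF this] that show False by contradiction
  qed
  then have "{(p, q). coeff_vec n G p q \<noteq> 0} \<subseteq> {..D} \<times> {..D}" by auto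
  then show "finite {(p, q). coeff_vec n G p q \<noteq> 0}" by (rule finite_subset) simp
  fix p q
  show "(\<lambda>z. coeff_vec n G p q (fst z) (snd z)) \<in> borel_measurable (sector p q)"
    using tame_conv_sector(2)[OF S, where n = n and p = p and q = q] unfolding sector_fun_def[abs_def] .
  show "integrable (sector p q) (\<lambda>z. (cmod (coeff_vec n G p q (fst z) (snd z)))\<^sup>2)"
    using tame_square_integrable(2)[OF S, where p = p and q = q and n = n] unfolding sector_fun_def .
  have "coeff_vec n G p q (x \<circ> \<pi>) (y \<circ> \<rho>) = coeff_vec n G p q x y"
    if "\<pi> permutes {..<p}" "\<rho> permutes {..<q}" for x y \<pi> \<rho>
    unfolding coeff_vec_def sym[OF that] ..
  then show "\<forall>(x, y)\<in>space (sector p q). \<forall>\<pi> \<rho>. \<pi> permutes {..<p} \<longrightarrow> \<rho> permutes {..<q} \<longrightarrow>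
      coeff_vec n G p q (x \<circ> \<pi>) (y \<circ> \<rho>) = coeff_vec n G p q x y"
    by blast
qed

lemma pair_state_permute:
  assumes "\<pi> permutes {..<p}" "\<rho> permutes {..<q}"
  shows "pair_state C K p q (x \<circ> \<pi>) (y \<circ> \<rho>) = pair_state C K p q x y"
  using assms permanent_permute[of \<pi> p \<rho> "\<lambda>i j. K (x i) (y j)"] by (auto simp: pair_state_def)

lemma pair_state_nth_low:
  assumes "\<And>s t. K s t $ 0 = 0" "n < p \<or> n < q" shows "pair_state C K p q x y $ n = 0"
proof (cases "p = q")
  case True
  then show ?thesis
    unfolding pair_state_def using assms by (simp, intro mult_nth_low permanent_nth_low) auto
qed (simp add: pair_state_def)

lemma pair_creation_nth_low:
  assumes "\<And>s t. K s t $ 0 = 0" "Suc n < p \<or> Suc n < q" shows "pair_creation M C K p q x y $ n = 0"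
proof (cases "p = q")
  case True
  have "(\<Sum>i<p. \<Sum>j<p. M (x i) (y j) * permanent_minor (p - 1) i j (\<lambda>r u. K (x r) (y u))) $ k = 0" if "k \<le> n" for k
    unfolding fps_sum_nth permanent_minor_def
    by (intro sum.neutral ballI mult_nth_low permanent_nth_low assms(1)) (use assms(2) True that in auto)
  then show ?thesis
    unfolding pair_creation_def using True by (simp, intro mult_nth_low) auto
qed (simp add: pair_creation_def)

lemma uniform_partition:
  "is_partition a b (Suc k) (\<lambda>j. a + real j * ((b - a) / real (Suc k)))"
proof -
  define h where "h = (b - a) / real (Suc k)"
  have h: "h > 0" "real (Suc k) * h = b - a" using a_less_b by (simp_all add: h_def)
  have "real j * h < real (Suc j) * h" for j using h(1) by (simp add: distrib_right)
  then show ?thesis unfolding is_partition_def h_def[symmetric] using h(2) by (simp del: of_nat_Suc)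
qed

lemma levy_area_pair_state:
  assumes K: "bounded_kernel K" and K0: "\<And>s t. K s t $ 0 = 0"
    and M: "\<And>r s. limit_kernel \<sigma> K r s = \<kappa> * fps_deriv (K r s)" and tr: "limit_trace \<sigma> K * C = \<kappa> * fps_deriv C"
    and \<Psi>: "ae_eq \<Psi> (coeff_vec n (pair_state C K))"
  shows "ae_eq (levy_area \<sigma> a b \<Psi>) (coeff_vec n (\<lambda>p q x y. \<kappa> * fps_deriv (pair_state C K p q x y)))"
proof -
  let ?X = "pair_state C K"
  let ?G = "\<lambda>p q x y. \<kappa> * fps_deriv (?X p q x y)"
  define S where "S N t = (\<lambda>p q x y. riemann_trace \<sigma> K N t * ?X p q x y + pair_creation (riemann_kernel \<sigma> K N t) C K p q x y)"
    for N t
  have G: "?G = (\<lambda>p q x y. limit_trace \<sigma> K * ?X p q x y + pair_creation (limit_kernel \<sigma> K) C K p q x y)"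
  proof (intro ext)
    fix p q and x y :: "nat \<Rightarrow> real"
    have "\<kappa> * pair_state (fps_deriv C) K p q x y = limit_trace \<sigma> K * ?X p q x y"
      using arg_cong[OF tr[symmetric], of "\<lambda>u. u * (cst (1 / fact p) * permanent p (\<lambda>i j. K (x i) (y j)))"]
      by (cases "p = q") (simp_all add: pair_state_def mult_ac)
    moreover have "\<kappa> * pair_creation (\<lambda>s t. fps_deriv (K s t)) C K p q x y = pair_creation (limit_kernel \<sigma> K) C K p q x y"
      using pair_creation_lin[of \<kappa> "\<lambda>s t. fps_deriv (K s t)" 0 "\<lambda>s t. 0" C K p q x y] M[abs_def]
      by (simp add: M[abs_def])
    ultimately show "?G p q x y = limit_trace \<sigma> K * ?X p q x y + pair_creation (limit_kernel \<sigma> K) C K p q x y"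
      by (simp add: fps_deriv_pair_state distrib_left)
  qed
  have sumS: "area_sum \<sigma> a N t (coeff_vec n ?X) = coeff_vec n (S N t)" if "is_partition a b N t" for N t
    using area_sum_pair_state[OF that K] by (simp add: S_def)
  have conv: "tame_conv (\<lambda>k. S (N k) (t k)) ?G"
    if "\<And>k. is_partition a b (N k) (t k)" "\<And>k j. j < N k \<Longrightarrow> t k (Suc j) - t k j < \<delta> k" "\<delta> \<longlonglongrightarrow> 0" for N t \<delta>
    unfolding G S_def
    by (rule tame_conv_lin[OF tame_conv_pair_state[OF K] tame_conv_pair_creation[OF K riemann_conv(1)[OF that K]]
        riemann_conv(3)[OF that K] riemann_conv(2)[OF that K]])
  have low: "S N t p q x y $ n = 0" if "p > Suc n \<or> q > Suc n" for N t p q x y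
  proof -
    have "(riemann_trace \<sigma> K N t * ?X p q x y) $ n = 0"
      by (intro mult_nth_low pair_state_nth_low K0) (use that in auto)
    then show ?thesis unfolding S_def fps_add_nth using pair_creation_nth_low[OF K0 that] by simp
  qed
  have ae: "fock_norm (area_sum \<sigma> a N t \<Psi> - \<Phi>) = fock_norm (coeff_vec n (S N t) - \<Phi>)"
    if "is_partition a b N t" "\<And>p q. sector_fun \<Phi> p q \<in> borel_measurable (sector p q)" for N t \<Phi>
  proof (rule fock_norm_ae_eq, rule ae_eq_diff)
    show "ae_eq (area_sum \<sigma> a N t \<Psi>) (coeff_vec n (S N t))"
      unfolding sumS[OF that(1), symmetric]
      by (rule respects_ae_area_sum[unfolded respects_ae_def, THEN spec, THEN spec, THEN mp, OF \<Psi>])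
    show "ae_eq \<Phi> \<Phi>" using that(2) by (simp add: ae_eq_def)
  qed
  define N0 where "N0 = (\<lambda>k::nat. Suc k)"
  define t0 where "t0 = (\<lambda>k j. a + real j * ((b - a) / real (Suc k)))"
  define \<delta>0 where "\<delta>0 = (\<lambda>k. 2 * (b - a) / real (Suc k))"
  have p0: "is_partition a b (N0 k) (t0 k)" for k
    unfolding N0_def t0_def by (rule uniform_partition)
  have mesh0: "t0 k (Suc j) - t0 k j < \<delta>0 k" for k j
  proof -
    define h where "h = (b - a) / real (Suc k)"
    have "h > 0" using a_less_b by (simp add: h_def)
    moreover have "t0 k (Suc j) - t0 k j = h" unfolding t0_def h_def[symmetric] by (simp add: distrib_right)
    moreover have "\<delta>0 k = 2 * h" unfolding \<delta>0_def h_def by (rule times_divide_eq_right[symmetric])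
    ultimately show ?thesis by simp
  qed
  have \<delta>0: "\<delta>0 \<longlonglongrightarrow> 0"
    unfolding \<delta>0_def by (rule LIMSEQ_Suc[OF lim_const_over_n])
  note conv0 = conv[OF p0 mesh0 \<delta>0]
  have finG: "finite_particle (coeff_vec n ?G)"
  proof (rule finite_particle_limit[OF conv0, of "Suc n"])
    show "?G p q x y $ n = 0" if "p > Suc n \<or> q > Suc n" for p q x y
      using tame_conv_sector(6)[OF conv0, where n = n and p = p and q = q and z = "(x, y)"] low[OF that]
      by (simp add: sector_fun_def coeff_vec_def LIMSEQ_const_iff)
    show "?G p q (x \<circ> \<pi>) (y \<circ> \<rho>) = ?G p q x y" if "\<pi> permutes {..<p}" "\<rho> permutes {..<q}" for p q x y \<pi> \<rho>
      using pair_state_permute[OF that] by simp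
  qed
  have limG: "area_limit \<sigma> a b \<Psi> (coeff_vec n ?G)"
    unfolding area_limit_def
  proof (intro allI impI)
    fix \<epsilon> :: real assume \<epsilon>: "\<epsilon> > 0"
    define narrow where "narrow \<delta> w \<longleftrightarrow> is_partition a b (fst w) (snd w) \<and> (\<forall>j<fst w. snd w (Suc j) - snd w j < \<delta>)"
      for \<delta> :: real and w :: "nat \<times> (nat \<Rightarrow> real)"
    define close where "close w \<longleftrightarrow> fock_norm (area_sum \<sigma> a (fst w) (snd w) \<Psi> - coeff_vec n ?G) < \<epsilon>"
      for w :: "nat \<times> (nat \<Rightarrow> real)"
    define \<delta> where "\<delta> = (\<lambda>k. 1 / real (Suc k))"
    have \<delta>: "\<delta> \<longlonglongrightarrow> 0" unfolding \<delta>_def by (rule LIMSEQ_Suc[OF lim_const_over_n])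
    have \<delta>_pos: "\<delta> k > 0" for k by (simp add: \<delta>_def)
    have "\<exists>k. \<forall>w. narrow (\<delta> k) w \<longrightarrow> close w"
    proof (rule ccontr)
      assume "\<not> ?thesis"
      then have "\<forall>k. \<exists>w. narrow (\<delta> k) w \<and> \<not> close w" by blast
      from choice[OF this] obtain w where w: "\<And>k. narrow (\<delta> k) (w k)" "\<And>k. \<not> close (w k)" by blast
      have w1: "is_partition a b (fst (w k)) (snd (w k))" for k
        using w(1)[of k] unfolding narrow_def by (rule conjunct1)
      have w2: "j < fst (w k) \<Longrightarrow> snd (w k) (Suc j) - snd (w k) j < \<delta> k" for k j
        using w(1)[of k] unfolding narrow_def by blast
      have m: "sector_fun (coeff_vec n ?G) p q \<in> borel_measurable (sector p q)" for p q
        by (rule tame_conv_sector(2)[OF conv0])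
      have "(\<lambda>k. fock_norm (coeff_vec n (S (fst (w k)) (snd (w k))) - coeff_vec n ?G)) \<longlonglongrightarrow> 0"
        by (rule fock_norm_tendsto[OF conv[OF w1 w2 \<delta>] low])
      from order_tendstoD(2)[OF this \<epsilon>]
      obtain k where "fock_norm (coeff_vec n (S (fst (w k)) (snd (w k))) - coeff_vec n ?G) < \<epsilon>"
        unfolding eventually_sequentially by blast
      then have "close (w k)" unfolding close_def ae[OF w1 m] .
      with w(2) show False by blast
    qed
    then obtain k where k: "\<And>w. narrow (\<delta> k) w \<Longrightarrow> close w" by blast
    show "\<exists>\<delta>>0. \<forall>N t. is_partition a b N t \<and> (\<forall>j<N. t (Suc j) - t j < \<delta>) \<longrightarrow>
        fock_norm (area_sum \<sigma> a N t \<Psi> - coeff_vec n ?G) < \<epsilon>"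
    proof (rule exI[of _ "\<delta> k"], intro conjI \<delta>_pos allI impI)
      fix N t assume "is_partition a b N t \<and> (\<forall>j<N. t (Suc j) - t j < \<delta> k)"
      then have "narrow (\<delta> k) (N, t)" by (simp add: narrow_def)
      from k[OF this] show "fock_norm (area_sum \<sigma> a N t \<Psi> - coeff_vec n ?G) < \<epsilon>" by (simp add: close_def)
    qed
  qed
  define \<Phi> where "\<Phi> = levy_area \<sigma> a b \<Psi>"
  have "finite_particle \<Phi> \<and> area_limit \<sigma> a b \<Psi> \<Phi>"
    unfolding \<Phi>_def levy_area_def by (rule someI[where P = "\<lambda>\<Phi>. finite_particle \<Phi> \<and> area_limit \<sigma> a b \<Psi> \<Phi>", OF conjI[OF finG limG]])
  then have \<Phi>: "finite_particle \<Phi>" and lim: "area_limit \<sigma> a b \<Psi> \<Phi>" by (rule conjunct1, rule conjunct2)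
  have m\<Phi>: "sector_fun \<Phi> p q \<in> borel_measurable (sector p q)" for p q
    using \<Phi> unfolding finite_particle_def sector_fun_def[abs_def] by blast
  have "(\<lambda>k. fock_norm (coeff_vec n (S (N0 k) (t0 k)) - \<Phi>)) \<longlonglongrightarrow> 0"
  proof (rule LIMSEQ_I)
    fix \<epsilon> :: real assume "\<epsilon> > 0"
    then obtain \<delta> where \<delta>: "\<delta> > 0" "\<And>N t. is_partition a b N t \<Longrightarrow> (\<forall>j<N. t (Suc j) - t j < \<delta>) \<Longrightarrow>
        fock_norm (area_sum \<sigma> a N t \<Psi> - \<Phi>) < \<epsilon>"
      using lim[unfolded area_limit_def, THEN spec, THEN mp, OF \<open>\<epsilon> > 0\<close>] by blast
    from order_tendstoD(2)[OF \<delta>0 \<delta>(1)] obtain k0 where k0: "\<And>k. k \<ge> k0 \<Longrightarrow> \<delta>0 k < \<delta>"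
      by (auto simp: eventually_sequentially)
    show "\<exists>k0. \<forall>k\<ge>k0. norm (fock_norm (coeff_vec n (S (N0 k) (t0 k)) - \<Phi>) - 0) < \<epsilon>"
    proof (intro exI allI impI)
      fix k assume "k \<ge> k0"
      then have "t0 k (Suc j) - t0 k j < \<delta>" for j using mesh0[of k j] k0[of k] by simp
      then have "fock_norm (area_sum \<sigma> a (N0 k) (t0 k) \<Psi> - \<Phi>) < \<epsilon>" by (intro \<delta>(2)[OF p0] allI impI)
      then have "fock_norm (coeff_vec n (S (N0 k) (t0 k)) - \<Phi>) < \<epsilon>" by (simp only: ae[OF p0 m\<Phi>])
      moreover have "fock_norm (coeff_vec n (S (N0 k) (t0 k)) - \<Phi>) \<ge> 0"
        by (rule fock_norm_nonneg)
      ultimately show "norm (fock_norm (coeff_vec n (S (N0 k) (t0 k)) - \<Phi>) - 0) < \<epsilon>" by simp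
    qed
  qed
  from limit_unique[OF \<Phi> conv0 low this] show ?thesis unfolding \<Phi>_def .
qed

end

(*PART12*)
lemma pair_state_cst: "pair_state (cst k * C) K p q x y = cst k * pair_state C K p q x y"
  by (simp add: pair_state_def mult_ac)

lemma cst_mult_nth: "(cst k * h) $ n = k * h $ n"
  by (simp add: cst_def)

lemma integral_sector_0: "(\<integral>z. c \<partial>sector 0 0) = (c :: complex)"
proof -
  interpret Q: sigma_finite_measure "points 0" by (rule sigma_finite_points)
  have sp: "space (points 0) = {\<lambda>_. undefined}" by (simp add: space_PiM)
  have e: "emeasure (points 0) (space (points 0)) = 1" unfolding sp by simp
  have "emeasure (sector 0 0) (space (sector 0 0)) = 1"
    unfolding sector_def space_pair_measure
    by (subst Q.emeasure_pair_measure_Times[OF sets.top sets.top]) (simp only: e mult_1)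
  then show ?thesis by (simp add: measure_def)
qed

lemma fock_inner_vacuum:
  assumes "ae_eq \<Phi> (coeff_vec n (pair_state C K))"
  shows "fock_inner vacuum \<Phi> = C $ n"
proof -
  have "fock_inner vacuum \<Phi> = (\<Sum>\<^sub>\<infinity>(p, q)\<in>UNIV. if (p, q) = (0::nat, 0::nat) then C $ n else 0)"
    unfolding fock_inner_def
  proof (rule infsum_cong, clarify)
    fix p q :: nat
    show "(\<integral>z. cnj (vacuum p q (fst z) (snd z)) * \<Phi> p q (fst z) (snd z) \<partial>sector p q) =
      (if (p, q) = (0, 0) then C $ n else 0)"
    proof (cases "p = 0 \<and> q = 0")
      case True
      have m: "sector_fun \<Phi> 0 0 \<in> borel_measurable (sector 0 0)"
        and ae: "AE z in sector 0 0. sector_fun \<Phi> 0 0 z = sector_fun (coeff_vec n (pair_state C K)) 0 0 z"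
        using assms unfolding ae_eq_def by blast+
      have c: "sector_fun (coeff_vec n (pair_state C K)) 0 0 z = C $ n" for z
        by (simp add: sector_fun_def coeff_vec_def pair_state_def cst_def)
      have "(\<integral>z. sector_fun \<Phi> 0 0 z \<partial>sector 0 0) = (\<integral>z. C $ n \<partial>sector 0 0)"
        by (rule integral_cong_AE[OF m borel_measurable_const]) (use ae in \<open>simp only: c\<close>)
      then have "(\<integral>z. sector_fun \<Phi> 0 0 z \<partial>sector 0 0) = C $ n" unfolding integral_sector_0 .
      then show ?thesis using True by (simp add: vacuum_def sector_fun_def)
    next
      case False
      then have "vacuum p q = (\<lambda>x y. 0)" unfolding vacuum_def by (intro ext) (simp only: if_False)
      then show ?thesis using False by auto
    qed
  qed
  also have "\<dots> = (\<Sum>\<^sub>\<infinity>(p, q)\<in>{(0, 0)}. if (p, q) = (0::nat, 0::nat) then C $ n else 0)"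
    by (rule infsum_cong_neutral) (auto split: if_splits)
  finally show ?thesis by simp
qed

context time_interval
begin

lemma ae_eq_pair_state_refl:
  assumes "bounded_kernel K" shows "ae_eq (coeff_vec n (pair_state C K)) (coeff_vec n (pair_state C K))"
  using tame_conv_sector(2)[OF tame_conv_pair_state[OF assms]] by (simp add: ae_eq_def)

lemma levy_area_moments:
  assumes K: "bounded_kernel K" and K0: "\<And>s t. K s t $ 0 = 0" and \<sigma>: "\<sigma> \<noteq> 0"
    and M: "\<And>r s. limit_kernel \<sigma> K r s = cst (of_real (\<sigma>\<^sup>2)) * fps_deriv (K r s)"
    and tr: "limit_trace \<sigma> K * C = cst (of_real (\<sigma>\<^sup>2)) * fps_deriv C" and C0: "C $ 0 = 1"
  shows "expect (normalized_levy_area \<sigma> a b ^^ n) = fact n * C $ n"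
proof -
  let ?X = "\<lambda>n. coeff_vec n (pair_state (cst (fact n) * C) K)"
  have "ae_eq ((normalized_levy_area \<sigma> a b ^^ n) vacuum) (?X n)"
  proof (induction n)
    case 0
    have "vacuum = ?X 0"
    proof (intro ext)
      fix p q and x y :: "nat \<Rightarrow> real"
      show "vacuum p q x y = ?X 0 p q x y"
      proof (cases "p = 0 \<and> q = 0")
        case True
        then show ?thesis by (simp add: vacuum_def coeff_vec_def pair_state_def cst_def C0)
      next
        case False
        then have "?X 0 p q x y = 0"
          unfolding coeff_vec_def by (intro pair_state_nth_low K0) auto
        then show ?thesis using False by (auto simp: vacuum_def)
      qed
    qed
    then show ?case using ae_eq_pair_state_refl[OF K, of 0 "cst (fact 0) * C"] by simp
  next
    case (Suc n)
    let ?\<Psi> = "(normalized_levy_area \<sigma> a b ^^ n) vacuum"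
    have tr': "limit_trace \<sigma> K * (cst (fact n) * C) = cst (of_real (\<sigma>\<^sup>2)) * fps_deriv (cst (fact n) * C)"
      using tr by (simp add: mult_ac)
    have "ae_eq (levy_area \<sigma> a b ?\<Psi>)
        (coeff_vec n (\<lambda>p q x y. cst (of_real (\<sigma>\<^sup>2)) * fps_deriv (pair_state (cst (fact n) * C) K p q x y)))"
      by (rule levy_area_pair_state[OF K K0 M tr' Suc])
    from ae_eq_scale[OF this, of "of_real (1 / \<sigma>\<^sup>2)"]
    have "ae_eq ((normalized_levy_area \<sigma> a b ^^ Suc n) vacuum) (scale (of_real (1 / \<sigma>\<^sup>2))
        (coeff_vec n (\<lambda>p q x y. cst (of_real (\<sigma>\<^sup>2)) * fps_deriv (pair_state (cst (fact n) * C) K p q x y))))"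
      by (simp add: normalized_levy_area_def)
    moreover have "scale (of_real (1 / \<sigma>\<^sup>2))
        (coeff_vec n (\<lambda>p q x y. cst (of_real (\<sigma>\<^sup>2)) * fps_deriv (pair_state (cst (fact n) * C) K p q x y))) = ?X (Suc n)"
    proof (intro ext)
      fix p q and x y :: "nat \<Rightarrow> real"
      have "(of_real (1 / \<sigma>\<^sup>2) :: complex) * of_real (\<sigma>\<^sup>2) = 1" using \<sigma> by (simp flip: of_real_mult)
      then have "scale (of_real (1 / \<sigma>\<^sup>2)) (coeff_vec n (\<lambda>p q x y. cst (of_real (\<sigma>\<^sup>2)) *
          fps_deriv (pair_state (cst (fact n) * C) K p q x y))) p q x y =
        fps_deriv (pair_state (cst (fact n) * C) K p q x y) $ n"
        unfolding scale_def coeff_vec_def cst_mult_nth by (simp only: mult.assoc[symmetric] mult_1)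
      also have "\<dots> = of_nat (Suc n) * fact n * pair_state C K p q x y $ Suc n"
        unfolding pair_state_cst fps_deriv_nth cst_mult_nth by simp
      also have "\<dots> = ?X (Suc n) p q x y"
        by (simp add: coeff_vec_def pair_state_cst cst_mult_nth)
      finally show "scale (of_real (1 / \<sigma>\<^sup>2)) (coeff_vec n (\<lambda>p q x y. cst (of_real (\<sigma>\<^sup>2)) *
          fps_deriv (pair_state (cst (fact n) * C) K p q x y))) p q x y = ?X (Suc n) p q x y" .
    qed
    ultimately show ?case by simp
  qed
  from fock_inner_vacuum[OF this] show ?thesis by (simp add: expect_def cst_mult_nth)
qed

end

(*PART13*)
lemma integral_half_line_Icc:
  fixes f F :: "real \<Rightarrow> complex"
  assumes "0 \<le> \<alpha>" "\<alpha> \<le> \<beta>"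
    and F: "\<And>x. \<alpha> \<le> x \<Longrightarrow> x \<le> \<beta> \<Longrightarrow> (F has_vector_derivative f x) (at x within {\<alpha>..\<beta>})"
    and c: "continuous_on {\<alpha>..\<beta>} f"
  shows "(\<integral>x. (if x \<in> {\<alpha>..\<beta>} then f x else 0) \<partial>half_line) = F \<beta> - F \<alpha>"
    and "integrable half_line (\<lambda>x. if x \<in> {\<alpha>..\<beta>} then f x else 0)"
proof -
  have eq: "indicator {0..} x *\<^sub>R (if x \<in> {\<alpha>..\<beta>} then f x else 0) = indicator {\<alpha>..\<beta>} x *\<^sub>R f x" for x
    using assms(1) by (simp add: indicator_def)
  have h: "has_bochner_integral lborel (\<lambda>x. indicator {\<alpha>..\<beta>} x *\<^sub>R f x) (F \<beta> - F \<alpha>)"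
    by (rule has_bochner_integral_FTC_Icc[OF assms(2) F c])
  show "(\<integral>x. (if x \<in> {\<alpha>..\<beta>} then f x else 0) \<partial>half_line) = F \<beta> - F \<alpha>"
    unfolding half_line_def by (subst integral_restrict_space) (simp_all only: eq has_bochner_integral_integral_eq[OF h], simp)
  show "integrable half_line (\<lambda>x. if x \<in> {\<alpha>..\<beta>} then f x else 0)"
    unfolding half_line_def by (subst integrable_restrict_space) (use h in \<open>simp_all only: eq has_bochner_integral_iff\<close>, simp)
qed

text \<open>The series \<open>exp (-2 i w r)\<close> in the variable \<open>w\<close>.\<close>

definition osc :: "real \<Rightarrow> complex fps" where
  "osc r = fps_exp (- 2 * \<i> * of_real r)"

lemma osc_add: "osc (r + s) = osc r * osc s"
  unfolding osc_def of_real_add distrib_left by (rule fps_exp_add_mult)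

lemma osc_0 [simp]: "osc 0 = 1"
  by (simp add: osc_def)

lemma osc_nth: "osc r $ n = (- 2 * \<i> * of_real r) ^ n / fact n"
  by (simp add: osc_def fps_exp_def)

definition osc_piece :: "real \<Rightarrow> real \<Rightarrow> real \<Rightarrow> complex fps" where
  "osc_piece \<alpha> \<beta> t = coeff_integral (\<lambda>r. if r \<in> {\<alpha>..\<beta>} then osc (r - t) else 0)"

lemma osc_piece_integral:
  assumes "0 \<le> \<alpha>" "\<alpha> \<le> \<beta>"
  shows "coeff_integrable (\<lambda>r. if r \<in> {\<alpha>..\<beta>} then osc (r - t) else 0)"
    and "cst (- 2 * \<i>) * fps_X * osc_piece \<alpha> \<beta> t = osc (\<beta> - t) - osc (\<alpha> - t)"
proof -
  let ?F = "\<lambda>n r. of_real ((r - t) ^ Suc n / real (Suc n)) * ((- 2 * \<i>) ^ n / fact n) :: complex"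
  have nth: "osc (r - t) $ n = of_real ((r - t) ^ n) * ((- 2 * \<i>) ^ n / fact n)" for r n
    unfolding osc_nth power_mult_distrib of_real_power times_divide_eq_right by (simp only: mult.commute)
  have F: "(?F n has_vector_derivative osc (r - t) $ n) (at r within A)" for n r A
  proof -
    have "((\<lambda>r. (r - t) ^ Suc n / real (Suc n)) has_real_derivative (r - t) ^ n) (at r within A)"
      by (rule derivative_eq_intros refl | simp)+
    then have "((\<lambda>r. complex_of_real ((r - t) ^ Suc n / real (Suc n))) has_vector_derivative of_real ((r - t) ^ n)) (at r within A)"
      by (intro has_vector_derivative_of_real) (simp add: has_real_derivative_iff_has_vector_derivative)
    from has_vector_derivative_mult_left[OF this, of "(- 2 * \<i>) ^ n / fact n"]
    show ?thesis unfolding nth .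
  qed
  have c: "continuous_on A (\<lambda>r. osc (r - t) $ n)" for A n
    unfolding nth by (intro continuous_intros)
  note int = integral_half_line_Icc[OF assms F c]
  have if_nth: "(if r \<in> {\<alpha>..\<beta>} then osc (r - t) else 0) $ n = (if r \<in> {\<alpha>..\<beta>} then osc (r - t) $ n else 0)" for r n
    by simp
  show "coeff_integrable (\<lambda>r. if r \<in> {\<alpha>..\<beta>} then osc (r - t) else 0)"
    unfolding coeff_integrable_def if_nth using int(2) by blast
  have J: "osc_piece \<alpha> \<beta> t $ n = ?F n \<beta> - ?F n \<alpha>" for n
    unfolding osc_piece_def coeff_integral_nth if_nth by (rule int(1))
  show "cst (- 2 * \<i>) * fps_X * osc_piece \<alpha> \<beta> t = osc (\<beta> - t) - osc (\<alpha> - t)"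
  proof (rule fps_ext)
    fix n
    show "(cst (- 2 * \<i>) * fps_X * osc_piece \<alpha> \<beta> t) $ n = (osc (\<beta> - t) - osc (\<alpha> - t)) $ n"
    proof (cases n)
      case 0
      then show ?thesis by (simp add: osc_nth)
    next
      case (Suc m)
      have step: "k * (of_real (y / real (Suc m)) * (k ^ m / fact m)) = of_real y * (k ^ Suc m / fact (Suc m))"
        for k :: complex and y by (simp add: mult_ac del: of_nat_Suc)
      have "(cst (- 2 * \<i>) * fps_X * osc_piece \<alpha> \<beta> t) $ n = - 2 * \<i> * (?F m \<beta> - ?F m \<alpha>)"
        by (simp only: Suc mult.assoc cst_mult_nth fps_X_mult_nth J nat.simps if_False diff_Suc_1)
      also have "\<dots> = (osc (\<beta> - t) - osc (\<alpha> - t)) $ n"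
        unfolding fps_sub_nth nth Suc right_diff_distrib step ..
      finally show ?thesis .
    qed
  qed
qed

context time_interval
begin

abbreviation len :: real where "len \<equiv> b - a"

definition wave_up :: "complex fps" where "wave_up = fps_exp (\<i> * of_real (b - a))"
definition wave_down :: "complex fps" where "wave_down = fps_exp (- \<i> * of_real (b - a))"

lemma wave_inverse: "wave_up * wave_down = 1"
  unfolding wave_up_def wave_down_def by (simp flip: fps_exp_add_mult)

lemma osc_wave: "osc (b - t) = osc (a - t) * (wave_down * wave_down)"
proof -
  have "osc (b - a) = wave_down * wave_down"
    unfolding osc_def wave_down_def fps_exp_add_mult[symmetric] by (rule arg_cong[of _ _ fps_exp]) (simp add: algebra_simps)
  then show ?thesis using osc_add[of "a - t" "b - a"] by simp
qed

definition den :: "complex fps" where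
  "den = inverse (wave_up + wave_down)"

lemma den: "(wave_up + wave_down) * den = 1"
  unfolding den_def by (rule inverse_mult_eq_1') (simp add: wave_up_def wave_down_def)

definition jump_plus :: "complex fps" where
  "jump_plus = cst (- 2 * \<i>) * fps_X * (wave_up * den)"

definition jump_minus :: "complex fps" where
  "jump_minus = - (cst (- 2 * \<i>) * fps_X * (wave_down * den))"

lemma jump: "jump_plus - jump_minus = cst (- 2 * \<i>) * fps_X"
proof -
  have "jump_plus - jump_minus = cst (- 2 * \<i>) * fps_X * ((wave_up + wave_down) * den)"
    unfolding jump_plus_def jump_minus_def by (simp only: distrib_left distrib_right diff_minus_eq_add)
  then show ?thesis by (simp only: den mult_1_right)
qed

lemma antiperiodic: "jump_plus * osc (b - t) + jump_minus * osc (a - t) = 0"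
proof -
  define k where "k = cst (- 2 * \<i>)"
  have "jump_plus * osc (b - t) + jump_minus * osc (a - t) =
    k * fps_X * den * osc (a - t) * wave_down * (wave_up * wave_down - 1)"
    unfolding jump_plus_def jump_minus_def osc_wave k_def[symmetric] by (simp add: algebra_simps)
  then show ?thesis unfolding wave_inverse by simp
qed

definition tangent :: "complex fps" where
  "tangent = - (cst \<i> * (wave_up - wave_down) * den)"

lemma jump_mean: "jump_plus + jump_minus = 2 * (fps_X * tangent)"
proof -
  have "cst (- 2 * \<i>) = - (2 * cst \<i>)"
    by (simp add: cst_def numeral_fps_const)
  then show ?thesis unfolding jump_plus_def jump_minus_def tangent_def by (simp add: algebra_simps)
qed

lemma tangent_deriv: "fps_deriv tangent = cst (of_real (b - a)) * (1 + tangent * tangent)"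
proof -
  define l where "l = cst (of_real (b - a))"
  define k where "k = cst \<i>"
  have k1: "k * k = - 1" by (simp add: k_def cst_def flip: fps_const_neg)
  then have kk: "k * (k * z) = - z" for z by (simp add: mult.assoc[symmetric])
  have dk: "fps_deriv k = 0" unfolding k_def by (rule fps_deriv_cst)
  have dp: "fps_deriv wave_up = k * l * wave_up"
    unfolding wave_up_def k_def l_def cst_def fps_const_mult by (rule fps_exp_deriv)
  have dm: "fps_deriv wave_down = - (k * l * wave_down)"
  proof -
    have "fps_deriv wave_down = cst (- \<i> * of_real (b - a)) * wave_down"
      unfolding wave_down_def cst_def by (rule fps_exp_deriv)
    also have "cst (- \<i> * of_real (b - a)) = - (k * l)"
      unfolding k_def l_def cst_def by (simp only: fps_const_mult fps_const_neg mult_minus_left)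
    finally show ?thesis by simp
  qed
  have "fps_deriv ((wave_up + wave_down) * den) = 0" unfolding den by simp
  then have "(wave_up + wave_down) * fps_deriv den = - (k * l * (wave_up - wave_down) * den)"
    by (simp add: dp dm algebra_simps eq_neg_iff_add_eq_0)
  then have "((wave_up + wave_down) * den) * fps_deriv den = - (k * l * (wave_up - wave_down) * den * den)"
    by (simp only: mult_ac) (simp add: mult_ac)
  then have dd: "fps_deriv den = - (k * l * (wave_up - wave_down) * den * den)"
    by (simp only: den mult_1_left)
  have "fps_deriv tangent = - (k * (k * l * (wave_up + wave_down)) * den) - k * (wave_up - wave_down) * fps_deriv den"
    unfolding tangent_def k_def[symmetric] by (simp add: dp dm dk algebra_simps)
  also have "\<dots> = l * ((wave_up + wave_down) * den) + l * (tangent * tangent)"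
    unfolding dd tangent_def k_def[symmetric] by (simp add: algebra_simps k1 kk)
  also have "\<dots> = l * (1 + tangent * tangent)"
    unfolding den by (simp add: distrib_left)
  finally show ?thesis unfolding l_def .
qed

lemma tangent_0: "tangent $ 0 = 0"
  by (simp add: tangent_def fps_mult_nth wave_up_def wave_down_def)

definition profile :: "real \<Rightarrow> complex fps" where
  "profile r = (if r > 0 then jump_plus * osc r else if r < 0 then jump_minus * osc r else fps_X * tangent)"

definition resolvent :: "real \<Rightarrow> real \<Rightarrow> complex fps" where
  "resolvent s t = (if s \<in> {a..<b} \<and> t \<in> {a..<b} then profile (s - t) else 0)"

lemma coeff_integral_cong_finite:
  assumes "coeff_measurable f" "coeff_integrable g" "finite A" "\<And>r. r \<notin> A \<Longrightarrow> f r = g r"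
  shows "coeff_integral f = coeff_integral g"
proof (rule fps_ext)
  fix n
  have "AE r in lborel. r \<notin> A"
    using finite_imp_null_set_lborel[OF assms(3)] by (rule AE_not_in)
  then have "AE r in lborel. r \<in> {0..} \<longrightarrow> r \<notin> A" by eventually_elim simp
  then have "AE r in half_line. r \<notin> A"
    unfolding half_line_def by (subst AE_restrict_space_iff) simp_all
  then have ae: "AE r in half_line. f r $ n = g r $ n"
    by eventually_elim (simp add: assms(4))
  have "(\<lambda>r. f r $ n) \<in> borel_measurable half_line"
    using assms(1) unfolding coeff_measurable_def by (intro borel_imp_half_line) (rule spec)
  moreover have "(\<lambda>r. g r $ n) \<in> borel_measurable half_line"
    using assms(2) unfolding coeff_integrable_def by (intro borel_measurable_integrable) (rule spec)
  ultimately show "coeff_integral f $ n = coeff_integral g $ n"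
    unfolding coeff_integral_nth using ae by (rule integral_cong_AE)
qed

lemma bounded_kernel_sgn:
  assumes meas: "\<And>n. f n \<in> borel_measurable borel" 
    and bd: "\<And>n. \<exists>B. \<forall>r. \<bar>r\<bar> \<le> len \<longrightarrow> cmod (f n r) \<le> B"
  shows "bounded_kernel (\<lambda>s t. if s \<in> {a..<b} \<and> t \<in> {a..<b} then Abs_fps (\<lambda>n. f n (s - t)) else 0)"
  unfolding bounded_kernel_def
proof (intro conjI allI impI)
  have nth: "(if s \<in> {a..<b} \<and> t \<in> {a..<b} then Abs_fps (\<lambda>n. f n (s - t)) else 0) $ n =
    indicator ({a..<b} \<times> {a..<b}) (s, t) * f n (s - t)" for s t n
    by (simp add: indicator_def)
  show "coeff_measurable (\<lambda>(s, t). if s \<in> {a..<b} \<and> t \<in> {a..<b} then Abs_fps (\<lambda>n. f n (s - t)) else 0)"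
    unfolding coeff_measurable_def case_prod_unfold nth
  proof
    fix n
    have S: "{a..<b} \<times> {a..<b} \<in> sets (borel :: (real \<times> real) measure)"
      unfolding borel_prod[symmetric] by (intro pair_measureI) auto
    have d: "(\<lambda>z::real \<times> real. fst z - snd z) \<in> borel_measurable borel"
      by (intro borel_measurable_continuous_onI continuous_intros)
    show "(\<lambda>z. indicator ({a..<b} \<times> {a..<b}) (fst z, snd z) * f n (fst z - snd z)) \<in> borel_measurable borel"
      unfolding prod.collapse
      by (rule borel_measurable_times[OF borel_measurable_indicator[OF S] measurable_compose[OF d meas]])
  qed
  show "coeff_bounded (\<lambda>(s, t). if s \<in> {a..<b} \<and> t \<in> {a..<b} then Abs_fps (\<lambda>n. f n (s - t)) else 0)"
    unfolding coeff_bounded_def case_prod_unfold nth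
  proof
    fix n
    obtain B where B: "\<And>r. \<bar>r\<bar> \<le> len \<Longrightarrow> cmod (f n r) \<le> B" using bd[of n] by blast
    have "cmod (indicator ({a..<b} \<times> {a..<b}) (s, t) * f n (s - t)) \<le> max B 0" for s t
    proof (cases "s \<in> {a..<b} \<and> t \<in> {a..<b}")
      case True
      then have "\<bar>s - t\<bar> \<le> len" by (auto simp: abs_le_iff)
      with True show ?thesis using B[of "s - t"] by (simp add: max.coboundedI1)
    qed (auto simp: indicator_def)
    then show "\<exists>B. \<forall>z. cmod (indicator ({a..<b} \<times> {a..<b}) (fst z, snd z) * f n (fst z - snd z)) \<le> B" by blast
  qed
qed auto

lemma resolvent_nth:
  "resolvent s t $ n = (if s \<in> {a..<b} \<and> t \<in> {a..<b} then profile (s - t) $ n else 0)"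
  by (simp add: resolvent_def)

lemma profile_measurable: "(\<lambda>r. profile r $ n) \<in> borel_measurable borel"
  and profile_bounded: "\<exists>B. \<forall>r. \<bar>r\<bar> \<le> len \<longrightarrow> cmod (profile r $ n) \<le> B"
proof -
  have nth: "profile r $ n = (if r > 0 then (\<Sum>i=0..n. jump_plus $ i * osc r $ (n - i))
      else if r < 0 then (\<Sum>i=0..n. jump_minus $ i * osc r $ (n - i)) else (fps_X * tangent) $ n)" for r
    by (simp add: profile_def fps_mult_nth)
  have o: "(\<lambda>r. \<Sum>i=0..n. c $ i * osc r $ (n - i)) \<in> borel_measurable borel" for c :: "complex fps"
    unfolding osc_nth by (intro borel_measurable_continuous_onI continuous_intros) simp_all
  show "(\<lambda>r. profile r $ n) \<in> borel_measurable borel"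
    unfolding nth by (intro measurable_If o borel_measurable_const) auto
  have ob: "cmod (osc r $ k) \<le> (2 * len) ^ k / fact k" if "\<bar>r\<bar> \<le> len" for r k
  proof -
    have "cmod (osc r $ k) = (2 * \<bar>r\<bar>) ^ k / fact k"
      by (simp add: osc_nth norm_divide norm_power norm_mult)
    then show ?thesis using that by (simp only:) (intro divide_right_mono power_mono, auto)
  qed
  have b: "cmod (\<Sum>i=0..n. c $ i * osc r $ (n - i)) \<le> (\<Sum>i=0..n. cmod (c $ i) * ((2 * len) ^ (n - i) / fact (n - i)))"
    if "\<bar>r\<bar> \<le> len" for r and c :: "complex fps"
    by (rule sum_norm_le) (simp only: norm_mult, intro mult_left_mono ob that norm_ge_zero)
  let ?b = "\<lambda>c::complex fps. (\<Sum>i=0..n. cmod (c $ i) * ((2 * len) ^ (n - i) / fact (n - i)))"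
  have "cmod (profile r $ n) \<le> max (?b jump_plus) (max (?b jump_minus) (cmod ((fps_X * tangent) $ n)))" if "\<bar>r\<bar> \<le> len" for r
    unfolding nth using b[OF that, of jump_plus] b[OF that, of jump_minus] by (auto simp: max.coboundedI1 max.coboundedI2)
  then show "\<exists>B. \<forall>r. \<bar>r\<bar> \<le> len \<longrightarrow> cmod (profile r $ n) \<le> B" by blast
qed

lemma bounded_kernel_profile:
  fixes \<alpha> :: "nat \<Rightarrow> complex"
  shows "bounded_kernel (\<lambda>s t. Abs_fps (\<lambda>n. \<alpha> n * resolvent s t $ \<nu> n))"
proof -
  have m: "(\<lambda>r. \<alpha> n * profile r $ \<nu> n) \<in> borel_measurable borel" for n
    by (intro borel_measurable_times borel_measurable_const profile_measurable)
  have bd: "\<exists>B. \<forall>r. \<bar>r\<bar> \<le> len \<longrightarrow> cmod (\<alpha> n * profile r $ \<nu> n) \<le> B" for n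
  proof -
    obtain B where B: "\<forall>r. \<bar>r\<bar> \<le> len \<longrightarrow> cmod (profile r $ \<nu> n) \<le> B" using profile_bounded by blast
    then have "\<forall>r. \<bar>r\<bar> \<le> len \<longrightarrow> cmod (\<alpha> n * profile r $ \<nu> n) \<le> cmod (\<alpha> n) * B"
      by (simp add: norm_mult mult_left_mono)
    then show ?thesis by blast
  qed
  have "(\<lambda>s t. Abs_fps (\<lambda>n. \<alpha> n * resolvent s t $ \<nu> n)) =
    (\<lambda>s t. if s \<in> {a..<b} \<and> t \<in> {a..<b} then Abs_fps (\<lambda>n. \<alpha> n * profile (s - t) $ \<nu> n) else 0)"
    by (intro ext) (auto simp: resolvent_nth fps_eq_iff)
  then show ?thesis using bounded_kernel_sgn[OF m bd] by simp
qed

lemma bounded_kernel_resolvent: "bounded_kernel resolvent"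
proof -
  have "(\<lambda>s t. Abs_fps (\<lambda>n. 1 * resolvent s t $ n)) = resolvent"
    by (intro ext fps_ext) simp
  then show ?thesis using bounded_kernel_profile[of "\<lambda>n. 1" "\<lambda>n. n"] by (simp only:)
qed

end

(*PART14*)
context time_interval
begin

lemma piecewise_osc_integral:
  assumes m: "a \<le> m1" "m1 \<le> m2" "m2 \<le> b" and f: "coeff_measurable f"
    and eq: "\<And>r. r \<notin> {a, m1, m2, b} \<Longrightarrow> f r =
      (if r < a then 0 else if r < m1 then c1 * osc (r - t) else if r < m2 then c2 * osc (r - t)
       else if r < b then c3 * osc (r - t) else 0)"
  shows "cst (- 2 * \<i>) * fps_X * coeff_integral f =
    c1 * (osc (m1 - t) - osc (a - t)) + c2 * (osc (m2 - t) - osc (m1 - t)) + c3 * (osc (b - t) - osc (m2 - t))"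
proof -
  let ?p = "\<lambda>\<alpha> \<beta> r. if r \<in> {\<alpha>..\<beta>} then osc (r - t) else 0"
  have m0: "0 \<le> m1" "0 \<le> m2" using m a_nonneg by linarith+
  note i1 = osc_piece_integral[OF a_nonneg m(1), of t] and i2 = osc_piece_integral[OF m0(1) m(2), of t]
    and i3 = osc_piece_integral[OF m0(2) m(3), of t]
  let ?g = "\<lambda>r. c1 * ?p a m1 r + (c2 * ?p m1 m2 r + c3 * ?p m2 b r)"
  have ig: "coeff_integrable ?g"
    by (intro coeff_integrable_add coeff_integrable_cmult i1(1) i2(1) i3(1))
  have "coeff_integral f = coeff_integral ?g"
  proof (rule coeff_integral_cong_finite[OF f ig, of "{a, m1, m2, b}"])
    fix r assume r: "r \<notin> {a, m1, m2, b}"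
    then consider "r < a" | "a < r" "r < m1" | "m1 < r" "r < m2" | "m2 < r" "r < b" | "b < r" by fastforce
    then show "f r = ?g r" unfolding eq[OF r] using m by cases auto
  qed simp
  also have "\<dots> = c1 * osc_piece a m1 t + (c2 * osc_piece m1 m2 t + c3 * osc_piece m2 b t)"
    unfolding osc_piece_def
    by (simp only: coeff_integral_add coeff_integral_cmult coeff_integrable_add coeff_integrable_cmult i1(1) i2(1) i3(1))
  finally have "cst (- 2 * \<i>) * fps_X * coeff_integral f =
      c1 * (cst (- 2 * \<i>) * fps_X * osc_piece a m1 t) + (c2 * (cst (- 2 * \<i>) * fps_X * osc_piece m1 m2 t) +
      c3 * (cst (- 2 * \<i>) * fps_X * osc_piece m2 b t))"
    by (simp only: distrib_left mult_ac)
  then show ?thesis unfolding i1(2) i2(2) i3(2) by (simp only: add.assoc)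
qed

lemma profile_0: "profile r $ 0 = 0"
  by (simp add: profile_def jump_plus_def jump_minus_def fps_mult_nth)

lemma wave_den_0: "wave_up $ 0 = 1" "wave_down $ 0 = 1" "den $ 0 = 1 / 2"
  by (simp_all add: den_def wave_up_def wave_down_def)

lemma profile_1: "profile r $ 1 = - \<i> * of_real (sgn r)"
proof -
  have "jump_plus $ 1 = - \<i>" "jump_minus $ 1 = \<i>"
    unfolding jump_plus_def jump_minus_def fps_neg_nth mult.assoc cst_mult_nth fps_X_mult_nth
    by (simp_all add: wave_den_0)
  moreover have "jump_plus $ 0 = 0" "jump_minus $ 0 = 0"
    by (simp_all add: jump_plus_def jump_minus_def fps_mult_nth)
  ultimately show ?thesis
    by (simp add: profile_def fps_mult_nth[of _ _ 1] osc_nth tangent_0 sgn_if)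
qed

lemma area_kernel_resolvent: "area_kernel s t = cst (resolvent s t $ 1)"
  using profile_1[of "s - t"] by (auto simp: area_kernel_def resolvent_nth cst_def)

lemma resolvent_eq:
  "resolvent s t = fps_X * (area_kernel s t + kernel_comp area_kernel resolvent s t)"
proof (cases "s \<in> {a..<b} \<and> t \<in> {a..<b}")
  case False
  then show ?thesis by (auto simp: resolvent_def area_kernel_def kernel_comp_def)
next
  case True
  define ci where "ci = cst (- \<i>)"
  define kk where "kk = cst (- 2 * \<i>) * fps_X"
  have ci1: "cst \<i> * ci = 1" by (simp add: ci_def cst_def)
  have ci2: "cst (\<i>) = - ci" by (simp add: ci_def cst_def)
  have kk2: "kk = 2 * (fps_X * ci)"
    by (simp add: kk_def ci_def cst_def numeral_fps_const)
  let ?f = "\<lambda>r. area_kernel s r * resolvent r t"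
  have ak: "bounded_kernel area_kernel"
  proof -
    have "area_kernel = (\<lambda>s t. Abs_fps (\<lambda>n. (if n = 0 then 1 else 0) * resolvent s t $ 1))"
      by (intro ext fps_ext) (simp add: area_kernel_resolvent cst_def)
    then show ?thesis using bounded_kernel_profile[of "\<lambda>n. if n = 0 then 1 else 0" "\<lambda>_. 1"] by simp
  qed
  have meas: "coeff_measurable ?f" by (rule compose_measurable_section[OF ak bounded_kernel_resolvent])
  have a1: "area_kernel s r = (if r < s then ci else - ci)" if "r \<in> {a..<b}" "r \<noteq> s" for r
    using that True by (auto simp: area_kernel_def ci_def cst_def sgn_if)
  have r1: "resolvent r t = (if r < t then jump_minus * osc (r - t) else jump_plus * osc (r - t))"
    if "r \<in> {a..<b}" "r \<noteq> t" for r
    using that True by (auto simp: resolvent_def profile_def)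
  have out: "?f r = 0" if "r \<notin> {a..<b}" for r using that by (auto simp: resolvent_def)
  have osc0: "osc (t - t) = 1" by simp
  have cancel: "fps_X * kernel_comp area_kernel resolvent s t = E" if "kk * coeff_integral ?f = ci * (2 * E)" for E
  proof -
    have "cst \<i> * (2 * (fps_X * ci) * coeff_integral ?f) = cst \<i> * (ci * (2 * E))" using that kk2 by simp
    then have "2 * (fps_X * coeff_integral ?f) * (cst \<i> * ci) = 2 * E * (cst \<i> * ci)" by (simp only: mult_ac)
    then have "2 * (fps_X * coeff_integral ?f) = 2 * E" unfolding ci1 by simp
    then show ?thesis by (simp add: kernel_comp_def)
  qed
  have ap: "jump_minus * osc (a - t) = - (jump_plus * osc (b - t))"
    using antiperiodic[of t] by (simp add: add_eq_0_iff)
  have jp: "jump_plus = jump_minus + kk" using jump by (simp add: kk_def algebra_simps)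
  consider "t < s" | "s < t" | "s = t" by fastforce
  then show ?thesis
  proof cases
    case 1
    have "kk * coeff_integral ?f = (ci * jump_minus) * (osc (t - t) - osc (a - t)) +
        (ci * jump_plus) * (osc (s - t) - osc (t - t)) + (- (ci * jump_plus)) * (osc (b - t) - osc (s - t))"
      unfolding kk_def
      by (rule piecewise_osc_integral[OF _ _ _ meas]) (use 1 True a1 r1 out in \<open>auto simp: mult_ac\<close>)
    also have "\<dots> = ci * (2 * (jump_plus * osc (s - t)) - (jump_plus - jump_minus) - (jump_minus * osc (a - t) + jump_plus * osc (b - t)))"
      unfolding osc0 by (simp add: algebra_simps)
    also have "\<dots> = ci * (2 * (jump_plus * osc (s - t) - fps_X * ci))"
      unfolding ap jump kk_def[symmetric] kk2 by (simp add: algebra_simps)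
    finally have "fps_X * kernel_comp area_kernel resolvent s t = jump_plus * osc (s - t) - fps_X * ci" by (rule cancel)
    then show ?thesis using 1 True a1[of t] by (simp add: distrib_left resolvent_def profile_def)
  next
    case 2
    have "kk * coeff_integral ?f = (ci * jump_minus) * (osc (s - t) - osc (a - t)) +
        (- (ci * jump_minus)) * (osc (t - t) - osc (s - t)) + (- (ci * jump_plus)) * (osc (b - t) - osc (t - t))"
      unfolding kk_def
      by (rule piecewise_osc_integral[OF _ _ _ meas]) (use 2 True a1 r1 out in \<open>auto simp: mult_ac\<close>)
    also have "\<dots> = ci * (2 * (jump_minus * osc (s - t)) + (jump_plus - jump_minus) - (jump_minus * osc (a - t) + jump_plus * osc (b - t)))"
      unfolding osc0 by (simp add: algebra_simps)
    also have "\<dots> = ci * (2 * (jump_minus * osc (s - t) + fps_X * ci))"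
      unfolding ap jump kk_def[symmetric] kk2 by (simp add: algebra_simps)
    finally have "fps_X * kernel_comp area_kernel resolvent s t = jump_minus * osc (s - t) + fps_X * ci" by (rule cancel)
    then show ?thesis using 2 True a1[of t] by (simp add: distrib_left right_diff_distrib resolvent_def profile_def)
  next
    case 3
    have "kk * coeff_integral ?f = (ci * jump_minus) * (osc (t - t) - osc (a - t)) +
        0 * (osc (t - t) - osc (t - t)) + (- (ci * jump_plus)) * (osc (b - t) - osc (t - t))"
      unfolding kk_def
      by (rule piecewise_osc_integral[OF _ _ _ meas]) (use 3 True a1 r1 out in \<open>auto simp: mult_ac\<close>)
    also have "\<dots> = ci * ((jump_plus + jump_minus) - (jump_minus * osc (a - t) + jump_plus * osc (b - t)))"
      unfolding osc0 by (simp add: algebra_simps)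
    also have "\<dots> = ci * (2 * (fps_X * tangent))"
      unfolding ap jump_mean by simp
    finally have "fps_X * kernel_comp area_kernel resolvent s t = fps_X * tangent" by (rule cancel)
    then show ?thesis using 3 True by (simp add: distrib_left resolvent_def profile_def area_kernel_def cst_def)
  qed
qed

lemma kernel_comp_assoc:
  assumes A: "bounded_kernel A" and B: "bounded_kernel B" and C: "bounded_kernel C"
  shows "kernel_comp (kernel_comp A B) C = kernel_comp A (kernel_comp B C)"
proof (intro ext)
  fix s t
  let ?g = "\<lambda>u r. A s u * (B u r * C r t)"
  have AC: "supported (A s)" "supported (\<lambda>r. C r t)" using kernel_section'[OF A] kernel_section[OF C] by auto
  have c: "continuous_on UNIV (fst :: real \<times> real \<Rightarrow> real)" "continuous_on UNIV (snd :: real \<times> real \<Rightarrow> real)"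
    by (auto intro: continuous_on_fst continuous_on_snd continuous_on_id)
  have mA: "coeff_measurable (A s)" "coeff_bounded (A s)" and mC: "coeff_measurable (\<lambda>r. C r t)" "coeff_bounded (\<lambda>r. C r t)"
    using AC by (simp_all add: supported_def test_fun_def)
  have mB: "coeff_measurable (\<lambda>(u, r). B u r)" "coeff_bounded (\<lambda>(u, r). B u r)" using B by (simp_all add: bounded_kernel_def)
  have m: "coeff_measurable (\<lambda>z. A s (fst z) * ((case z of (u, r) \<Rightarrow> B u r) * C (snd z) t))"
    by (rule coeff_measurable_mult[OF coeff_measurable_compose[OF mA(1) c(1)]
        coeff_measurable_mult[OF mB(1) coeff_measurable_compose[OF mC(1) c(2)]]])
  have bd: "coeff_bounded (\<lambda>z. A s (fst z) * ((case z of (u, r) \<Rightarrow> B u r) * C (snd z) t))"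
    by (rule coeff_bounded_mult[OF coeff_bounded_compose[OF mA(2), of fst]
        coeff_bounded_mult[OF mB(2) coeff_bounded_compose[OF mC(2), of snd]]])
  have "coeff_integral (\<lambda>u. coeff_integral (?g u)) = coeff_integral (\<lambda>r. coeff_integral (\<lambda>u. ?g u r))"
    by (rule coeff_integral_swap[of _ a b]) (use m bd AC in \<open>auto simp: case_prod_unfold supported_def\<close>)
  moreover have "coeff_integral (?g u) = A s u * kernel_comp B C u t" for u
    unfolding kernel_comp_def
    by (intro coeff_integral_cmult supported_integrable[OF supported_test[OF kernel_section'[OF B]] AC(2)])
  moreover have "coeff_integral (\<lambda>u. ?g u r) = kernel_comp A B s r * C r t" for r
  proof -
    have "coeff_integral (\<lambda>u. ?g u r) = coeff_integral (\<lambda>u. C r t * (A s u * B u r))" by (simp only: mult_ac)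
    also have "\<dots> = C r t * kernel_comp A B s r"
      unfolding kernel_comp_def
      by (intro coeff_integral_cmult supported_integrable[OF supported_test[OF AC(1)] kernel_section[OF B]])
    finally show ?thesis by (simp only: mult_ac)
  qed
  ultimately show "kernel_comp (kernel_comp A B) C s t = kernel_comp A (kernel_comp B C) s t"
    by (simp add: kernel_comp_def[of "kernel_comp A B"] kernel_comp_def[of A "kernel_comp B C"])
qed

definition power_kernel :: "nat \<Rightarrow> real \<Rightarrow> real \<Rightarrow> complex fps" where
  "power_kernel l s t = cst (resolvent s t $ l)"

lemma bounded_kernel_power: "bounded_kernel (power_kernel l)"
proof -
  have "power_kernel l = (\<lambda>s t. Abs_fps (\<lambda>n. (if n = 0 then 1 else 0) * resolvent s t $ l))"
    by (intro ext fps_ext) (simp add: power_kernel_def cst_def)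
  then show ?thesis using bounded_kernel_profile[of "\<lambda>n. if n = 0 then 1 else 0" "\<lambda>_. l"] by simp
qed

lemma kernel_comp_power_nth:
  "kernel_comp (power_kernel l) (power_kernel m) s t $ n =
    (if n = 0 then \<integral>r. resolvent s r $ l * resolvent r t $ m \<partial>half_line else 0)"
  by (simp add: kernel_comp_def power_kernel_def cst_def)

lemma area_power: "area_kernel = power_kernel 1"
  by (intro ext) (simp add: area_kernel_resolvent power_kernel_def)

lemma power_kernel_Suc:
  assumes "l \<ge> 1" shows "kernel_comp (power_kernel 1) (power_kernel l) = power_kernel (Suc l)"
proof (intro ext fps_ext)
  fix s t n
  have "resolvent s t $ Suc l = (area_kernel s t + kernel_comp area_kernel resolvent s t) $ l"
    by (subst resolvent_eq) (simp only: fps_X_mult_nth nat.simps if_False diff_Suc_1)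
  also have "\<dots> = (\<integral>r. resolvent s r $ 1 * resolvent r t $ l \<partial>half_line)"
    using assms by (simp add: area_kernel_resolvent kernel_comp_def cst_def)
  finally show "kernel_comp (power_kernel 1) (power_kernel l) s t $ n = power_kernel (Suc l) s t $ n"
    unfolding kernel_comp_power_nth by (simp add: power_kernel_def cst_def)
qed

lemma power_kernel_add:
  assumes "l \<ge> 1" "m \<ge> 1" shows "kernel_comp (power_kernel l) (power_kernel m) = power_kernel (l + m)"
  using assms(1)
proof (induction l rule: nat_induct_at_least)
  case base
  then show ?case using power_kernel_Suc[OF assms(2)] by simp
next
  case (Suc l)
  have "kernel_comp (power_kernel (Suc l)) (power_kernel m) =
    kernel_comp (power_kernel 1) (kernel_comp (power_kernel l) (power_kernel m))"
    unfolding power_kernel_Suc[OF Suc.hyps, symmetric]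
    by (rule kernel_comp_assoc[OF bounded_kernel_power bounded_kernel_power bounded_kernel_power])
  then show ?case using Suc power_kernel_Suc[of "l + m"] by simp
qed

lemma resolvent_integral:
  assumes "l \<ge> 1" "m \<ge> 1"
  shows "(\<integral>r. resolvent s r $ l * resolvent r t $ m \<partial>half_line) = resolvent s t $ (l + m)"
  using fun_cong[OF fun_cong[OF power_kernel_add[OF assms]], of s t] kernel_comp_power_nth[of l m s t 0]
  by (simp add: power_kernel_def cst_def)

lemma resolvent_integrable: "integrable half_line (\<lambda>r. resolvent s r $ l * resolvent r t $ m)"
proof -
  have "coeff_integrable (\<lambda>r. power_kernel l s r * power_kernel m r t)"
    by (rule supported_integrable[OF supported_test[OF kernel_section'[OF bounded_kernel_power]] kernel_section[OF bounded_kernel_power]])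
  then have "integrable half_line (\<lambda>r. (power_kernel l s r * power_kernel m r t) $ 0)"
    unfolding coeff_integrable_def by (rule spec)
  then show ?thesis by (simp add: power_kernel_def cst_def)
qed

text \<open>Functions of the area kernel, given by their Taylor series.\<close>

definition series_kernel :: "nat \<Rightarrow> complex fps \<Rightarrow> real \<Rightarrow> real \<Rightarrow> complex fps" where
  "series_kernel i \<alpha> s t = Abs_fps (\<lambda>n. \<alpha> $ n * resolvent s t $ (n + i))"

lemma bounded_series_kernel: "bounded_kernel (series_kernel i \<alpha>)"
  unfolding series_kernel_def[abs_def] by (rule bounded_kernel_profile)

lemma area_series_kernel: "area_kernel = series_kernel 1 1"
  by (intro ext fps_ext) (simp add: area_kernel_resolvent series_kernel_def cst_def)

lemma kernel_comp_series_kernel: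
  assumes \<alpha>: "i \<ge> 1 \<or> \<alpha> $ 0 = 0" and \<beta>: "j \<ge> 1 \<or> \<beta> $ 0 = 0"
  shows "kernel_comp (series_kernel i \<alpha>) (series_kernel j \<beta>) = series_kernel (i + j) (\<alpha> * \<beta>)"
proof (intro ext fps_ext)
  fix s t n
  have "kernel_comp (series_kernel i \<alpha>) (series_kernel j \<beta>) s t $ n =
    (\<integral>r. (\<Sum>k=0..n. (\<alpha> $ k * \<beta> $ (n - k)) * (resolvent s r $ (k + i) * resolvent r t $ (n - k + j))) \<partial>half_line)"
    by (simp add: kernel_comp_def series_kernel_def fps_mult_nth mult_ac)
  also have "\<dots> = (\<Sum>k=0..n. (\<alpha> $ k * \<beta> $ (n - k)) * (\<integral>r. resolvent s r $ (k + i) * resolvent r t $ (n - k + j) \<partial>half_line))"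
    by (subst Bochner_Integration.integral_sum)
      (intro integrable_mult_right resolvent_integrable, simp add: resolvent_integrable)
  also have "\<dots> = (\<Sum>k=0..n. (\<alpha> $ k * \<beta> $ (n - k)) * resolvent s t $ (n + (i + j)))"
  proof (rule sum.cong[OF refl])
    fix k assume k: "k \<in> {0..n}"
    show "(\<alpha> $ k * \<beta> $ (n - k)) * (\<integral>r. resolvent s r $ (k + i) * resolvent r t $ (n - k + j) \<partial>half_line) =
      (\<alpha> $ k * \<beta> $ (n - k)) * resolvent s t $ (n + (i + j))"
    proof (cases "k + i \<ge> 1 \<and> n - k + j \<ge> 1")
      case True
      moreover have "k + i + (n - k + j) = n + (i + j)" using k by simp
      ultimately show ?thesis by (simp only: resolvent_integral)
    next
      case False
      then have "\<alpha> $ k = 0 \<or> \<beta> $ (n - k) = 0"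
        using \<alpha> \<beta> by (cases "k + i \<ge> 1") (auto simp: not_le)
      then show ?thesis by auto
    qed
  qed
  finally show "kernel_comp (series_kernel i \<alpha>) (series_kernel j \<beta>) s t $ n = series_kernel (i + j) (\<alpha> * \<beta>) s t $ n"
    by (simp add: series_kernel_def fps_mult_nth sum_distrib_right)
qed

lemma fps_deriv_series_kernel: "fps_deriv (series_kernel 0 \<alpha> s t) = series_kernel 1 (fps_deriv \<alpha>) s t"
  by (rule fps_ext) (simp add: series_kernel_def mult_ac)

lemma series_kernel_lin: "series_kernel i (cst c * \<alpha> + \<beta>) s t = cst c * series_kernel i \<alpha> s t + series_kernel i \<beta> s t"
  by (rule fps_ext) (simp add: series_kernel_def cst_def algebra_simps)

lemma kernel_trace_series_kernel:
  "kernel_trace (series_kernel 1 \<alpha>) $ n = of_real (b - a) * (\<alpha> $ n * tangent $ n)"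
proof -
  have "series_kernel 1 \<alpha> s s $ n = (if s \<in> {a..<b} then \<alpha> $ n * tangent $ n else 0)" for s
    by (simp add: series_kernel_def resolvent_def profile_def)
  then have "kernel_trace (series_kernel 1 \<alpha>) $ n = (\<integral>s. indicator {a..<b} s *\<^sub>R (\<alpha> $ n * tangent $ n) \<partial>half_line)"
    unfolding kernel_trace_def coeff_integral_nth
    by (intro Bochner_Integration.integral_cong) (auto simp: indicator_def)
  also have "\<dots> = measure half_line ({a..<b} \<inter> space half_line) *\<^sub>R (\<alpha> $ n * tangent $ n)"
  proof -
    have "integrable half_line (indicator {a..<b} :: real \<Rightarrow> real)"
      using sets_half_line_interval[of a b] finite_half_line_interval[of a b]
      by (simp only: interval_half_line) (rule integrable_real_indicator)
    then show ?thesis by simp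
  qed
  also have "measure half_line ({a..<b} \<inter> space half_line) = b - a"
  proof -
    have "emeasure half_line ({a..<b} \<inter> {0..}) = emeasure lborel {a..<b}"
      unfolding interval_half_line half_line_def
      by (rule emeasure_restrict_space) (use a_nonneg in auto)
    then show ?thesis using a_less_b by (simp add: measure_def)
  qed
  finally show ?thesis by (simp add: scaleR_conv_of_real)
qed

end

(*PART15*)
fun pattern_weight :: "(nat \<Rightarrow> real) \<Rightarrow> (nat \<Rightarrow> real) \<Rightarrow> nat \<Rightarrow> nat list \<Rightarrow> real" where
  "pattern_weight \<alpha> \<beta> k (x # y # xs) = (if x > y then \<alpha> k else \<beta> k) * pattern_weight \<alpha> \<beta> (Suc k) (y # xs)"
| "pattern_weight \<alpha> \<beta> k xs = 1"

definition arrangements :: "nat set \<Rightarrow> nat list set" where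
  "arrangements S = {xs. set xs = S \<and> distinct xs}"

definition pattern_sum :: "(nat \<Rightarrow> real) \<Rightarrow> (nat \<Rightarrow> real) \<Rightarrow> nat \<Rightarrow> nat set \<Rightarrow> real" where
  "pattern_sum \<alpha> \<beta> k S = (\<Sum>xs\<in>arrangements S. pattern_weight \<alpha> \<beta> k xs)"

lemma length_arrangement: "xs \<in> arrangements S \<Longrightarrow> length xs = card S"
  unfolding arrangements_def using distinct_card by fastforce

lemma finite_arrangements: "finite S \<Longrightarrow> finite (arrangements S)"
  by (rule finite_subset[OF _ finite_lists_length_eq[of S "card S"]])
    (auto simp: length_arrangement, auto simp: arrangements_def)

lemma pattern_weight_map:
  assumes "strict_mono_on (set xs) f"
  shows "pattern_weight \<alpha> \<beta> k (map f xs) = pattern_weight \<alpha> \<beta> k xs"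
  using assms
proof (induction \<alpha> \<beta> k xs rule: pattern_weight.induct)
  case (1 \<alpha> \<beta> k x y xs)
  have lt: "f u < f w \<longleftrightarrow> u < w" if "u \<in> set (x # y # xs)" "w \<in> set (x # y # xs)" for u w
    using 1(2) that unfolding monotone_on_def by (metis linorder_neqE_nat order_less_asym order_less_irrefl)
  have "strict_mono_on (set (y # xs)) f" by (rule monotone_on_subset[OF 1(2)]) auto
  from 1(1)[OF this] show ?case using lt[of y x] by simp
qed simp_all

lemma pattern_sum_card:
  assumes "finite S"
  shows "pattern_sum \<alpha> \<beta> k S = pattern_sum \<alpha> \<beta> k {0..<card S}"
proof -
  obtain h where h: "bij_betw h {0..<card S} S" "strict_mono_on {0..<card S} h"
    by (rule ex_bij_betw_strict_mono_card[OF assms, unfolded lessThan_atLeast0])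
  have inj: "inj_on h {0..<card S}" using h(1) by (rule bij_betw_imp_inj_on)
  have bij: "bij_betw (map h) (arrangements {0..<card S}) (arrangements S)"
    unfolding bij_betw_def
  proof
    show "inj_on (map h) (arrangements {0..<card S})"
    proof (rule inj_onI)
      fix xs ys assume "xs \<in> arrangements {0..<card S}" "ys \<in> arrangements {0..<card S}" "map h xs = map h ys"
      then show "xs = ys" using inj by (intro map_inj_on[of h xs ys]) (simp_all add: arrangements_def)
    qed
    show "map h ` arrangements {0..<card S} = arrangements S"
    proof (intro set_eqI iffI)
      fix ys assume ys: "ys \<in> arrangements S"
      let ?g = "inv_into {0..<card S} h"
      have g: "bij_betw ?g S {0..<card S}" using h(1) by (rule bij_betw_inv_into)
      have "map ?g ys \<in> arrangements {0..<card S}"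
        using ys g by (simp add: arrangements_def distinct_map bij_betw_def)
      moreover have "map h (map ?g ys) = ys"
        unfolding map_map comp_def
        using ys bij_betw_inv_into_right[OF h(1)] by (intro map_idI) (simp add: arrangements_def)
      ultimately show "ys \<in> map h ` arrangements {0..<card S}" by (intro image_eqI) auto
    qed (use h(1) inj in \<open>auto simp: arrangements_def distinct_map bij_betw_def simp del: set_upt\<close>)
  qed
  show ?thesis
    unfolding pattern_sum_def
    by (subst sum.reindex_bij_betw[OF bij, symmetric], intro sum.cong refl pattern_weight_map)
      (use h(2) in \<open>auto simp: arrangements_def\<close>)
qed

definition pattern_number :: "(nat \<Rightarrow> real) \<Rightarrow> (nat \<Rightarrow> real) \<Rightarrow> nat \<Rightarrow> nat \<Rightarrow> real" where
  "pattern_number \<alpha> \<beta> k n = pattern_sum \<alpha> \<beta> k {0..<n}"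

lemma pattern_number_0 [simp]: "pattern_number \<alpha> \<beta> k 0 = 1"
proof -
  have "arrangements {} = {[]}" by (auto simp: arrangements_def)
  then show ?thesis by (simp add: pattern_number_def pattern_sum_def)
qed

lemma pattern_weight_minimum:
  assumes "\<forall>y\<in>set ys. 0 < y" "\<forall>z\<in>set zs. 0 < z"
  shows "pattern_weight \<alpha> \<beta> k (ys @ 0 # zs) =
    pattern_weight \<alpha> \<beta> k ys * (if ys = [] then 1 else \<alpha> (k + length ys - 1)) *
    (if zs = [] then 1 else \<beta> (k + length ys)) * pattern_weight \<alpha> \<beta> (Suc (k + length ys)) zs"
  using assms
proof (induction ys arbitrary: k)
  case Nil
  then show ?case by (cases zs) auto
next
  case (Cons y ys)
  show ?case
  proof (cases ys)
    case Nil
    then show ?thesis using Cons by (cases zs) auto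
  next
    case (Cons y' ys')
    then show ?thesis using Cons.IH[of "Suc k"] Cons.prems by simp
  qed
qed

lemma arrangement_split:
  "bij_betw (\<lambda>(A, ys, zs). ys @ 0 # zs) (SIGMA A:Pow {1..n}. arrangements A \<times> arrangements ({1..n} - A))
    (arrangements {0..<Suc n})"
proof (rule bij_betw_byWitness[where f' = "\<lambda>xs. (set (takeWhile ((<) 0) xs), takeWhile ((<) 0) xs, tl (dropWhile ((<) 0) xs))"])
  have z: "takeWhile ((<) 0) (ys @ 0 # zs) = ys" "dropWhile ((<) 0) (ys @ 0 # zs) = 0 # zs"
    if "0 \<notin> set ys" for ys zs :: "nat list"
    using that by (induction ys) auto
  show "\<forall>w\<in>SIGMA A:Pow {1..n}. arrangements A \<times> arrangements ({1..n} - A).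
      (\<lambda>xs. (set (takeWhile ((<) 0) xs), takeWhile ((<) 0) xs, tl (dropWhile ((<) 0) xs))) ((\<lambda>(A, ys, zs). ys @ 0 # zs) w) = w"
  proof
    fix w assume w: "w \<in> (SIGMA A:Pow {1..n}. arrangements A \<times> arrangements ({1..n} - A))"
    obtain A ys zs where e: "w = (A, ys, zs)" by (rule prod_cases3)
    have "0 \<notin> set ys" "set ys = A" using w unfolding e by (auto simp: arrangements_def)
    then show "(\<lambda>xs. (set (takeWhile ((<) 0) xs), takeWhile ((<) 0) xs, tl (dropWhile ((<) 0) xs))) ((\<lambda>(A, ys, zs). ys @ 0 # zs) w) = w"
      unfolding e by (simp add: z)
  qed
  have rebuild: "takeWhile ((<) 0) xs @ 0 # tl (dropWhile ((<) 0) xs) = xs" if "0 \<in> set xs" for xs :: "nat list"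
    using that by (induction xs) auto
  show "\<forall>xs\<in>arrangements {0..<Suc n}. (\<lambda>(A, ys, zs). ys @ 0 # zs)
      (set (takeWhile ((<) 0) xs), takeWhile ((<) 0) xs, tl (dropWhile ((<) 0) xs)) = xs"
  proof
    fix xs assume "xs \<in> arrangements {0..<Suc n}"
    then have "0 \<in> set xs" by (auto simp: arrangements_def)
    from rebuild[OF this] show "(\<lambda>(A, ys, zs). ys @ 0 # zs)
      (set (takeWhile ((<) 0) xs), takeWhile ((<) 0) xs, tl (dropWhile ((<) 0) xs)) = xs" by simp
  qed
  show "(\<lambda>(A, ys, zs). ys @ 0 # zs) ` (SIGMA A:Pow {1..n}. arrangements A \<times> arrangements ({1..n} - A))
      \<subseteq> arrangements {0..<Suc n}"
    by (fastforce simp: arrangements_def)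
  show "(\<lambda>xs. (set (takeWhile ((<) 0) xs), takeWhile ((<) 0) xs, tl (dropWhile ((<) 0) xs))) ` arrangements {0..<Suc n}
      \<subseteq> (SIGMA A:Pow {1..n}. arrangements A \<times> arrangements ({1..n} - A))"
  proof (rule image_subsetI)
    fix xs assume xs: "xs \<in> arrangements {0..<Suc n}"
    define ys where "ys = takeWhile ((<) 0) xs"
    define zs where "zs = tl (dropWhile ((<) 0) xs)"
    have eq: "xs = ys @ 0 # zs" unfolding ys_def zs_def using xs rebuild[of xs] by (auto simp: arrangements_def)
    have d: "distinct (ys @ 0 # zs)" and s: "set (ys @ 0 # zs) = {0..<Suc n}"
      using xs unfolding eq arrangements_def by auto
    have "set ys \<union> set zs = set (ys @ 0 # zs) - {0}" using d by auto
    also have "\<dots> = {0..<Suc n} - {0}" unfolding s ..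
    also have "\<dots> = {1..n}" by auto
    finally have "set ys \<subseteq> {1..n}" "set zs = {1..n} - set ys" using d by auto
    with d show "(set (takeWhile ((<) 0) xs), takeWhile ((<) 0) xs, tl (dropWhile ((<) 0) xs))
      \<in> (SIGMA A:Pow {1..n}. arrangements A \<times> arrangements ({1..n} - A))"
      by (auto simp: arrangements_def ys_def[symmetric] zs_def[symmetric])
  qed
qed

lemma sum_over_subsets:
  fixes f :: "nat \<Rightarrow> real"
  assumes "finite S"
  shows "(\<Sum>A\<in>Pow S. f (card A)) = (\<Sum>k=0..card S. real (card S choose k) * f k)"
proof -
  have "(\<Sum>A\<in>Pow S. f (card A)) = (\<Sum>k=0..card S. \<Sum>A | A \<in> Pow S \<and> card A = k. f (card A))"
    by (rule sum.group[symmetric]) (use assms in \<open>auto intro: card_mono\<close>)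
  also have "\<dots> = (\<Sum>k=0..card S. real (card S choose k) * f k)"
    by (intro sum.cong refl) (use assms in \<open>simp add: n_subsets flip: Pow_iff\<close>, simp add: n_subsets)
  finally show ?thesis .
qed

lemma pattern_number_Suc:
  "pattern_number \<alpha> \<beta> i (Suc n) = (\<Sum>k=0..n. real (n choose k) *
    (pattern_number \<alpha> \<beta> i k * (if k = 0 then 1 else \<alpha> (i + k - 1)) * (if k = n then 1 else \<beta> (i + k)) *
     pattern_number \<alpha> \<beta> (Suc (i + k)) (n - k)))"
proof -
  let ?S = "{1..n}"
  let ?c = "\<lambda>k. (if k = 0 then 1 else \<alpha> (i + k - 1)) * (if k = n then 1 else \<beta> (i + k))"
  have "pattern_number \<alpha> \<beta> i (Suc n) =
    (\<Sum>(A, ys, zs)\<in>(SIGMA A:Pow ?S. arrangements A \<times> arrangements (?S - A)). pattern_weight \<alpha> \<beta> i (ys @ 0 # zs))"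
    unfolding pattern_number_def pattern_sum_def
    by (subst sum.reindex_bij_betw[OF arrangement_split, symmetric]) (simp add: case_prod_unfold)
  also have "\<dots> = (\<Sum>A\<in>Pow ?S. \<Sum>(ys, zs)\<in>arrangements A \<times> arrangements (?S - A). pattern_weight \<alpha> \<beta> i (ys @ 0 # zs))"
    by (subst sum.Sigma[symmetric]) (auto intro!: finite_arrangements finite_cartesian_product intro: finite_subset)
  also have "\<dots> = (\<Sum>A\<in>Pow ?S. pattern_number \<alpha> \<beta> i (card A) * ?c (card A) *
      pattern_number \<alpha> \<beta> (Suc (i + card A)) (n - card A))"
  proof (rule sum.cong[OF refl])
    fix A assume "A \<in> Pow ?S"
    then have A: "A \<subseteq> ?S" "finite A" by (auto intro: finite_subset)
    have cA: "card (?S - A) = n - card A" using A by (simp add: card_Diff_subset)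
    have le: "card A \<le> n" using card_mono[OF _ A(1)] by simp
    have "(\<Sum>(ys, zs)\<in>arrangements A \<times> arrangements (?S - A). pattern_weight \<alpha> \<beta> i (ys @ 0 # zs)) =
      (\<Sum>(ys, zs)\<in>arrangements A \<times> arrangements (?S - A). ?c (card A) *
        (pattern_weight \<alpha> \<beta> i ys * pattern_weight \<alpha> \<beta> (Suc (i + card A)) zs))"
    proof (rule sum.cong[OF refl], clarify)
      fix ys zs assume ys: "ys \<in> arrangements A" and zs: "zs \<in> arrangements (?S - A)"
      have l: "length ys = card A" "length zs = n - card A"
        using length_arrangement[OF ys] length_arrangement[OF zs] cA by auto
      have pos: "\<forall>y\<in>set ys. 0 < y" "\<forall>z\<in>set zs. 0 < z" using ys zs A(1) by (auto simp: arrangements_def)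
      have e: "ys = [] \<longleftrightarrow> card A = 0" "zs = [] \<longleftrightarrow> card A = n"
        using l le by (auto simp flip: length_0_conv)
      show "pattern_weight \<alpha> \<beta> i (ys @ 0 # zs) =
        ?c (card A) * (pattern_weight \<alpha> \<beta> i ys * pattern_weight \<alpha> \<beta> (Suc (i + card A)) zs)"
        unfolding pattern_weight_minimum[OF pos] e l(1) by (simp only: mult_ac)
    qed
    also have "\<dots> = ?c (card A) * (pattern_sum \<alpha> \<beta> i A * pattern_sum \<alpha> \<beta> (Suc (i + card A)) (?S - A))"
    proof -
      have "sum f P * sum g Q = (\<Sum>(y, z)\<in>P \<times> Q. f y * g z)" for f g :: "nat list \<Rightarrow> real" and P Q
        by (simp only: sum_product sum.cartesian_product)
      then show ?thesis unfolding pattern_sum_def by (simp only: sum_distrib_left case_prod_unfold)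
    qed
    also have "pattern_sum \<alpha> \<beta> i A = pattern_number \<alpha> \<beta> i (card A)"
      unfolding pattern_number_def by (rule pattern_sum_card[OF A(2)])
    also have "pattern_sum \<alpha> \<beta> (Suc (i + card A)) (?S - A) = pattern_number \<alpha> \<beta> (Suc (i + card A)) (n - card A)"
      unfolding pattern_number_def cA[symmetric] by (rule pattern_sum_card) simp
    finally show "(\<Sum>(ys, zs)\<in>arrangements A \<times> arrangements (?S - A). pattern_weight \<alpha> \<beta> i (ys @ 0 # zs)) =
        pattern_number \<alpha> \<beta> i (card A) * ?c (card A) * pattern_number \<alpha> \<beta> (Suc (i + card A)) (n - card A)"
      by (simp only: mult_ac)
  qed
  also have "\<dots> = (\<Sum>k=0..n. real (n choose k) * (pattern_number \<alpha> \<beta> i k * ?c k * pattern_number \<alpha> \<beta> (Suc (i + k)) (n - k)))"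
    using sum_over_subsets[of ?S "\<lambda>k. pattern_number \<alpha> \<beta> i k * ?c k * pattern_number \<alpha> \<beta> (Suc (i + k)) (n - k)"] by simp
  finally show ?thesis by (simp only: mult.assoc)
qed

text \<open>Permutations as functions.\<close>

lemma bij_permutes_arrangements: "bij_betw (\<lambda>s. map s [1..<Suc n]) {s. s permutes {1..n}} (arrangements {1..n})"
proof -
  let ?m = "\<lambda>s. map s [1..<Suc n]"
  have su: "set [1..<Suc n] = {1..n}" by (simp only: set_upt atLeastLessThanSuc_atLeastAtMost)
  have inj: "inj_on ?m {s. s permutes {1..n}}"
  proof (rule inj_onI)
    fix s s' assume s: "s \<in> {s. s permutes {1..n}}" "s' \<in> {s. s permutes {1..n}}" and eq: "?m s = ?m s'"
    have "\<forall>x\<in>{1..n}. s x = s' x" using eq unfolding map_eq_conv su .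
    moreover have "s x = s' x" if "x \<notin> {1..n}" for x
      using s that permutes_not_in[of s "{1..n}" x] permutes_not_in[of s' "{1..n}" x] by simp
    ultimately show "s = s'" by blast
  qed
  have sub: "?m ` {s. s permutes {1..n}} \<subseteq> arrangements {1..n}"
  proof (rule image_subsetI)
    fix s assume "s \<in> {s. s permutes {1..n}}"
    then have s: "s permutes {1..n}" by simp
    have "set (?m s) = {1..n}" unfolding set_map su by (rule permutes_image[OF s])
    moreover have "distinct (?m s)" unfolding distinct_map su using permutes_inj_on[OF s] distinct_upt by blast
    ultimately show "?m s \<in> arrangements {1..n}" unfolding arrangements_def by blast
  qed
  have card: "card (arrangements {1..n}) = card {s. s permutes {1..n}}"
  proof -
    have "arrangements {1..n} = {xs. length xs = n \<and> distinct xs \<and> set xs \<subseteq> {1..n}}"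
    proof (intro set_eqI iffI)
      fix xs assume "xs \<in> arrangements {1..n}"
      then show "xs \<in> {xs. length xs = n \<and> distinct xs \<and> set xs \<subseteq> {1..n}}"
        using length_arrangement[of xs "{1..n}"] by (simp add: arrangements_def)
    next
      fix xs assume xs: "xs \<in> {xs. length xs = n \<and> distinct xs \<and> set xs \<subseteq> {1..n}}"
      then have "set xs = {1..n}" using distinct_card[of xs] by (intro card_subset_eq) auto
      with xs show "xs \<in> arrangements {1..n}" by (simp add: arrangements_def)
    qed
    then have "card (arrangements {1..n}) = fact n"
      using card_lists_distinct_length_eq[of "{1..n}" n] by (simp add: fact_prod)
    then show ?thesis using card_permutations[of "{1..n}" n] by simp
  qed
  have "?m ` {s. s permutes {1..n}} = arrangements {1..n}"
    by (rule card_subset_eq[OF finite_arrangements[OF finite_atLeastAtMost] sub])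
      (simp only: card_image[OF inj] card)
  with inj show ?thesis unfolding bij_betw_def by blast
qed

lemma pattern_weight_prod:
  "pattern_weight \<alpha> \<beta> m (map s [m..<Suc (m + r)]) = (\<Prod>i\<in>{m..<m + r}. if s i > s (Suc i) then \<alpha> i else \<beta> i)"
proof (induction r arbitrary: m)
  case 0
  then show ?case by simp
next
  case (Suc r)
  have u: "[m..<Suc (m + Suc r)] = m # [Suc m..<Suc (Suc m + r)]" "[Suc m..<Suc (Suc m + r)] = Suc m # [Suc (Suc m)..<Suc (Suc m + r)]"
    by (subst upt_conv_Cons, simp_all del: upt_Suc)+
  have "pattern_weight \<alpha> \<beta> m (map s [m..<Suc (m + Suc r)]) =
    (if s m > s (Suc m) then \<alpha> m else \<beta> m) * pattern_weight \<alpha> \<beta> (Suc m) (map s [Suc m..<Suc (Suc m + r)])"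
    unfolding u by (simp only: list.map pattern_weight.simps)
  also have "\<dots> = (\<Prod>i\<in>{m..<m + Suc r}. if s i > s (Suc i) then \<alpha> i else \<beta> i)"
    unfolding Suc.IH by (subst prod.atLeast_Suc_lessThan[of m]) simp_all
  finally show ?case .
qed

lemma sum_over_permutations:
  "(\<Sum>s | s permutes {1..n}. \<Prod>i\<in>{1..<n}. if s i > s (Suc i) then \<alpha> i else \<beta> i) = pattern_number \<alpha> \<beta> 1 n"
proof (cases n)
  case 0
  then show ?thesis by (simp add: permutes_empty)
next
  case (Suc r)
  have "(\<Sum>s | s permutes {1..n}. \<Prod>i\<in>{1..<n}. if s i > s (Suc i) then \<alpha> i else \<beta> i) =
    (\<Sum>s | s permutes {1..n}. pattern_weight \<alpha> \<beta> 1 (map s [1..<Suc n]))"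
    using pattern_weight_prod[of \<alpha> \<beta> 1 _ r] by (intro sum.cong refl) (simp add: Suc del: upt_Suc)
  also have "\<dots> = pattern_sum \<alpha> \<beta> 1 {1..n}"
    unfolding pattern_sum_def by (rule sum.reindex_bij_betw[OF bij_permutes_arrangements])
  also have "\<dots> = pattern_number \<alpha> \<beta> 1 n"
    unfolding pattern_number_def using pattern_sum_card[of "{1..n}"] by simp
  finally show ?thesis .
qed

lemma euler_hom_pattern: "euler_hom n u v = pattern_number (\<lambda>_. u) (\<lambda>_. v) 1 n"
proof -
  have e: "u ^ des n s * v ^ (n - 1 - des n s) = (\<Prod>i\<in>{1..<n}. if s i > s (Suc i) then u else v)" for s
  proof -
    have d: "card ({1..<n} \<inter> {i. s i > s (Suc i)}) = des n s"
      unfolding des_def by (rule arg_cong[of _ _ card]) auto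
    have "card ({1..<n} \<inter> - {i. s i > s (Suc i)}) = card {1..<n} - card ({1..<n} \<inter> {i. s i > s (Suc i)})"
      unfolding Diff_eq[symmetric] by (rule card_Diff_subset_Int) simp
    then have "card ({1..<n} \<inter> - {i. s i > s (Suc i)}) = n - 1 - des n s" unfolding d by simp
    then show ?thesis unfolding prod.If_cases[OF finite_atLeastLessThan] prod_constant d by simp
  qed
  show ?thesis unfolding euler_hom_def e by (rule sum_over_permutations)
qed

lemma prod_indicator:
  "finite A \<Longrightarrow> (\<Prod>i\<in>A. if P i then 1 else 0) = (if \<forall>i\<in>A. P i then 1 else (0::real))"
  by (induction A rule: finite_induct) auto

lemma zigzag_pattern:
  "real (zigzag n) = pattern_number (\<lambda>i. if odd i then 1 else 0) (\<lambda>i. if even i then 1 else 0) 1 n"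
proof -
  let ?C = "\<lambda>s i. if odd i then s i > s (Suc i) else s i < s (Suc i)"
  have w: "(\<Prod>i\<in>{1..<n}. if s i > s (Suc i) then (if odd i then 1 else 0) else (if even i then 1 else 0)) =
    (if \<forall>i\<in>{1..<n}. ?C s i then 1 else (0::real))" if s: "s permutes {1..n}" for s :: "nat \<Rightarrow> nat"
  proof -
    have ne: "s i \<noteq> s (Suc i)" for i
      unfolding inj_eq[OF permutes_inj[OF s]] by simp
    have "(\<Prod>i\<in>{1..<n}. if s i > s (Suc i) then (if odd i then 1 else 0) else (if even i then 1 else 0)) =
      (\<Prod>i\<in>{1..<n}. if ?C s i then 1 else (0::real))"
    proof (intro prod.cong refl)
      fix i
      from ne[of i] consider "s i < s (Suc i)" "\<not> s (Suc i) < s i" | "s (Suc i) < s i" "\<not> s i < s (Suc i)" by linarith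
      then show "(if s i > s (Suc i) then (if odd i then 1 else 0) else (if even i then 1 else 0)) =
          (if ?C s i then 1 else (0::real))" by cases simp_all
    qed
    also have "\<dots> = (if \<forall>i\<in>{1..<n}. ?C s i then 1 else 0)"
      by (rule prod_indicator[OF finite_atLeastLessThan])
    finally show ?thesis .
  qed
  have "real (zigzag n) = (\<Sum>s | s permutes {1..n} \<and> (\<forall>i\<in>{1..<n}. ?C s i). 1)"
    unfolding zigzag_def by simp
  also have "\<dots> = (\<Sum>s | s permutes {1..n}. if \<forall>i\<in>{1..<n}. ?C s i then 1 else 0)"
    by (subst sum.inter_filter[symmetric]) (simp_all add: finite_permutations)
  also have "\<dots> = (\<Sum>s | s permutes {1..n}. \<Prod>i\<in>{1..<n}. if s i > s (Suc i) then (if odd i then 1 else 0) else (if even i then 1 else 0))"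
    by (intro sum.cong refl, subst w) simp_all
  finally show ?thesis unfolding sum_over_permutations .
qed

lemma pattern_weight_shift:
  "pattern_weight \<alpha> \<beta> (k + d) xs = pattern_weight (\<lambda>i. \<alpha> (i + d)) (\<lambda>i. \<beta> (i + d)) k xs"
proof (induction "\<lambda>i. \<alpha> (i + d)" "\<lambda>i. \<beta> (i + d)" k xs rule: pattern_weight.induct)
  case (1 k x y xs)
  then show ?case by simp
qed simp_all

lemma pattern_number_shift:
  "pattern_number \<alpha> \<beta> (k + d) n = pattern_number (\<lambda>i. \<alpha> (i + d)) (\<lambda>i. \<beta> (i + d)) k n"
  unfolding pattern_number_def pattern_sum_def pattern_weight_shift ..

lemma binomial_split:
  assumes "k \<le> n"
  shows "real (n choose k) * (x * y) / fact n = (x / fact k) * (y / fact (n - k))"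
  by (simp add: binomial_fact[OF assms] field_simps)

definition euler_coeff :: "real \<Rightarrow> real \<Rightarrow> nat \<Rightarrow> real" where
  "euler_coeff u v n = (if n = 0 then 0 else euler_hom n u v / fact n)"

lemma euler_coeff_Suc:
  "real (Suc n) * euler_coeff u v (Suc n) = (if n = 0 then 1 else 0) + (u + v) * euler_coeff u v n +
    u * v * (\<Sum>k=0..n. euler_coeff u v k * euler_coeff u v (n - k))"
proof -
  let ?H = "\<lambda>n. pattern_number (\<lambda>_. u) (\<lambda>_. v) 1 n"
  let ?e = "euler_coeff u v"
  have shift: "pattern_number (\<lambda>_. u) (\<lambda>_. v) (Suc (1 + k)) m = ?H m" for k m
    using pattern_number_shift[of "\<lambda>_. u" "\<lambda>_. v" 1 "Suc k" m] by simp
  have e: "?e m = ?H m / fact m" if "m \<noteq> 0" for m using that by (simp add: euler_coeff_def euler_hom_pattern)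
  have "real (Suc n) * ?e (Suc n) = ?H (Suc n) / fact n"
    by (simp add: e del: of_nat_Suc)
  also have "\<dots> = (\<Sum>k=0..n. real (n choose k) *
      ((?H k * (if k = 0 then 1 else u) * (if k = n then 1 else v)) * ?H (n - k)) / fact n)"
    unfolding pattern_number_Suc shift sum_divide_distrib ..
  also have "\<dots> = (\<Sum>k=0..n. (?H k * (if k = 0 then 1 else u) * (if k = n then 1 else v)) / fact k * (?H (n - k) / fact (n - k)))"
    by (intro sum.cong refl binomial_split) simp
  also have "\<dots> = (\<Sum>k=0..n. (if k = 0 then (if n = 0 then 1 else v * ?e n) else 0) + (if k = n then u * ?e n else 0) +
      u * v * (?e k * ?e (n - k)))"
  proof (intro sum.cong refl)
    fix k assume k: "k \<in> {0..n}"
    have e0: "?e 0 = 0" by (simp add: euler_coeff_def)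
    consider "n = 0" "k = 0" | "n \<noteq> 0" "k = 0" | "n \<noteq> 0" "k = n" | "k \<noteq> 0" "k < n" using k by fastforce
    then show "(?H k * (if k = 0 then 1 else u) * (if k = n then 1 else v)) / fact k * (?H (n - k) / fact (n - k)) =
      (if k = 0 then (if n = 0 then 1 else v * ?e n) else 0) + (if k = n then u * ?e n else 0) + u * v * (?e k * ?e (n - k))"
      by cases (simp_all add: e0 e)
  qed
  also have "\<dots> = (if n = 0 then 1 else v * ?e n) + u * ?e n + u * v * (\<Sum>k=0..n. ?e k * ?e (n - k))"
    by (simp only: sum.distrib sum_distrib_left[symmetric]) simp
  also have "\<dots> = (if n = 0 then 1 else 0) + (u + v) * ?e n + u * v * (\<Sum>k=0..n. ?e k * ?e (n - k))"
    by (simp add: euler_coeff_def algebra_simps)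
  finally show ?thesis .
qed

definition tangent_coeff :: "nat \<Rightarrow> real" where
  "tangent_coeff n = (if odd n then real (zigzag n) / fact n else 0)"

lemma tangent_coeff_Suc:
  "real (Suc n) * tangent_coeff (Suc n) = (if n = 0 then 1 else 0) +
    (\<Sum>k=0..n. tangent_coeff k * tangent_coeff (n - k))"
proof (cases "odd n")
  case True
  have "tangent_coeff k * tangent_coeff (n - k) = 0" if "k \<in> {0..n}" for k
    using True that by (auto simp: tangent_coeff_def)
  then have "(\<Sum>k=0..n. tangent_coeff k * tangent_coeff (n - k)) = 0" by (intro sum.neutral) blast
  moreover have "tangent_coeff (Suc n) = 0" "n \<noteq> 0" using True by (simp_all add: tangent_coeff_def) (rule odd_pos)
  ultimately show ?thesis by simp
next
  case False
  define A :: "nat \<Rightarrow> real" where "A = (\<lambda>i. if odd i then 1 else 0)"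
  define B :: "nat \<Rightarrow> real" where "B = (\<lambda>i. if even i then 1 else 0)"
  let ?Z = "pattern_number A B 1"
  have z: "tangent_coeff m = (if odd m then ?Z m / fact m else 0)" for m
    by (simp only: tangent_coeff_def zigzag_pattern A_def B_def)
  have shift: "pattern_number A B (Suc (1 + k)) m = ?Z m" if "odd k" for k m
  proof -
    have "(\<lambda>i. A (i + Suc k)) = A" "(\<lambda>i. B (i + Suc k)) = B" using that by (auto simp: A_def B_def fun_eq_iff)
    then show ?thesis using pattern_number_shift[of A B 1 "Suc k" m] by simp
  qed
  have "real (Suc n) * tangent_coeff (Suc n) = ?Z (Suc n) / fact n"
    using False by (simp add: z del: of_nat_Suc)
  also have "\<dots> = (\<Sum>k=0..n. real (n choose k) *
      ((?Z k * (if k = 0 then 1 else A (1 + k - 1)) * (if k = n then 1 else B (1 + k))) * pattern_number A B (Suc (1 + k)) (n - k)) / fact n)"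
    unfolding pattern_number_Suc sum_divide_distrib ..
  also have "\<dots> = (\<Sum>k=0..n. (?Z k * (if k = 0 then 1 else A (1 + k - 1)) * (if k = n then 1 else B (1 + k))) / fact k *
      (pattern_number A B (Suc (1 + k)) (n - k) / fact (n - k)))"
    by (intro sum.cong refl binomial_split) simp
  also have "\<dots> = (\<Sum>k=0..n. (if k = 0 then (if n = 0 then 1 else 0) else 0) + tangent_coeff k * tangent_coeff (n - k))"
  proof (intro sum.cong refl)
    fix k assume k: "k \<in> {0..n}"
    consider "n = 0" "k = 0" | "n \<noteq> 0" "k = 0" | "k \<noteq> 0" "even k" | "odd k" "k < n" "odd (n - k)"
      using k False by fastforce
    then show "(?Z k * (if k = 0 then 1 else A (1 + k - 1)) * (if k = n then 1 else B (1 + k))) / fact k *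
      (pattern_number A B (Suc (1 + k)) (n - k) / fact (n - k)) =
      (if k = 0 then (if n = 0 then 1 else 0) else 0) + tangent_coeff k * tangent_coeff (n - k)"
    proof cases
      case 4
      then have "k \<noteq> 0" "k \<noteq> n" using odd_pos[of k] by auto
      with 4 show ?thesis unfolding shift[OF 4(1)] z by (simp add: A_def B_def)
    qed (simp_all add: z A_def B_def)
  qed
  also have "\<dots> = (if n = 0 then 1 else 0) + (\<Sum>k=0..n. tangent_coeff k * tangent_coeff (n - k))"
    by (simp only: sum.distrib) simp
  finally show ?thesis .
qed

text \<open>The exponential formula over partitions.\<close>

definition partition_weight :: "(nat \<Rightarrow> real) \<Rightarrow> nat multiset \<Rightarrow> real" where
  "partition_weight w M = (\<Prod>j\<in>#M. w j) / (\<Prod>j\<in>set_mset M. fact (count M j))"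

lemma finite_partitions: "finite (partitions m)"
proof -
  have "partitions m \<subseteq> mset ` {xs. set xs \<subseteq> {0..m} \<and> length xs \<le> m}"
  proof
    fix M assume M: "M \<in> partitions m"
    obtain xs where xs: "mset xs = M" using ex_mset by blast
    have "size M \<le> m" using M power_absorb(1)[of M] by (simp add: partitions_def)
    moreover have "j \<le> m" if "j \<in># M" for j
      using M that by (auto simp: partitions_def dest!: multi_member_split)
    ultimately show "M \<in> mset ` {xs. set xs \<subseteq> {0..m} \<and> length xs \<le> m}"
      using xs by (intro image_eqI[of _ _ xs]) auto
  qed
  then show ?thesis by (rule finite_subset) (intro finite_imageI finite_lists_length_le, simp)
qed

lemma partition_weight_remove:
  assumes "j \<in># M"
  shows "real (count M j) * partition_weight w M = w j * partition_weight w (M - {#j#})"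
proof -
  obtain N where M: "M = add_mset j N" using assms by (blast dest: multi_member_split)
  let ?p = "\<lambda>M. \<Prod>i\<in>set_mset M. fact (count M i) :: real"
  have p: "?p M = real (count M j) * ?p N"
  proof -
    have "?p M = fact (count M j) * (\<Prod>i\<in>set_mset M - {j}. fact (count M i))"
      using assms by (intro prod.remove) auto
    also have "(\<Prod>i\<in>set_mset M - {j}. fact (count M i)) = (\<Prod>i\<in>set_mset N - {j}. fact (count N i) :: real)"
      by (intro prod.cong) (auto simp: M)
    also have "fact (count M j) = real (count M j) * (fact (count N j) :: real)"
      by (simp add: M)
    also have "real (count M j) * fact (count N j) * (\<Prod>i\<in>set_mset N - {j}. fact (count N i)) = real (count M j) * ?p N"
    proof (cases "j \<in># N")
      case True
      then show ?thesis by (subst (2) prod.remove[of _ j]) auto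
    next
      case False
      then have "set_mset N - {j} = set_mset N" "count N j = 0" by (auto simp: not_in_iff)
      then show ?thesis by simp
    qed
    finally show ?thesis .
  qed
  have "real (count M j) \<noteq> 0" "?p N \<noteq> 0" using assms by auto
  then show ?thesis unfolding partition_weight_def p by (simp add: M)
qed

lemma partition_sum_rec:
  "real m * (\<Sum>M\<in>partitions m. partition_weight w M) =
    (\<Sum>j=1..m. real j * w j * (\<Sum>M\<in>partitions (m - j). partition_weight w M))"
proof -
  have counts: "sum_mset M = (\<Sum>j\<in>set_mset M. j * count M j)" for M :: "nat multiset"
  proof -
    have "finite A \<Longrightarrow> set_mset M \<subseteq> A \<Longrightarrow> sum_mset M = (\<Sum>j\<in>A. j * count M j)" for A
    proof (induction M)
      case (add x M)
      have "(\<Sum>j\<in>A. j * count (add_mset x M) j) = (\<Sum>j\<in>A. j * count M j + (if j = x then x else 0))"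
        by (intro sum.cong) auto
      then show ?case using add by (simp add: sum.distrib)
    qed simp
    then show ?thesis by simp
  qed
  have size: "real m = (\<Sum>j\<in>set_mset M. real j * real (count M j))" if "M \<in> partitions m" for M
  proof -
    have "m = (\<Sum>j\<in>set_mset M. j * count M j)"
      using that counts[of M] unfolding partitions_def by simp
    then show ?thesis by (metis (mono_tags, lifting) of_nat_mult of_nat_sum sum.cong)
  qed
  have "real m * (\<Sum>M\<in>partitions m. partition_weight w M) =
    (\<Sum>M\<in>partitions m. \<Sum>j\<in>set_mset M. real j * w j * partition_weight w (M - {#j#}))"
    unfolding sum_distrib_left
  proof (rule sum.cong[OF refl])
    fix M assume M: "M \<in> partitions m"
    have "real m * partition_weight w M = (\<Sum>j\<in>set_mset M. real j * (real (count M j) * partition_weight w M))"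
      unfolding size[OF M] sum_distrib_right by (simp only: mult.assoc)
    also have "\<dots> = (\<Sum>j\<in>set_mset M. real j * w j * partition_weight w (M - {#j#}))"
      by (intro sum.cong refl) (simp only: partition_weight_remove mult.assoc)
    finally show "real m * partition_weight w M = (\<Sum>j\<in>set_mset M. real j * w j * partition_weight w (M - {#j#}))" .
  qed
  also have "\<dots> = (\<Sum>(M, j)\<in>(SIGMA M:partitions m. set_mset M). real j * w j * partition_weight w (M - {#j#}))"
    by (rule sum.Sigma) (simp_all add: finite_partitions)
  also have "\<dots> = (\<Sum>(j, N)\<in>(SIGMA j:{1..m}. partitions (m - j)). real j * w j * partition_weight w N)"
  proof (rule sum.reindex_bij_witness[where i = "\<lambda>(j, N). (add_mset j N, j)" and j = "\<lambda>(M, j). (j, M - {#j#})"])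
    fix x assume "x \<in> (SIGMA M:partitions m. set_mset M)"
    then obtain M j where x: "x = (M, j)" and M: "M \<in> partitions m" "j \<in># M" by auto
    obtain N where N: "M = add_mset j N" using M(2) by (blast dest: multi_member_split)
    have "j \<noteq> 0" "0 \<notin># N" "j + sum_mset N = m" using M(1) unfolding N partitions_def by auto
    then show "(case x of (M, j) \<Rightarrow> (j, M - {#j#})) \<in> (SIGMA j:{1..m}. partitions (m - j))"
      by (auto simp: x N partitions_def)
    show "(case case x of (M, j) \<Rightarrow> (j, M - {#j#}) of (j, N) \<Rightarrow> (add_mset j N, j)) = x"
      by (simp add: x N)
    show "(case case x of (M, j) \<Rightarrow> (j, M - {#j#}) of (j, N) \<Rightarrow> real j * w j * partition_weight w N) =
        (case x of (M, j) \<Rightarrow> real j * w j * partition_weight w (M - {#j#}))"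
      by (simp add: x)
  next
    fix y assume "y \<in> (SIGMA j:{1..m}. partitions (m - j))"
    then obtain j N where y: "y = (j, N)" "1 \<le> j" "j \<le> m" "N \<in> partitions (m - j)" by auto
    show "(case case y of (j, N) \<Rightarrow> (add_mset j N, j) of (M, j) \<Rightarrow> (j, M - {#j#})) = y" by (simp add: y)
    show "(case y of (j, N) \<Rightarrow> (add_mset j N, j)) \<in> (SIGMA M:partitions m. set_mset M)"
      using y by (auto simp: partitions_def)
  qed
  also have "\<dots> = (\<Sum>j=1..m. \<Sum>N\<in>partitions (m - j). real j * w j * partition_weight w N)"
    by (rule sum.Sigma[symmetric]) (simp_all add: finite_partitions)
  finally show ?thesis by (simp only: sum_distrib_left)
qed

lemma area_moment_cancelled_partition_weight:
  "area_moment_cancelled m u v = (\<Sum>M\<in>partitions m. partition_weight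
    (\<lambda>j. u * v * (real (zigzag (2 * j - 1)) / (real (2 * j) * (fact (2 * j - 1))\<^sup>2) * euler_hom (2 * j - 1) u v)) M)"
proof -
  have pull: "(\<Prod>j\<in>#M. u * v * f j) = u ^ size M * v ^ size M * (\<Prod>j\<in>#M. f j)" for f :: "nat \<Rightarrow> real" and M
    by (induction M) simp_all
  show ?thesis
    unfolding area_moment_cancelled_def partition_weight_def pull
    by (intro sum.cong refl) (simp only: times_divide_eq_left times_divide_eq_right mult_ac)
qed

lemma partitions_0: "partitions 0 = {{#}}"
  by (auto simp: partitions_def) (metis sum_mset_0_iff multiset_nonemptyE)

(*PART16*)
lemma sigma_identities:
  assumes "\<sigma> \<ge> 1"
  defines "u \<equiv> sigma_plus \<sigma>" and "v \<equiv> sigma_minus \<sigma>" and "g \<equiv> c_plus \<sigma> * c_minus \<sigma> / \<sigma>\<^sup>2"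
  shows "u + v = 1" "g\<^sup>2 = u * v" "\<sigma>\<^sup>2 * g = c_plus \<sigma> * c_minus \<sigma>" "(c_plus \<sigma>)\<^sup>2 + (c_minus \<sigma>)\<^sup>2 = \<sigma>\<^sup>2"
proof -
  have s: "\<sigma> \<noteq> 0" "\<sigma>\<^sup>2 \<ge> 1" using assms(1) by (auto simp: one_le_power)
  show "u + v = 1" by (simp add: u_def v_def sigma_plus_def sigma_minus_def field_simps)
  have c: "(c_plus \<sigma>)\<^sup>2 = (\<sigma>\<^sup>2 + 1) / 2" "(c_minus \<sigma>)\<^sup>2 = (\<sigma>\<^sup>2 - 1) / 2"
    using s by (simp_all add: c_plus_def c_minus_def)
  show "(c_plus \<sigma>)\<^sup>2 + (c_minus \<sigma>)\<^sup>2 = \<sigma>\<^sup>2" unfolding c by (simp add: field_simps)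
  show "\<sigma>\<^sup>2 * g = c_plus \<sigma> * c_minus \<sigma>" using s by (simp add: g_def)
  have "g\<^sup>2 = ((\<sigma>\<^sup>2 + 1) / 2) * ((\<sigma>\<^sup>2 - 1) / 2) / (\<sigma>\<^sup>2)\<^sup>2"
    unfolding g_def power_divide power_mult_distrib c ..
  also have "\<dots> = u * v"
    using s by (simp add: u_def v_def sigma_plus_def sigma_minus_def power2_eq_square field_simps)
  finally show "g\<^sup>2 = u * v" .
qed

definition euler_series :: "real \<Rightarrow> real \<Rightarrow> complex fps" where
  "euler_series u v = Abs_fps (\<lambda>n. of_real (euler_coeff u v n))"

lemma euler_series_deriv:
  "fps_deriv (euler_series u v) = 1 + cst (of_real (u + v)) * euler_series u v +
    cst (of_real (u * v)) * (euler_series u v * euler_series u v)"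
proof (rule fps_ext)
  fix n
  have "fps_deriv (euler_series u v) $ n = complex_of_real (real (Suc n) * euler_coeff u v (Suc n))"
    by (simp add: euler_series_def)
  also have "\<dots> = (1 + cst (of_real (u + v)) * euler_series u v +
      cst (of_real (u * v)) * (euler_series u v * euler_series u v)) $ n"
    unfolding euler_coeff_Suc fps_add_nth cst_mult_nth
    by (simp add: euler_series_def fps_mult_nth)
  finally show "fps_deriv (euler_series u v) $ n = (1 + cst (of_real (u + v)) * euler_series u v +
      cst (of_real (u * v)) * (euler_series u v * euler_series u v)) $ n" .
qed

context time_interval
begin

lemma tangent_nth: "tangent $ n = of_real ((b - a) ^ n * tangent_coeff n)"
proof (induction n rule: less_induct)
  case (less n)
  show ?case
  proof (cases n)
    case 0
    then show ?thesis by (simp add: tangent_0 tangent_coeff_def)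
  next
    case (Suc m)
    have sum: "(tangent * tangent) $ m = of_real ((b - a) ^ m * (\<Sum>k=0..m. tangent_coeff k * tangent_coeff (m - k)))"
    proof -
      have "tangent $ k * tangent $ (m - k) = of_real ((b - a) ^ m * (tangent_coeff k * tangent_coeff (m - k)))"
        if k: "k \<in> {0..m}" for k
      proof -
        have "(b - a) ^ m = (b - a) ^ k * (b - a) ^ (m - k)" using k by (simp flip: power_add)
        then show ?thesis using less[of k] less[of "m - k"] k Suc by (simp add: mult_ac)
      qed
      then show ?thesis unfolding fps_mult_nth by (simp add: sum_distrib_left)
    qed
    have "of_nat (Suc m) * tangent $ Suc m = fps_deriv tangent $ m" by simp
    also have "\<dots> = of_real (b - a) * ((1::complex fps) $ m + (tangent * tangent) $ m)"
      unfolding tangent_deriv cst_mult_nth fps_add_nth ..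
    also have "\<dots> = of_real ((b - a) ^ Suc m * ((if m = 0 then 1 else 0) + (\<Sum>k=0..m. tangent_coeff k * tangent_coeff (m - k))))"
      unfolding sum by (simp add: distrib_left)
    also have "\<dots> = of_real ((b - a) ^ Suc m * (real (Suc m) * tangent_coeff (Suc m)))"
      by (simp only: tangent_coeff_Suc)
    also have "\<dots> = of_nat (Suc m) * of_real ((b - a) ^ Suc m * tangent_coeff (Suc m))"
      by (simp add: mult_ac del: of_nat_Suc)
    finally show ?thesis unfolding Suc by (simp del: of_nat_Suc power_Suc)
  qed
qed

definition moment_series :: "real \<Rightarrow> complex fps" where
  "moment_series \<sigma> = Abs_fps (\<lambda>n. if even n then
     of_real ((b - a) ^ n * area_moment_cancelled (n div 2) (sigma_plus \<sigma>) (sigma_minus \<sigma>)) else 0)"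

lemma moment_series_0: "moment_series \<sigma> $ 0 = 1"
proof -
  have "area_moment_cancelled 0 u v = 1" for u v
    unfolding area_moment_cancelled_partition_weight partitions_0 by (simp add: partition_weight_def)
  then show ?thesis by (simp add: moment_series_def)
qed

text \<open>The logarithmic derivative of the generating function.\<close>

definition log_deriv :: "real \<Rightarrow> complex fps" where
  "log_deriv \<sigma> = Abs_fps (\<lambda>n. of_real (sigma_plus \<sigma> * sigma_minus \<sigma> * (b - a) *
     euler_coeff (sigma_plus \<sigma>) (sigma_minus \<sigma>) n) * tangent $ n)"

lemma moment_series_deriv: "fps_deriv (moment_series \<sigma>) = log_deriv \<sigma> * moment_series \<sigma>"
proof (rule fps_ext)
  fix n
  let ?u = "sigma_plus \<sigma>" and ?v = "sigma_minus \<sigma>"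
  let ?L = "b - a"
  define w where "w = (\<lambda>j. ?u * ?v * (real (zigzag (2 * j - 1)) / (real (2 * j) * (fact (2 * j - 1))\<^sup>2) * euler_hom (2 * j - 1) ?u ?v))"
  define p where "p = (\<lambda>m. \<Sum>M\<in>partitions m. partition_weight w M)"
  have p: "area_moment_cancelled m ?u ?v = p m" for m
    unfolding p_def w_def by (rule area_moment_cancelled_partition_weight)
  have ms: "moment_series \<sigma> $ k = (if even k then of_real (?L ^ k * p (k div 2)) else 0)" for k
    by (simp only: moment_series_def p fps_nth_Abs_fps)
  have ld: "log_deriv \<sigma> $ k = (if odd k then of_real (?L ^ Suc k * (2 * real (Suc k div 2) * w (Suc k div 2))) else 0)" for k
  proof (cases "odd k")
    case True
    then obtain i where i: "k = 2 * i + 1" by (elim oddE)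
    have "real (2 * Suc i) * w (Suc i) = ?u * ?v * (real (zigzag k) / (fact k)\<^sup>2 * euler_hom k ?u ?v)"
      unfolding w_def by (simp add: i del: of_nat_mult fact_Suc of_nat_Suc)
    moreover have "Suc k div 2 = Suc i" using i by simp
    moreover have "euler_coeff ?u ?v k = euler_hom k ?u ?v / fact k" using i by (simp add: euler_coeff_def)
    moreover have "tangent_coeff k = real (zigzag k) / fact k" using True by (simp add: tangent_coeff_def)
    ultimately show ?thesis
      using True by (simp add: log_deriv_def tangent_nth power2_eq_square mult_ac flip: of_real_mult)
  next
    case False
    then show ?thesis by (simp add: log_deriv_def tangent_nth tangent_coeff_def)
  qed
  show "fps_deriv (moment_series \<sigma>) $ n = (log_deriv \<sigma> * moment_series \<sigma>) $ n"
  proof (cases "even n")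
    case True
    have "log_deriv \<sigma> $ k * moment_series \<sigma> $ (n - k) = 0" if "k \<in> {0..n}" for k
      using True that by (cases "odd k") (auto simp: ld ms)
    then have "(log_deriv \<sigma> * moment_series \<sigma>) $ n = 0" unfolding fps_mult_nth by (intro sum.neutral) blast
    then show ?thesis using True by (simp add: ms)
  next
    case False
    then obtain r where r: "n = 2 * r + 1" by (elim oddE)
    have "(log_deriv \<sigma> * moment_series \<sigma>) $ n = (\<Sum>k=0..n. if odd k then log_deriv \<sigma> $ k * moment_series \<sigma> $ (n - k) else 0)"
      unfolding fps_mult_nth by (intro sum.cong refl) (simp add: ld)
    also have "\<dots> = (\<Sum>k | k \<in> {0..n} \<and> odd k. log_deriv \<sigma> $ k * moment_series \<sigma> $ (n - k))"
      by (rule sum.inter_filter[symmetric]) simp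
    also have "\<dots> = (\<Sum>j=1..Suc r. log_deriv \<sigma> $ (2 * j - 1) * moment_series \<sigma> $ (n - (2 * j - 1)))"
      by (rule sum.reindex_bij_witness[where i = "\<lambda>j. 2 * j - 1" and j = "\<lambda>k. Suc k div 2"]) (use r in \<open>auto elim!: oddE\<close>)
    also have "\<dots> = (\<Sum>j=1..Suc r. of_real (?L ^ Suc n * (2 * (real j * w j * p (Suc r - j)))))"
    proof (intro sum.cong refl)
      fix j assume j: "j \<in> {1..Suc r}"
      have o: "odd (2 * j - 1)" "Suc (2 * j - 1) = 2 * j" using j by auto
      have e: "n - (2 * j - 1) = 2 * (Suc r - j)" using j r by auto
      have L: "?L ^ Suc n = ?L ^ (2 * j) * ?L ^ (2 * (Suc r - j))"
        unfolding power_add[symmetric] using j r by (simp add: diff_mult_distrib2)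
      show "log_deriv \<sigma> $ (2 * j - 1) * moment_series \<sigma> $ (n - (2 * j - 1)) =
          of_real (?L ^ Suc n * (2 * (real j * w j * p (Suc r - j))))"
        unfolding ld ms e o(2) L using o(1) by (simp add: mult_ac)
    qed
    also have "\<dots> = of_real (?L ^ Suc n * (2 * (\<Sum>j=1..Suc r. real j * w j * p (Suc r - j))))"
      by (simp only: of_real_sum[symmetric] sum_distrib_left)
    also have "(\<Sum>j=1..Suc r. real j * w j * p (Suc r - j)) = real (Suc r) * p (Suc r)"
      unfolding p_def by (rule partition_sum_rec[symmetric])
    also have "complex_of_real (?L ^ Suc n * (2 * (real (Suc r) * p (Suc r)))) = of_nat (Suc n) * moment_series \<sigma> $ Suc n"
      by (simp add: ms r mult_ac)
    finally show ?thesis by simp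
  qed
qed

lemma area_moments:
  assumes \<sigma>: "\<sigma> \<ge> 1"
  shows "expect (normalized_levy_area \<sigma> a b ^^ n) = fact n * moment_series \<sigma> $ n"
proof -
  let ?u = "sigma_plus \<sigma>" and ?v = "sigma_minus \<sigma>"
  define g where "g = c_plus \<sigma> * c_minus \<sigma> / \<sigma>\<^sup>2"
  note id = sigma_identities[OF \<sigma>, folded g_def]
  define E where "E = euler_series ?u ?v"
  define \<alpha> where "\<alpha> = cst (of_real g) * E"
  define K where "K = series_kernel 0 \<alpha>"
  define c where "c = cst (of_real (c_plus \<sigma>))"
  define d where "d = cst (of_real (c_minus \<sigma>))"
  have \<alpha>0: "\<alpha> $ 0 = 0" by (simp add: \<alpha>_def E_def euler_series_def euler_coeff_def)
  have K: "bounded_kernel K" unfolding K_def by (rule bounded_series_kernel)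
  have K0: "K s t $ 0 = 0" for s t by (simp add: K_def series_kernel_def \<alpha>0)
  have hK: "kernel_comp area_kernel K = series_kernel 1 \<alpha>"
    unfolding area_series_kernel K_def by (subst kernel_comp_series_kernel) (use \<alpha>0 in auto)
  have Kh: "kernel_comp K area_kernel = series_kernel 1 \<alpha>"
    unfolding area_series_kernel K_def by (subst kernel_comp_series_kernel) (use \<alpha>0 in auto)
  have KhK: "kernel_comp K (series_kernel 1 \<alpha>) = series_kernel 1 (\<alpha> * \<alpha>)"
    unfolding K_def by (subst kernel_comp_series_kernel) (use \<alpha>0 in auto)
  have cd: "c * d = cst (of_real (\<sigma>\<^sup>2 * g))" "c * c + d * d = cst (of_real (\<sigma>\<^sup>2))"
    using id(3,4) by (simp_all add: c_def d_def cst_def power2_eq_square flip: of_real_mult of_real_add)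
  have ric: "c * d + (c * c + d * d) * \<alpha> + c * d * (\<alpha> * \<alpha>) = cst (of_real (\<sigma>\<^sup>2)) * fps_deriv \<alpha>"
  proof -
    have gg: "cst (of_real g) * cst (of_real g) = cst (of_real (?u * ?v))"
      using id(2) by (simp add: cst_def power2_eq_square flip: of_real_mult)
    have one: "cst (of_real (?u + ?v)) = 1" unfolding id(1) by (simp add: cst_def)
    have sg: "cst (of_real (\<sigma>\<^sup>2 * g)) = cst (of_real (\<sigma>\<^sup>2)) * cst (of_real g)" by (simp add: cst_def)
    have "fps_deriv \<alpha> = cst (of_real g) * (1 + E + cst (of_real (?u * ?v)) * (E * E))"
      unfolding \<alpha>_def by (simp add: E_def euler_series_deriv[of ?u ?v, unfolded one])
    then show ?thesis
      unfolding cd sg gg[symmetric] \<alpha>_def by (simp add: algebra_simps)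
  qed
  have lin: "cst x * series_kernel 1 1 r s + cst y * series_kernel 1 \<alpha> r s + cst x * series_kernel 1 \<beta> r s =
      series_kernel 1 (cst x + cst y * \<alpha> + cst x * \<beta>) r s" for x y \<beta> r s
  proof -
    have "cst x $ k = x * ((1::complex fps) $ k)" for k by (simp add: cst_def)
    then show ?thesis
      by (intro fps_ext) (simp add: series_kernel_def cst_mult_nth distrib_right mult.assoc del: fps_one_nth)
  qed
  have M: "limit_kernel \<sigma> K r s = cst (of_real (\<sigma>\<^sup>2)) * fps_deriv (K r s)" for r s
  proof -
    have "limit_kernel \<sigma> K r s = c * d * series_kernel 1 1 r s + (c * c + d * d) * series_kernel 1 \<alpha> r s +
        c * d * series_kernel 1 (\<alpha> * \<alpha>) r s"
      unfolding limit_kernel_def Let_def hK Kh KhK c_def[symmetric] d_def[symmetric]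
      by (simp add: area_series_kernel algebra_simps)
    also have "\<dots> = series_kernel 1 (c * d + (c * c + d * d) * \<alpha> + c * d * (\<alpha> * \<alpha>)) r s"
      unfolding cd by (rule lin)
    also have "\<dots> = cst (of_real (\<sigma>\<^sup>2)) * series_kernel 1 (fps_deriv \<alpha>) r s"
      unfolding ric by (rule fps_ext) (simp add: series_kernel_def cst_def)
    finally show ?thesis unfolding K_def fps_deriv_series_kernel .
  qed
  have tr: "limit_trace \<sigma> K * moment_series \<sigma> = cst (of_real (\<sigma>\<^sup>2)) * fps_deriv (moment_series \<sigma>)"
  proof -
    have "limit_trace \<sigma> K = cst (of_real (\<sigma>\<^sup>2)) * log_deriv \<sigma>"
    proof (rule fps_ext)
      fix n
      have gg: "complex_of_real g * complex_of_real g = of_real (?u * ?v)"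
        using id(2) by (simp add: power2_eq_square flip: of_real_mult)
      have "limit_trace \<sigma> K $ n = of_real (\<sigma>\<^sup>2 * g) * (of_real (b - a) * (of_real g * of_real (euler_coeff ?u ?v n) * tangent $ n))"
        unfolding limit_trace_def hK cst_mult_nth kernel_trace_series_kernel id(3)
        by (simp add: \<alpha>_def E_def euler_series_def cst_mult_nth)
      also have "\<dots> = of_real (\<sigma>\<^sup>2) * ((of_real g * of_real g) * of_real (b - a) * of_real (euler_coeff ?u ?v n) * tangent $ n)"
        by (simp only: of_real_mult mult_ac)
      also have "\<dots> = (cst (of_real (\<sigma>\<^sup>2)) * log_deriv \<sigma>) $ n"
        unfolding gg cst_mult_nth log_deriv_def by simp
      finally show "limit_trace \<sigma> K $ n = (cst (of_real (\<sigma>\<^sup>2)) * log_deriv \<sigma>) $ n" .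
    qed
    then show ?thesis by (simp only: moment_series_deriv mult.assoc)
  qed
  have "\<sigma> \<noteq> 0" using \<sigma> by simp
  from levy_area_moments[OF K K0 this M tr moment_series_0] show ?thesis .
qed

end

theorem theorem19:
  fixes \<sigma> a b :: real
  assumes "\<sigma> \<ge> 1" and "0 \<le> a" and "a < b"
  shows "(\<forall>n::nat. odd n \<longrightarrow> expect (normalized_levy_area \<sigma> a b ^^ n) = 0) \<and>
    (\<forall>m::nat. m \<ge> 1 \<longrightarrow>
       (\<sigma> > 1 \<longrightarrow>
          expect (normalized_levy_area \<sigma> a b ^^ (2 * m)) =
            of_real (fact (2 * m) * (b - a) ^ (2 * m) *
              area_moment m (sigma_plus \<sigma>) (sigma_minus \<sigma>))) \<and>
       (\<sigma> = 1 \<longrightarrow>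
          expect (normalized_levy_area \<sigma> a b ^^ (2 * m)) =
            of_real (fact (2 * m) * (b - a) ^ (2 * m) *
              area_moment_cancelled m (sigma_plus \<sigma>) (sigma_minus \<sigma>))))"
proof -
  interpret time_interval a b by unfold_locales (rule assms)+
  have odd: "expect (normalized_levy_area \<sigma> a b ^^ n) = 0" if "odd n" for n
    unfolding area_moments[OF assms(1)] using that by (simp add: moment_series_def)
  have even: "expect (normalized_levy_area \<sigma> a b ^^ (2 * m)) =
      of_real (fact (2 * m) * (b - a) ^ (2 * m) * area_moment_cancelled m (sigma_plus \<sigma>) (sigma_minus \<sigma>))" for m
    unfolding area_moments[OF assms(1)] by (simp add: moment_series_def)
  have "sigma_minus \<sigma> \<noteq> 0" if "\<sigma> > 1"
  proof -
    have "\<sigma>\<^sup>2 > 1" using that by (simp add: one_less_power)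
    then show ?thesis by (simp add: sigma_minus_def)
  qed
  then have cancel: "area_moment_cancelled m (sigma_plus \<sigma>) (sigma_minus \<sigma>) = area_moment m (sigma_plus \<sigma>) (sigma_minus \<sigma>)"
    if "\<sigma> > 1" for m
    using that area_moment_cancelled_eq by blast
  show ?thesis by (intro conjI allI impI odd even) (assumption | simp only: even cancel)+
qed

end
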